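(* Let $(Y_1,Z_1,W_1),\dots,(Y_n,Z_n,W_n)$ be an i.i.d. sample of $(Y,Z,W)$ from the model $Y=\varphi(Z)+U$, $\mathbb E[U\mid W]=0$, with joint distribution of $(Z,W)$ fulfilling Assumption 3. Let Assumptions 1 and 2 be satisfied (all assumptions are written out in the context), and let $h\in\mathcal F_{1/\gamma}$. Suppose that the dimension parameter $m^*_n$ satisfies $$(m^*_n)^3\max\{|\log\mathcal R^h_n|,\,\log m^*_n\}=o(\gamma_{m^*_n})\qquad\text{as }n\to\infty .$$ Then for all $n\ge1$ $$\sup_{T\in\mathcal T_{d,D}^\upsilon}\ \sup_{P_{U|W}\in\mathcal U_\sigma}\ \sup_{\varphi\in\mathcal F_\gamma^\rho}\ \mathbb E|\widehat\ell_{m^*_n}-\ell_h(\varphi)|^2\le\mathcal C\,\mathcal R^h_n$$ for a constant $\mathcal C>0$ depending only on the classes $\mathcal F_\gamma^\rho$, $\mathcal T_{d,D}^\upsilon$, the constants $\sigma,\eta$ and the representer $h$.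
   Context: Model: $Y=\varphi(Z)+U$ with $\mathbb E[U\mid W]=0$ (in general $\mathbb E[U\mid Z]\neq0$). $L^2_Z$, $L^2_W$ are the spaces of square integrable functions of $Z$ and of $W$ with usual inner products $\langle\cdot,\cdot\rangle_Z$, $\langle\cdot,\cdot\rangle_W$. $T:L^2_Z\to L^2_W$, $T\phi=\mathbb E[\phi(Z)\mid W]$, is assumed compact and injective. $\{e_j\}_{j\ge1}$ and $\{f_l\}_{l\ge1}$ are fixed orthonormal bases of $L^2_Z$ and $L^2_W$; $[\phi]_j=\langle\phi,e_j\rangle_Z$, and $[\phi]_{\underline m}$ is the $m$-vector of the first $m$ coefficients. $[T]_{\underline m}$ is the $m\times m$ matrix with entries $[T]_{l,j}=\langle Te_j,f_l\rangle_W$; it is assumed nonsingular for all $m\ge1$. $[e(Z)]_{\underline m}=(e_1(Z),\dots,e_m(Z))^t$, $[f(W)]_{\underline m}=(f_1(W),\dots,f_m(W))^t$. $\|\cdot\|$ denotes the Euclidean norm of vectors and the spectral norm of matrices. For a positive sequence $w$, $\|\phi\|_w^2=\sum_jw_j[\phi]_j^2$, $\mathcal F_w$ is the corresponding (completed) weighted space, identified with coefficient sequences of finite norm, and $\mathcal F_w^r=\{\phi\in\mathcal F_w:\|\phi\|_w^2\le r\}$ ($\rho>0$ is fixed); $1/\gamma=(\gamma_j^{-1})_j$. For $h\in\mathcal F_{1/\gamma}$, $\phi\in\mathcal F_\gamma$: $\ell_h(\phi)=\sum_j[h]_j[\phi]_j$. For $d\ge1$, $\mathcal T_d^\upsilon$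 is the set of compact operators $T:L^2_Z\to L^2_W$ with $\|\phi\|_\upsilon^2/d\le\|T\phi\|_W^2\le d\|\phi\|_\upsilon^2$ for all $\phi\in L^2_Z$; for $D\ge d$, $\mathcal T_{d,D}^\upsilon=\{T\in\mathcal T_d^\upsilon:\sup_{m}\|[\nabla_\upsilon]^{1/2}_{\underline m}[T]_{\underline m}^{-1}\|^2\le D\}$, where $[\nabla_\upsilon]_{\underline m}=\mathrm{diag}(\upsilon_1,\dots,\upsilon_m)$. $\mathcal U_\sigma$ ($\sigma>0$): the conditional distributions $P_{U|W}$ of $U$ given $W$ with $\mathbb E[U\mid W]=0$ and $\mathbb E[U^4\mid W]\le\sigma^4$. The suprema range over joint laws of $(U,Z,W)$ (with $(Z,W)$ fulfilling Assumption 3) and functions $\varphi$ whose conditional expectation operator, conditional law of $U$ given $W$, and $\varphi$ lie in the indicated classes. Estimator: $[\widehat T]_{\underline m}=\frac1n\sum_{i=1}^n[f(W_i)]_{\underline m}[e(Z_i)]_{\underline m}^t$, $[\widehat g]_{\underline m}=\frac1n\sum_{i=1}^nY_i[f(W_i)]_{\underline m}$, and $\widehat\ell_m=[h]_{\underline m}^t[\widehat T]_{\underline m}^{-1}[\widehat g]_{\underline m}$ if $[\widehat T]_{\underline m}$ is nonsingular and $\|[\widehat T]_{\underline m}^{-1}\|\le\sqrt n$, and $\widehat\ell_m=0$ otherwise. Assumption 1 (part on $\gamma,\upsilon$): $\gamma,\upsilon$ are strictly positive with $\gamma_1=\upsilon_1=1$; $\gamma$ is nondecreasing with $j^3\gamma_j^{-1}\to0$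 as $j\to\infty$; $\upsilon$ is nonincreasing with $\lim_j\upsilon_j=0$. For $x\ge1$ let $$m^*_x=\operatorname*{arg\,min}_{m\in\mathbb N}\frac{\max\{\upsilon_m/\gamma_m,x^{-1}\}}{\min\{\upsilon_m/\gamma_m,x^{-1}\}}\ \text{(the smallest minimizer)},\qquad \alpha^*_x=\max\Big\{\frac{\upsilon_{m^*_x}}{\gamma_{m^*_x}},x^{-1}\Big\},$$ $$\mathcal R^h_x=\max\Big\{\alpha^*_x\sum_{j=1}^{m^*_x}\frac{[h]_j^2}{\upsilon_j},\ \sum_{j>m^*_x}\frac{[h]_j^2}{\gamma_j}\Big\}.$$ Assumption 2: $0<\kappa:=\inf_{n\ge1}\big\{(\alpha^*_n)^{-1}\min\{\upsilon_{m^*_n}/\gamma_{m^*_n},n^{-1}\}\big\}\le1$. Assumption 3: there is $\eta\ge1$ such that (i) $\sup_j\mathbb E[e_j^2(Z)\mid W]\le\eta^2$ and $\sup_l\mathbb E[f_l^4(W)]\le\eta^4$; (ii) $\sup_{j,l}\mathbb E|e_j(Z)f_l(W)-\mathbb E[e_j(Z)f_l(W)]|^k\le\eta^kk!$ for $k=3,4,\dots$. *)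

theory Defs
  imports
    "HOL-Probability.Probability"
    "HOL-Library.Landau_Symbols"
    "Jordan_Normal_Form.Gauss_Jordan_Elimination"
begin

text \<open>
  All sequences (bases, weights, coefficient sequences) are indexed by the naturals from 1 on;
  the value at 0 is never used.  The matrices of Jordan_Normal_Form are indexed from 0, whence
  the occurrences of \<^const>\<open>Suc\<close> below.
\<close>


section \<open>Square integrable functions\<close>

text \<open>Elements of the $L^2$-spaces are handled through representatives, up to AE equality.\<close>

definition L2 :: "'a measure \<Rightarrow> ('a \<Rightarrow> real) set" where
  "L2 M = {g \<in> borel_measurable M. integrable M (\<lambda>x. (g x)\<^sup>2)}"

definition ip :: "'a measure \<Rightarrow> ('a \<Rightarrow> real) \<Rightarrow> ('a \<Rightarrow> real) \<Rightarrow> real" where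
  "ip M g g' = (\<integral>x. g x * g' x \<partial>M)"

definition sqnorm :: "'a measure \<Rightarrow> ('a \<Rightarrow> real) \<Rightarrow> real" where
  "sqnorm M g = ip M g g"

definition orthonormal_basis :: "'a measure \<Rightarrow> (nat \<Rightarrow> 'a \<Rightarrow> real) \<Rightarrow> bool" where
  "orthonormal_basis M e \<longleftrightarrow>
     (\<forall>j\<ge>1. e j \<in> L2 M) \<and>
     (\<forall>i\<ge>1. \<forall>j\<ge>1. ip M (e i) (e j) = (if i = j then 1 else 0)) \<and>
     (\<forall>g\<in>L2 M. (\<lambda>m. sqnorm M (\<lambda>x. g x - (\<Sum>j=1..m. ip M g (e j) * e j x))) \<longlonglongrightarrow> 0)"

definition coefs :: "'a measure \<Rightarrow> (nat \<Rightarrow> 'a \<Rightarrow> real) \<Rightarrow> ('a \<Rightarrow> real) \<Rightarrow> nat \<Rightarrow> real" where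
  "coefs M e g j = ip M g (e j)"

definition compact_operator ::
    "'z measure \<Rightarrow> 'w measure \<Rightarrow> (('z \<Rightarrow> real) \<Rightarrow> 'w \<Rightarrow> real) \<Rightarrow> bool" where
  "compact_operator M N T \<longleftrightarrow>
     (\<forall>g\<in>L2 M. T g \<in> L2 N) \<and>
     (\<forall>g\<in>L2 M. \<forall>g'\<in>L2 M. (AE x in M. g x = g' x) \<longrightarrow> (AE y in N. T g y = T g' y)) \<and>
     (\<forall>g\<in>L2 M. \<forall>g'\<in>L2 M. \<forall>a b. AE y in N. T (\<lambda>x. a * g x + b * g' x) y = a * T g y + b * T g' y) \<and>
     (\<forall>s. (\<forall>k. s k \<in> L2 M \<and> sqnorm M (s k) \<le> 1) \<longrightarrow>
        (\<exists>r g. strict_mono (r :: nat \<Rightarrow> nat) \<and> g \<in> L2 N \<and>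
           (\<lambda>k. sqnorm N (\<lambda>y. T (s (r k)) y - g y)) \<longlonglongrightarrow> 0))"


section \<open>Weighted sequence spaces\<close>

definition weighted_space :: "(nat \<Rightarrow> real) \<Rightarrow> (nat \<Rightarrow> real) set" where
  "weighted_space w = {c. (\<lambda>j. w j * (c j)\<^sup>2) summable_on {1..}}"

definition weighted_sqnorm :: "(nat \<Rightarrow> real) \<Rightarrow> (nat \<Rightarrow> real) \<Rightarrow> real" where
  "weighted_sqnorm w c = (\<Sum>\<^sub>\<infinity>j\<in>{1..}. w j * (c j)\<^sup>2)"

text \<open>For nondecreasing positive weights the ellipsoid consists of genuine $L^2$-functions.\<close>

definition ellipsoid ::
    "'z measure \<Rightarrow> (nat \<Rightarrow> 'z \<Rightarrow> real) \<Rightarrow> (nat \<Rightarrow> real) \<Rightarrow> real \<Rightarrow> ('z \<Rightarrow> real) set" where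
  "ellipsoid M e w r =
     {\<phi> \<in> L2 M. coefs M e \<phi> \<in> weighted_space w \<and> weighted_sqnorm w (coefs M e \<phi>) \<le> r}"

definition lin_functional :: "(nat \<Rightarrow> real) \<Rightarrow> (nat \<Rightarrow> real) \<Rightarrow> real" where
  "lin_functional h c = (\<Sum>\<^sub>\<infinity>j\<in>{1..}. h j * c j)"


section \<open>Matrices\<close>

definition euclid_norm :: "real vec \<Rightarrow> real" where
  "euclid_norm v = sqrt (scalar_prod v v)"

definition spectral_norm :: "real mat \<Rightarrow> real" where
  "spectral_norm A =
     (SUP v \<in> {v \<in> carrier_vec (dim_col A). euclid_norm v \<le> 1}. euclid_norm (mult_mat_vec A v))"

text \<open>Only meaningful for matrices satisfying \<^const>\<open>invertible_mat\<close>.\<close>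

definition inv_mat :: "real mat \<Rightarrow> real mat" where
  "inv_mat A = the (mat_inverse A)"

definition op_matrix ::
    "'w measure \<Rightarrow> (nat \<Rightarrow> 'z \<Rightarrow> real) \<Rightarrow> (nat \<Rightarrow> 'w \<Rightarrow> real) \<Rightarrow>
     (('z \<Rightarrow> real) \<Rightarrow> 'w \<Rightarrow> real) \<Rightarrow> nat \<Rightarrow> real mat" where
  "op_matrix N e f T m = mat m m (\<lambda>(l, j). ip N (T (e (Suc j))) (f (Suc l)))"

definition sqrt_diag :: "(nat \<Rightarrow> real) \<Rightarrow> nat \<Rightarrow> real mat" where
  "sqrt_diag \<upsilon> m = mat m m (\<lambda>(l, j). if l = j then sqrt (\<upsilon> (Suc j)) else 0)"


section \<open>Classes of operators\<close>

definition link_class ::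
    "'z measure \<Rightarrow> 'w measure \<Rightarrow> (nat \<Rightarrow> 'z \<Rightarrow> real) \<Rightarrow> (nat \<Rightarrow> real) \<Rightarrow> real \<Rightarrow>
     (('z \<Rightarrow> real) \<Rightarrow> 'w \<Rightarrow> real) set" where
  "link_class M N e \<upsilon> d =
     {T. compact_operator M N T \<and>
         (\<forall>\<phi>\<in>L2 M. weighted_sqnorm \<upsilon> (coefs M e \<phi>) / d \<le> sqnorm N (T \<phi>) \<and>
                   sqnorm N (T \<phi>) \<le> d * weighted_sqnorm \<upsilon> (coefs M e \<phi>))}"

definition ext_link_class ::
    "'z measure \<Rightarrow> 'w measure \<Rightarrow> (nat \<Rightarrow> 'z \<Rightarrow> real) \<Rightarrow> (nat \<Rightarrow> 'w \<Rightarrow> real) \<Rightarrow> (nat \<Rightarrow> real) \<Rightarrow>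
     real \<Rightarrow> real \<Rightarrow> (('z \<Rightarrow> real) \<Rightarrow> 'w \<Rightarrow> real) set" where
  "ext_link_class M N e f \<upsilon> d D =
     {T \<in> link_class M N e \<upsilon> d.
        \<forall>m\<ge>1. invertible_mat (op_matrix N e f T m) \<and>
              (spectral_norm (sqrt_diag \<upsilon> m * inv_mat (op_matrix N e f T m)))\<^sup>2 \<le> D}"


section \<open>Joint laws of (U, Z, W)\<close>

definition joint_law ::
    "'z measure \<Rightarrow> 'w measure \<Rightarrow> (real \<times> 'z \<times> 'w) measure \<Rightarrow> bool" where
  "joint_law MZ MW P \<longleftrightarrow>
     prob_space P \<and> sets P = sets (borel \<Otimes>\<^sub>M MZ \<Otimes>\<^sub>M MW) \<and>
     distr P MZ (\<lambda>(u, z, w). z) = MZ \<and> distr P MW (\<lambda>(u, z, w). w) = MW"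

definition sigma_W ::
    "'w measure \<Rightarrow> (real \<times> 'z \<times> 'w) measure \<Rightarrow> (real \<times> 'z \<times> 'w) measure" where
  "sigma_W MW P = vimage_algebra (space P) (\<lambda>(u, z, w). w) MW"

text \<open>\<open>T \<phi>\<close> is a version of the regression function $w \mapsto E[\phi(Z) \mid W = w]$.\<close>

definition cond_exp_operator ::
    "'z measure \<Rightarrow> 'w measure \<Rightarrow> (real \<times> 'z \<times> 'w) measure \<Rightarrow>
     (('z \<Rightarrow> real) \<Rightarrow> 'w \<Rightarrow> real) \<Rightarrow> bool" where
  "cond_exp_operator MZ MW P T \<longleftrightarrow>
     (\<forall>\<phi>\<in>L2 MZ. T \<phi> \<in> L2 MW \<and>
        (AE (u, z, w) in P.
           T \<phi> w = real_cond_exp P (sigma_W MW P) (\<lambda>(u, z, w). \<phi> z) (u, z, w)))"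

definition noise_class :: "'w measure \<Rightarrow> real \<Rightarrow> (real \<times> 'z \<times> 'w) measure set" where
  "noise_class MW \<sigma> =
     {P. integrable P fst \<and>
         (AE x in P. real_cond_exp P (sigma_W MW P) fst x = 0) \<and>
         (AE x in P. nn_cond_exp P (sigma_W MW P) (\<lambda>(u, z, w). ennreal (u ^ 4)) x \<le> ennreal (\<sigma> ^ 4))}"

definition assumption3 ::
    "'w measure \<Rightarrow> (nat \<Rightarrow> 'z \<Rightarrow> real) \<Rightarrow> (nat \<Rightarrow> 'w \<Rightarrow> real) \<Rightarrow> real \<Rightarrow>
     (real \<times> 'z \<times> 'w) measure \<Rightarrow> bool" where
  "assumption3 MW e f \<eta> P \<longleftrightarrow>
     (\<forall>j\<ge>1. AE x in P.
        nn_cond_exp P (sigma_W MW P) (\<lambda>(u, z, w). ennreal ((e j z)\<^sup>2)) x \<le> ennreal (\<eta>\<^sup>2)) \<and>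
     (\<forall>l\<ge>1. (\<integral>\<^sup>+(u, z, w). ennreal ((f l w) ^ 4) \<partial>P) \<le> ennreal (\<eta> ^ 4)) \<and>
     (\<forall>j\<ge>1. \<forall>l\<ge>1. \<forall>k\<ge>3.
        (\<integral>\<^sup>+(u, z, w). ennreal (\<bar>e j z * f l w - (\<integral>(u', z', w'). e j z' * f l w' \<partial>P)\<bar> ^ k) \<partial>P)
          \<le> ennreal (\<eta> ^ k * fact k))"

text \<open>The joint laws with given conditional expectation operator \<open>T\<close>.\<close>

definition admissible_laws ::
    "'z measure \<Rightarrow> 'w measure \<Rightarrow> (nat \<Rightarrow> 'z \<Rightarrow> real) \<Rightarrow> (nat \<Rightarrow> 'w \<Rightarrow> real) \<Rightarrow> real \<Rightarrow> real \<Rightarrow>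
     (('z \<Rightarrow> real) \<Rightarrow> 'w \<Rightarrow> real) \<Rightarrow> (real \<times> 'z \<times> 'w) measure set" where
  "admissible_laws MZ MW e f \<sigma> \<eta> T =
     {P. joint_law MZ MW P \<and> cond_exp_operator MZ MW P T \<and>
         P \<in> noise_class MW \<sigma> \<and> assumption3 MW e f \<eta> P}"

text \<open>The law of $(Y, Z, W)$ with $Y = \phi(Z) + U$, and of an i.i.d. sample of size \<open>n\<close> from it.\<close>

definition obs_law ::
    "(real \<times> 'z \<times> 'w) measure \<Rightarrow> ('z \<Rightarrow> real) \<Rightarrow> (real \<times> 'z \<times> 'w) measure" where
  "obs_law P \<phi> = distr P P (\<lambda>(u, z, w). (\<phi> z + u, z, w))"

definition sample_law ::
    "(real \<times> 'z \<times> 'w) measure \<Rightarrow> ('z \<Rightarrow> real) \<Rightarrow> nat \<Rightarrow> (nat \<Rightarrow> real \<times> 'z \<times> 'w) measure" where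
  "sample_law P \<phi> n = Pi\<^sub>M {1..n} (\<lambda>_. obs_law P \<phi>)"


section \<open>The estimator\<close>

definition T_hat ::
    "(nat \<Rightarrow> 'z \<Rightarrow> real) \<Rightarrow> (nat \<Rightarrow> 'w \<Rightarrow> real) \<Rightarrow> nat \<Rightarrow> nat \<Rightarrow>
     (nat \<Rightarrow> real \<times> 'z \<times> 'w) \<Rightarrow> real mat" where
  "T_hat e f n m s =
     mat m m (\<lambda>(l, j). (\<Sum>i=1..n. case s i of (y, z, w) \<Rightarrow> f (Suc l) w * e (Suc j) z) / real n)"

definition g_hat ::
    "(nat \<Rightarrow> 'w \<Rightarrow> real) \<Rightarrow> nat \<Rightarrow> nat \<Rightarrow> (nat \<Rightarrow> real \<times> 'z \<times> 'w) \<Rightarrow> real vec" where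
  "g_hat f n m s = vec m (\<lambda>l. (\<Sum>i=1..n. case s i of (y, z, w) \<Rightarrow> y * f (Suc l) w) / real n)"

definition l_hat ::
    "(nat \<Rightarrow> 'z \<Rightarrow> real) \<Rightarrow> (nat \<Rightarrow> 'w \<Rightarrow> real) \<Rightarrow> (nat \<Rightarrow> real) \<Rightarrow> nat \<Rightarrow> nat \<Rightarrow>
     (nat \<Rightarrow> real \<times> 'z \<times> 'w) \<Rightarrow> real" where
  "l_hat e f h n m s =
     (if invertible_mat (T_hat e f n m s) \<and> spectral_norm (inv_mat (T_hat e f n m s)) \<le> sqrt (real n)
      then scalar_prod (vec m (\<lambda>j. h (Suc j))) (mult_mat_vec (inv_mat (T_hat e f n m s)) (g_hat f n m s))
      else 0)"


section \<open>Rates and assumptions on the weights\<close>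

definition m_star :: "(nat \<Rightarrow> real) \<Rightarrow> (nat \<Rightarrow> real) \<Rightarrow> real \<Rightarrow> nat" where
  "m_star \<gamma> \<upsilon> x =
     (LEAST m. is_arg_min (\<lambda>m. max (\<upsilon> m / \<gamma> m) (1 / x) / min (\<upsilon> m / \<gamma> m) (1 / x)) (\<lambda>m. 1 \<le> m) m)"

definition alpha_star :: "(nat \<Rightarrow> real) \<Rightarrow> (nat \<Rightarrow> real) \<Rightarrow> real \<Rightarrow> real" where
  "alpha_star \<gamma> \<upsilon> x = max (\<upsilon> (m_star \<gamma> \<upsilon> x) / \<gamma> (m_star \<gamma> \<upsilon> x)) (1 / x)"

definition rate :: "(nat \<Rightarrow> real) \<Rightarrow> (nat \<Rightarrow> real) \<Rightarrow> (nat \<Rightarrow> real) \<Rightarrow> real \<Rightarrow> real" where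
  "rate \<gamma> \<upsilon> h x =
     max (alpha_star \<gamma> \<upsilon> x * (\<Sum>j=1..m_star \<gamma> \<upsilon> x. (h j)\<^sup>2 / \<upsilon> j))
         (\<Sum>\<^sub>\<infinity>j\<in>{m_star \<gamma> \<upsilon> x<..}. (h j)\<^sup>2 / \<gamma> j)"

definition assumption1 :: "(nat \<Rightarrow> real) \<Rightarrow> (nat \<Rightarrow> real) \<Rightarrow> bool" where
  "assumption1 \<gamma> \<upsilon> \<longleftrightarrow>
     (\<forall>j\<ge>1. 0 < \<gamma> j \<and> 0 < \<upsilon> j) \<and> \<gamma> 1 = 1 \<and> \<upsilon> 1 = 1 \<and>
     mono_on {1..} \<gamma> \<and> (\<lambda>j. real j ^ 3 / \<gamma> j) \<longlonglongrightarrow> 0 \<and>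
     antimono_on {1..} \<upsilon> \<and> \<upsilon> \<longlonglongrightarrow> 0"

definition kappa :: "(nat \<Rightarrow> real) \<Rightarrow> (nat \<Rightarrow> real) \<Rightarrow> real" where
  "kappa \<gamma> \<upsilon> =
     (INF n\<in>{1::nat..}. min (\<upsilon> (m_star \<gamma> \<upsilon> n) / \<gamma> (m_star \<gamma> \<upsilon> n)) (1 / real n) / alpha_star \<gamma> \<upsilon> n)"

definition assumption2 :: "(nat \<Rightarrow> real) \<Rightarrow> (nat \<Rightarrow> real) \<Rightarrow> bool" where
  "assumption2 \<gamma> \<upsilon> \<longleftrightarrow> 0 < kappa \<gamma> \<upsilon> \<and> kappa \<gamma> \<upsilon> \<le> 1"

end

theory Submission
  imports Defs "Jordan_Normal_Form.Determinant"
begin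

text \<open>
  On the event that the matrix \<open>T_hat\<close> is close to its mean, the error splits into a bias, a term
  linear in the averaged residuals and a product of two centred averages; the latter two are
  controlled by second and fourth moments.  The complementary event has probability of order
  $m^2 \exp(- c \gamma_m / m^2)$ by a Chernoff bound, and there the cut-off
  $\sqrt{n}$ on the inverse limits the error to polynomial size, so the growth condition on
  $m^*_n$ makes its contribution negligible.  The balancing assumption 2 provides
  $n \upsilon_m \ge \kappa \gamma_m$ at $m = m^*_n$, which both puts the cut-off out of reach on
  the good event and yields the exponent $\gamma_m / m^2$.  For the finitely many $n$ not covered by
  the asymptotics a crude bound suffices.
\<close>


section \<open>Vectors and matrices\<close>

text \<open>The estimator is compared with the Galerkin solution, the element of the span of the
  first \<open>m\<close> basis functions whose image under \<open>T\<close> has the same first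
  \<open>m\<close> coefficients as \<open>T \<phi>\<close>, and not with the truncated expansion of
  \<open>\<phi>\<close>. With this centre the averaged residuals have mean exactly zero, and the
  deterministic error sits in one bias term. As the basis functions may be unbounded, moments of the
  Galerkin error are obtained from its lying in a \<open>\<gamma>\<close>-ellipsoid of radius
  independent of \<open>m\<close>, together with the summability of \<open>1 / \<gamma> j\<close>.
  The squared error is bounded pointwise by an integrable majorant built from squares and fourth
  powers of averages. Its expectation is computed entry by entry, with products split by weighted
  AM-GM inequalities. On the exceptional event the exponential must beat both
  \<open>\<gamma> m\<close>, which enters through the sum of the squares of \<open>h\<close>, and
  the rate itself, which may be tiny. After a square root, half of the remaining exponent is spent
  on each. All constants are expressions in the class parameters, \<open>h\<close> and the weights,
  so the final one is fixed before bases and laws are chosen.\<close>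

lemma euclid_norm_L2_set: "euclid_norm v = L2_set (vec_index v) {..<dim_vec v}"
  by (simp add: euclid_norm_def scalar_prod_def L2_set_def power2_eq_square lessThan_atLeast0)

lemma euclid_norm_nonneg [simp]: "0 \<le> euclid_norm v"
  by (simp add: euclid_norm_L2_set)

lemma euclid_norm_sq: "(euclid_norm v)\<^sup>2 = (\<Sum>i<dim_vec v. (vec_index v i)\<^sup>2)"
  by (simp add: euclid_norm_L2_set L2_set_def sum_nonneg)

lemma scalar_prod_self: "scalar_prod v v = (euclid_norm v)\<^sup>2" for v :: "real vec"
  unfolding euclid_norm_sq by (simp add: scalar_prod_def power2_eq_square lessThan_atLeast0)

lemma euclid_norm_minus:
  assumes "v \<in> carrier_vec n" "w \<in> carrier_vec n"
  shows "euclid_norm (v - w) \<le> euclid_norm v + euclid_norm w"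
proof -
  have "euclid_norm (v - w) = L2_set (\<lambda>i. vec_index v i + - vec_index w i) {..<n}"
    using assms by (auto simp: euclid_norm_L2_set intro!: L2_set_cong)
  moreover have "L2_set (\<lambda>i. - vec_index w i) {..<n} = L2_set (vec_index w) {..<n}"
    by (simp add: L2_set_def)
  ultimately show ?thesis
    using assms L2_set_triangle_ineq[of "vec_index v" "\<lambda>i. - vec_index w i" "{..<n}"]
    by (auto simp: euclid_norm_L2_set)
qed

lemma abs_scalar_prod_le:
  assumes "v \<in> carrier_vec n" "w \<in> carrier_vec n"
  shows "\<bar>scalar_prod v w\<bar> \<le> euclid_norm v * euclid_norm w"
proof -
  have "\<bar>scalar_prod v w\<bar> \<le> (\<Sum>i<n. \<bar>vec_index v i\<bar> * \<bar>vec_index w i\<bar>)"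
    using assms sum_abs[of "\<lambda>i. vec_index v i * vec_index w i" "{..<n}"]
    by (auto simp: scalar_prod_def lessThan_atLeast0 abs_mult)
  also have "\<dots> \<le> L2_set (vec_index v) {..<n} * L2_set (vec_index w) {..<n}"
    by (rule L2_set_mult_ineq)
  finally show ?thesis using assms by (simp add: euclid_norm_L2_set)
qed

lemma euclid_norm_smult: "euclid_norm (smult_vec a v) = \<bar>a\<bar> * euclid_norm v"
proof -
  have "(euclid_norm (smult_vec a v))\<^sup>2 = (\<bar>a\<bar> * euclid_norm v)\<^sup>2"
    by (simp add: euclid_norm_sq power_mult_distrib sum_distrib_left)
  then show ?thesis by (simp add: power2_eq_iff_nonneg)
qed

lemma euclid_norm_eq_0_iff:
  assumes "v \<in> carrier_vec n"
  shows "euclid_norm v = 0 \<longleftrightarrow> v = 0\<^sub>v n"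
  using assms by (auto simp: euclid_norm_L2_set L2_set_eq_0_iff intro!: eq_vecI)

text \<open>The squared Frobenius norm. It dominates the squared spectral norm and, being a sum over
  entries, reduces matrix errors to moments and tails of single entries.\<close>

definition frob_sq :: "real mat \<Rightarrow> real" where
  "frob_sq A = (\<Sum>i<dim_row A. \<Sum>j<dim_col A. (A $$ (i, j))\<^sup>2)"

lemma frob_sq_nonneg [simp]: "0 \<le> frob_sq A"
  by (simp add: frob_sq_def sum_nonneg)

lemma euclid_norm_mult_mat_vec_le:
  assumes "A \<in> carrier_mat r c" "v \<in> carrier_vec c"
  shows "euclid_norm (mult_mat_vec A v) \<le> sqrt (frob_sq A) * euclid_norm v"
proof (rule power2_le_imp_le)
  have row: "(vec_index (mult_mat_vec A v) i)\<^sup>2 \<le> (\<Sum>j<c. (A $$ (i, j))\<^sup>2) * (euclid_norm v)\<^sup>2"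
    if "i < r" for i
  proof -
    have eq: "(euclid_norm (row A i))\<^sup>2 = (\<Sum>j<c. (A $$ (i, j))\<^sup>2)"
      using assms that by (simp add: euclid_norm_sq)
    have "\<bar>scalar_prod (row A i) v\<bar> \<le> euclid_norm (row A i) * euclid_norm v"
      using assms that by (intro abs_scalar_prod_le[of _ c]) auto
    then have "\<bar>scalar_prod (row A i) v\<bar>\<^sup>2 \<le> (euclid_norm (row A i) * euclid_norm v)\<^sup>2"
      by (intro power_mono) auto
    then show ?thesis using assms that by (simp add: power_mult_distrib eq)
  qed
  have "(euclid_norm (mult_mat_vec A v))\<^sup>2 \<le> (\<Sum>i<r. (\<Sum>j<c. (A $$ (i, j))\<^sup>2) * (euclid_norm v)\<^sup>2)"
    unfolding euclid_norm_sq using assms row[unfolded euclid_norm_sq] by (auto intro!: sum_mono)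
  also have "\<dots> = frob_sq A * (euclid_norm v)\<^sup>2"
    using assms by (simp add: frob_sq_def sum_distrib_right)
  finally show "(euclid_norm (mult_mat_vec A v))\<^sup>2 \<le> (sqrt (frob_sq A) * euclid_norm v)\<^sup>2"
    by (simp add: power_mult_distrib)
qed simp

lemma mult_mat_vec_le_spectral_norm:
  assumes "A \<in> carrier_mat r c" "v \<in> carrier_vec c"
  shows "euclid_norm (mult_mat_vec A v) \<le> spectral_norm A * euclid_norm v"
proof (cases "euclid_norm v = 0")
  case True
  then show ?thesis
    using euclid_norm_mult_mat_vec_le[OF assms] by simp
next
  case False
  define w where "w = smult_vec (1 / euclid_norm v) v"
  have w: "w \<in> carrier_vec c" "euclid_norm w \<le> 1"
    using assms False by (auto simp: w_def euclid_norm_smult)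
  \<comment> \<open>A real \<open>SUP\<close> says nothing unless the set is bounded above; the
    Frobenius norm provides the bound.\<close>
  have "bdd_above ((\<lambda>v. euclid_norm (mult_mat_vec A v)) ` {v \<in> carrier_vec (dim_col A). euclid_norm v \<le> 1})"
  proof (rule bdd_aboveI2)
    fix x assume "x \<in> {v \<in> carrier_vec (dim_col A). euclid_norm v \<le> 1}"
    then have x: "x \<in> carrier_vec c" "euclid_norm x \<le> 1" using assms by auto
    have "euclid_norm (mult_mat_vec A x) \<le> sqrt (frob_sq A) * euclid_norm x"
      by (rule euclid_norm_mult_mat_vec_le) (use assms x in auto)
    also have "\<dots> \<le> sqrt (frob_sq A) * 1" using x by (intro mult_left_mono) auto
    finally show "euclid_norm (mult_mat_vec A x) \<le> sqrt (frob_sq A)" by simp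
  qed
  then have "euclid_norm (mult_mat_vec A w) \<le> spectral_norm A"
    unfolding spectral_norm_def using w assms by (intro cSUP_upper) auto
  moreover have "mult_mat_vec A w = smult_vec (1 / euclid_norm v) (mult_mat_vec A v)"
    using assms by (simp add: w_def mult_mat_vec)
  ultimately have "1 / euclid_norm v * euclid_norm (mult_mat_vec A v) \<le> spectral_norm A"
    by (simp add: euclid_norm_smult)
  moreover have "0 < euclid_norm v" using False euclid_norm_nonneg[of v] by linarith
  ultimately show ?thesis by (simp add: field_simps)
qed

lemma spectral_norm_le:
  assumes "A \<in> carrier_mat r c" "0 \<le> K"
    and "\<And>v. v \<in> carrier_vec c \<Longrightarrow> euclid_norm (mult_mat_vec A v) \<le> K * euclid_norm v"
  shows "spectral_norm A \<le> K"
  unfolding spectral_norm_def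
proof (rule cSUP_least)
  have "0\<^sub>v c \<in> {v \<in> carrier_vec (dim_col A). euclid_norm v \<le> 1}"
    using assms(1) euclid_norm_eq_0_iff[of "0\<^sub>v c" c] by auto
  then show "{v \<in> carrier_vec (dim_col A). euclid_norm v \<le> 1} \<noteq> {}" by blast
next
  fix x assume "x \<in> {v \<in> carrier_vec (dim_col A). euclid_norm v \<le> 1}"
  then have x: "x \<in> carrier_vec c" "euclid_norm x \<le> 1" using assms by auto
  have "euclid_norm (mult_mat_vec A x) \<le> K * euclid_norm x" using assms(3) x by blast
  also have "\<dots> \<le> K * 1" using x assms by (intro mult_left_mono) auto
  finally show "euclid_norm (mult_mat_vec A x) \<le> K" by simp
qed

section \<open>Inverses and their perturbation\<close>

lemma inv_mat:
  assumes "A \<in> carrier_mat m m" "invertible_mat A"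
  shows "inv_mat A \<in> carrier_mat m m" "A * inv_mat A = 1\<^sub>m m" "inv_mat A * A = 1\<^sub>m m"
proof -
  obtain B where B: "A * B = 1\<^sub>m m" "B * A = 1\<^sub>m (dim_row B)"
    using assms by (auto simp: invertible_mat_def inverts_mat_def)
  \<comment> \<open>\<open>invertible_mat\<close> leaves the shape of \<open>B\<close> open; the two
    products determine it.\<close>
  have "dim_row B = m" "dim_col B = m"
    using B assms by (metis carrier_matD(1,2) index_mult_mat(2,3) index_one_mat(2,3))+
  then have "B \<in> carrier_mat m m" "B * A = 1\<^sub>m m" using B by auto
  \<comment> \<open>The specification of \<open>mat_inverse\<close> speaks of units of the matrix
    ring, whose last parameter is an arbitrary dummy.\<close>
  then have "A \<in> Units (ring_mat TYPE(real) m undefined)"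
    using B(1) assms(1) by (auto simp: Units_def ring_mat_def)
  then obtain C where "mat_inverse A = Some C"
    using mat_inverse(1)[OF assms(1), of undefined] by (cases "mat_inverse A") auto
  then show "inv_mat A \<in> carrier_mat m m" "A * inv_mat A = 1\<^sub>m m" "inv_mat A * A = 1\<^sub>m m"
    using mat_inverse(2)[OF assms(1)] by (auto simp: inv_mat_def)
qed

lemma inv_mat_cancel:
  assumes "A \<in> carrier_mat m m" "invertible_mat A" "v \<in> carrier_vec m"
  shows "mult_mat_vec (inv_mat A) (mult_mat_vec A v) = v"
    and "mult_mat_vec A (mult_mat_vec (inv_mat A) v) = v"
  using assms inv_mat[OF assms(1,2)]
  by (simp_all flip: assoc_mult_mat_vec[of _ m m _ m])

lemma invertible_mat_if_inj:
  fixes A :: "real mat"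
  assumes "A \<in> carrier_mat m m"
    and "\<And>v. v \<in> carrier_vec m \<Longrightarrow> mult_mat_vec A v = 0\<^sub>v m \<Longrightarrow> v = 0\<^sub>v m"
  shows "invertible_mat A"
proof -
  have "Determinant.det A \<noteq> 0"
    using det_0_iff_vec_prod_zero_field[OF assms(1)] assms(2) by auto
  from det_non_zero_imp_unit[OF assms(1) this, of undefined]
  have "A \<in> Units (ring_mat TYPE(real) m undefined)" .
  then show ?thesis
    using assms(1) by (auto simp: Units_def ring_mat_def invertible_mat_def inverts_mat_def)
qed

text \<open>Absorption instead of a Neumann series: writing \<open>v\<close> as the inverse of
  \<open>A\<close> applied to \<open>Ah v - (Ah - A) v\<close> bounds the norm of \<open>v\<close>
  by \<open>\<beta>\<close> times that of \<open>Ah v\<close> plus half the norm of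
  \<open>v\<close>. This makes \<open>Ah\<close> injective, hence invertible in finite dimension,
  and the same inequality at a preimage of \<open>v\<close> bounds the inverse.\<close>

lemma perturbed_inverse:
  fixes A Ah :: "real mat"
  assumes A: "A \<in> carrier_mat m m" "invertible_mat A" and Ah: "Ah \<in> carrier_mat m m"
    and \<beta>: "\<And>v. v \<in> carrier_vec m \<Longrightarrow> euclid_norm (mult_mat_vec (inv_mat A) v) \<le> \<beta> * euclid_norm v" "0 \<le> \<beta>"
    and small: "\<beta> * sqrt (frob_sq (Ah - A)) \<le> 1 / 2"
  shows "invertible_mat Ah"
    and "\<And>v. v \<in> carrier_vec m \<Longrightarrow> euclid_norm (mult_mat_vec (inv_mat Ah) v) \<le> 2 * \<beta> * euclid_norm v"
proof -
  let ?B = "inv_mat A" and ?X = "Ah - A"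
  note B = inv_mat[OF A]
  have X: "?X \<in> carrier_mat m m" using A Ah by auto
  have lower: "euclid_norm v \<le> 2 * \<beta> * euclid_norm (mult_mat_vec Ah v)" if v: "v \<in> carrier_vec m" for v
  proof -
    have "mult_mat_vec A v = mult_mat_vec Ah v - mult_mat_vec ?X v"
      using A Ah v by (intro eq_vecI) (auto simp: minus_scalar_prod_distrib[of _ m] row_def minus_mat_def scalar_prod_def sum_subtractf algebra_simps)
    moreover have "v = mult_mat_vec ?B (mult_mat_vec A v)"
      using inv_mat_cancel(1)[OF A v] by simp
    ultimately have "euclid_norm v \<le> \<beta> * euclid_norm (mult_mat_vec Ah v - mult_mat_vec ?X v)"
      using \<beta>(1)[of "mult_mat_vec A v"] A v by (metis mult_mat_vec_carrier)
    also have "\<dots> \<le> \<beta> * (euclid_norm (mult_mat_vec Ah v) + euclid_norm (mult_mat_vec ?X v))"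
      using Ah X v \<beta>(2) by (intro mult_left_mono euclid_norm_minus[of _ m]) auto
    also have "\<dots> \<le> \<beta> * (euclid_norm (mult_mat_vec Ah v) + sqrt (frob_sq ?X) * euclid_norm v)"
      using X v \<beta>(2) by (intro mult_left_mono add_left_mono euclid_norm_mult_mat_vec_le) auto
    also have "\<dots> \<le> \<beta> * euclid_norm (mult_mat_vec Ah v) + 1 / 2 * euclid_norm v"
      using mult_right_mono[OF small, of "euclid_norm v"] by (simp add: algebra_simps)
    finally show ?thesis by simp
  qed
  show inv: "invertible_mat Ah"
  proof (rule invertible_mat_if_inj[OF Ah])
    fix v assume v: "v \<in> carrier_vec m" "mult_mat_vec Ah v = 0\<^sub>v m"
    then have "euclid_norm v = 0"
      using lower[of v] euclid_norm_eq_0_iff[of "0\<^sub>v m" m] euclid_norm_nonneg[of v]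
      by (simp del: euclid_norm_nonneg)
    then show "v = 0\<^sub>v m" using v euclid_norm_eq_0_iff by blast
  qed
  fix v :: "real Matrix.vec" assume v: "v \<in> carrier_vec m"
  note C = inv_mat[OF Ah inv]
  have "mult_mat_vec Ah (mult_mat_vec (inv_mat Ah) v) = v"
    by (rule inv_mat_cancel(2)[OF Ah inv v])
  then show "euclid_norm (mult_mat_vec (inv_mat Ah) v) \<le> 2 * \<beta> * euclid_norm v"
    using lower[of "mult_mat_vec (inv_mat Ah) v"] C v by (metis mult_mat_vec_carrier)
qed

text \<open>Turns the error against an arbitrary centre \<open>c\<close> into the inverse applied to
  a residual; for a good choice of \<open>c\<close> that residual is an average of centred
  variables.\<close>

lemma inv_mat_mult_residual:
  fixes Ah :: "real mat"
  assumes Ah: "Ah \<in> carrier_mat m m" "invertible_mat Ah"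
    and "g \<in> carrier_vec m" "c \<in> carrier_vec m"
  shows "mult_mat_vec (inv_mat Ah) (g - mult_mat_vec Ah c) = mult_mat_vec (inv_mat Ah) g - c"
proof -
  note C = inv_mat[OF Ah]
  have "mult_mat_vec (inv_mat Ah) (mult_mat_vec Ah c) = c"
    by (rule inv_mat_cancel(1)[OF Ah assms(4)])
  moreover have "mult_mat_vec (inv_mat Ah) (g - mult_mat_vec Ah c)
      = mult_mat_vec (inv_mat Ah) g - mult_mat_vec (inv_mat Ah) (mult_mat_vec Ah c)"
    using Ah C assms by (intro mult_minus_distrib_mat_vec) auto
  ultimately show ?thesis by simp
qed

text \<open>For samples where the cut-off on the inverse is the only available information on
  \<open>Ah\<close>.\<close>

lemma plug_in_error_crude:
  fixes Ah :: "real mat"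
  assumes Ah: "Ah \<in> carrier_mat m m" "invertible_mat Ah" "spectral_norm (inv_mat Ah) \<le> s"
    and v: "g \<in> carrier_vec m" "c \<in> carrier_vec m" "a \<in> carrier_vec m"
  shows "\<bar>scalar_prod a (mult_mat_vec (inv_mat Ah) g) - scalar_prod a c\<bar>
      \<le> euclid_norm a * (s * euclid_norm (g - mult_mat_vec Ah c))"
proof -
  let ?V = "g - mult_mat_vec Ah c"
  note C = inv_mat[OF Ah(1,2)]
  have V: "?V \<in> carrier_vec m" using Ah v by auto
  have "scalar_prod a (mult_mat_vec (inv_mat Ah) g) - scalar_prod a c = scalar_prod a (mult_mat_vec (inv_mat Ah) ?V)"
    using inv_mat_mult_residual[OF Ah(1,2) v(1,2)] C v by (simp add: scalar_prod_minus_distrib[of _ m])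
  also have "\<bar>\<dots>\<bar> \<le> euclid_norm a * euclid_norm (mult_mat_vec (inv_mat Ah) ?V)"
    using C v V by (intro abs_scalar_prod_le[of _ m]) auto
  also have "euclid_norm (mult_mat_vec (inv_mat Ah) ?V) \<le> spectral_norm (inv_mat Ah) * euclid_norm ?V"
    using C V by (intro mult_mat_vec_le_spectral_norm) auto
  also have "\<dots> \<le> s * euclid_norm ?V" using Ah by (intro mult_right_mono) auto
  finally show ?thesis by (simp add: mult_left_mono)
qed

text \<open>Let \<open>V\<close> be the residual, \<open>X = Ah - A\<close> and \<open>x\<close> the
  solution of \<open>Ah x = V\<close>. Then \<open>A x = V - X x\<close>, so the product of
  \<open>a\<close> with \<open>x\<close> is that of \<open>b\<close> with \<open>V\<close> minus
  that of \<open>b\<close> with \<open>X x\<close>. Removing the linear term leaves a remainder of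
  second order, a product of matrix error and residual. The vector \<open>b\<close>, the transposed
  inverse of \<open>A\<close> applied to \<open>a\<close>, enters through its defining
  property.\<close>

lemma plug_in_error_fine:
  fixes A Ah :: "real mat"
  assumes A: "A \<in> carrier_mat m m" "invertible_mat A" and Ah: "Ah \<in> carrier_mat m m"
    and \<beta>: "\<And>v. v \<in> carrier_vec m \<Longrightarrow> euclid_norm (mult_mat_vec (inv_mat A) v) \<le> \<beta> * euclid_norm v" "0 \<le> \<beta>"
    and small: "\<beta> * sqrt (frob_sq (Ah - A)) \<le> 1 / 2"
    and v: "g \<in> carrier_vec m" "c \<in> carrier_vec m" "a \<in> carrier_vec m" "b \<in> carrier_vec m"
    and b: "\<And>v. v \<in> carrier_vec m \<Longrightarrow> scalar_prod a (mult_mat_vec (inv_mat A) v) = scalar_prod b v"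
  shows "\<bar>scalar_prod a (mult_mat_vec (inv_mat Ah) g) - scalar_prod a c - scalar_prod b (g - mult_mat_vec Ah c)\<bar>
      \<le> euclid_norm b * (sqrt (frob_sq (Ah - A)) * (2 * \<beta> * euclid_norm (g - mult_mat_vec Ah c)))"
proof -
  let ?V = "g - mult_mat_vec Ah c" and ?X = "Ah - A"
  note pert = perturbed_inverse[OF A Ah \<beta> small]
  note C = inv_mat[OF Ah pert(1)]
  define x where "x = mult_mat_vec (inv_mat Ah) ?V"
  have V: "?V \<in> carrier_vec m" and X: "?X \<in> carrier_mat m m" using A Ah v by auto
  have x: "x \<in> carrier_vec m" using C V by (auto simp: x_def)
  have "mult_mat_vec Ah x = ?V"
    unfolding x_def by (rule inv_mat_cancel(2)[OF Ah pert(1) V])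
  moreover have "mult_mat_vec A x = mult_mat_vec Ah x - mult_mat_vec ?X x"
    using A Ah x by (intro eq_vecI) (auto simp: row_def minus_mat_def scalar_prod_def sum_subtractf algebra_simps)
  ultimately have Ax: "mult_mat_vec A x = ?V - mult_mat_vec ?X x" by simp
  have "scalar_prod a x = scalar_prod b (mult_mat_vec A x)"
    using b[of "mult_mat_vec A x"] A x by (simp add: inv_mat_cancel)
  also have "\<dots> = scalar_prod b ?V - scalar_prod b (mult_mat_vec ?X x)"
    unfolding Ax using v V X x by (intro scalar_prod_minus_distrib[of _ m]) auto
  finally have "scalar_prod a (mult_mat_vec (inv_mat Ah) g) - scalar_prod a c - scalar_prod b ?V
      = - scalar_prod b (mult_mat_vec ?X x)"
    using inv_mat_mult_residual[OF Ah(1) pert(1) v(1,2)] C v by (simp add: x_def scalar_prod_minus_distrib[of _ m])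
  also have "\<bar>\<dots>\<bar> \<le> euclid_norm b * euclid_norm (mult_mat_vec ?X x)"
    using abs_scalar_prod_le[of b m "mult_mat_vec ?X x"] v X x by (metis abs_minus mult_mat_vec_carrier)
  also have "\<dots> \<le> euclid_norm b * (sqrt (frob_sq ?X) * euclid_norm x)"
    using X x by (intro mult_left_mono euclid_norm_mult_mat_vec_le) auto
  also have "\<dots> \<le> euclid_norm b * (sqrt (frob_sq ?X) * (2 * \<beta> * euclid_norm ?V))"
    unfolding x_def using V by (intro mult_left_mono pert) auto
  finally show ?thesis .
qed

section \<open>Weighted bounds for the inverse matrix\<close>

lemma sqrt_diag_mult:
  assumes "B \<in> carrier_mat m m" "v \<in> carrier_vec m" "\<And>j. j < m \<Longrightarrow> 0 < \<upsilon> (Suc j)"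
  shows "(euclid_norm (mult_mat_vec (sqrt_diag \<upsilon> m * B) v))\<^sup>2
      = (\<Sum>j<m. \<upsilon> (Suc j) * (vec_index (mult_mat_vec B v) j)\<^sup>2)"
proof -
  have S: "sqrt_diag \<upsilon> m \<in> carrier_mat m m" by (simp add: sqrt_diag_def)
  have "mult_mat_vec (sqrt_diag \<upsilon> m * B) v = mult_mat_vec (sqrt_diag \<upsilon> m) (mult_mat_vec B v)"
    using S assms by (intro assoc_mult_mat_vec) auto
  moreover have "vec_index (mult_mat_vec (sqrt_diag \<upsilon> m) w) j = sqrt (\<upsilon> (Suc j)) * vec_index w j"
    if "j < m" "w \<in> carrier_vec m" for j w
  proof -
    have "vec_index (mult_mat_vec (sqrt_diag \<upsilon> m) w) j
        = (\<Sum>i\<in>{0..<m}. (if j = i then sqrt (\<upsilon> (Suc i)) * vec_index w i else 0))"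
      using that by (simp add: sqrt_diag_def scalar_prod_def mult_delta_left)
    then show ?thesis using that by simp
  qed
  ultimately show ?thesis
    using assms S by (auto simp: euclid_norm_sq power_mult_distrib less_imp_le intro!: sum.cong)
qed

text \<open>The first bound unfolds the spectral norm. The second is its dual: with \<open>b\<close>
  the transposed inverse applied to \<open>a\<close>, the squared norm of \<open>b\<close> is the
  product of \<open>a\<close> with the inverse applied to \<open>b\<close>. Weighted Cauchy-Schwarz
  and the first bound at \<open>b\<close> then estimate the fourth power of the norm by
  \<open>D\<close> times its square times the weighted sum, and one square cancels.\<close>

lemma
  fixes A :: "real mat"
  assumes A: "A \<in> carrier_mat m m" "invertible_mat A"
    and D: "(spectral_norm (sqrt_diag \<upsilon> m * inv_mat A))\<^sup>2 \<le> D"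
    and \<upsilon>: "\<And>j. j < m \<Longrightarrow> 0 < \<upsilon> (Suc j)"
  shows weighted_inv_le: "\<And>v. v \<in> carrier_vec m \<Longrightarrow>
      (\<Sum>j<m. \<upsilon> (Suc j) * (vec_index (mult_mat_vec (inv_mat A) v) j)\<^sup>2) \<le> D * (euclid_norm v)\<^sup>2"
    and inv_transpose_le: "a \<in> carrier_vec m \<Longrightarrow>
      (euclid_norm (mult_mat_vec (transpose_mat (inv_mat A)) a))\<^sup>2 \<le> D * (\<Sum>j<m. (vec_index a j)\<^sup>2 / \<upsilon> (Suc j))"
proof -
  note B = inv_mat[OF A]
  have S: "sqrt_diag \<upsilon> m * inv_mat A \<in> carrier_mat m m" using B by (auto simp: sqrt_diag_def)
  have D0: "0 \<le> D" using D by (meson order_trans zero_le_power2)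
  show 1: "(\<Sum>j<m. \<upsilon> (Suc j) * (vec_index (mult_mat_vec (inv_mat A) v) j)\<^sup>2) \<le> D * (euclid_norm v)\<^sup>2"
    if v: "v \<in> carrier_vec m" for v
  proof -
    have "(euclid_norm (mult_mat_vec (sqrt_diag \<upsilon> m * inv_mat A) v))\<^sup>2
        \<le> (spectral_norm (sqrt_diag \<upsilon> m * inv_mat A) * euclid_norm v)\<^sup>2"
      using mult_mat_vec_le_spectral_norm[OF S v] by (intro power_mono) auto
    also have "\<dots> \<le> D * (euclid_norm v)\<^sup>2"
      using D by (simp add: power_mult_distrib mult_right_mono)
    finally show ?thesis using sqrt_diag_mult[of "inv_mat A" m v \<upsilon>] B v \<upsilon> by auto
  qed
  assume a: "a \<in> carrier_vec m"
  define b where "b = mult_mat_vec (transpose_mat (inv_mat A)) a"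
  have b: "b \<in> carrier_vec m" using B a by (auto simp: b_def)
  define y where "y = mult_mat_vec (inv_mat A) b"
  have y: "y \<in> carrier_vec m" using B b by (auto simp: y_def)
  define H where "H = (\<Sum>j<m. (vec_index a j)\<^sup>2 / \<upsilon> (Suc j))"
  have H: "0 \<le> H" unfolding H_def using \<upsilon> by (intro sum_nonneg) (auto simp: less_imp_le)
  have "(euclid_norm b)\<^sup>2 = scalar_prod y a"
    unfolding scalar_prod_self[symmetric] y_def
    using transpose_vec_mult_scalar[of "inv_mat A" m m b a] B a b
    by (simp add: b_def comm_scalar_prod[of a m])
  also have "\<dots> = (\<Sum>j<m. (sqrt (\<upsilon> (Suc j)) * vec_index y j) * (vec_index a j / sqrt (\<upsilon> (Suc j))))"
    using a y by (auto simp: scalar_prod_def lessThan_atLeast0 dest!: \<upsilon> intro!: sum.cong)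
  finally have "((euclid_norm b)\<^sup>2)\<^sup>2 = (\<Sum>j<m. (sqrt (\<upsilon> (Suc j)) * vec_index y j) * (vec_index a j / sqrt (\<upsilon> (Suc j))))\<^sup>2"
    by simp
  also have "\<dots> \<le> (\<Sum>j<m. (sqrt (\<upsilon> (Suc j)) * vec_index y j)\<^sup>2) * (\<Sum>j<m. (vec_index a j / sqrt (\<upsilon> (Suc j)))\<^sup>2)"
    by (rule Cauchy_Schwarz_ineq_sum)
  also have "\<dots> = (\<Sum>j<m. \<upsilon> (Suc j) * (vec_index y j)\<^sup>2) * H"
    unfolding H_def using \<upsilon>
    by (intro arg_cong2[where f = "(*)"] sum.cong) (auto simp: power_mult_distrib power_divide less_imp_le)
  also have "\<dots> \<le> (D * (euclid_norm b)\<^sup>2) * H"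
    using 1[OF b] H by (intro mult_right_mono) (auto simp: y_def)
  finally have "(euclid_norm b)\<^sup>2 * (euclid_norm b)\<^sup>2 \<le> (D * H) * (euclid_norm b)\<^sup>2"
    by (simp add: power2_eq_square mult_ac)
  then have "(euclid_norm b)\<^sup>2 \<le> D * H"
    using D0 H mult_right_le_imp_le[of "(euclid_norm b)\<^sup>2" "(euclid_norm b)\<^sup>2" "D * H"]
    by (cases "euclid_norm b = 0") auto
  then show "(euclid_norm (mult_mat_vec (transpose_mat (inv_mat A)) a))\<^sup>2
      \<le> D * (\<Sum>j<m. (vec_index a j)\<^sup>2 / \<upsilon> (Suc j))"
    by (simp add: b_def H_def)
qed

section \<open>Means of independent identically distributed variables\<close>

lemma (in prob_space) integrable_power_le:
  fixes X :: "'a \<Rightarrow> real"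
  assumes "integrable M (\<lambda>x. X x ^ 4)" "X \<in> borel_measurable M" "k \<le> 4"
  shows "integrable M (\<lambda>x. X x ^ k)"
proof (rule Bochner_Integration.integrable_bound)
  show "integrable M (\<lambda>x. 1 + X x ^ 4)" using assms by simp
  have "\<bar>y\<bar> ^ k \<le> 1 + y ^ 4" for y :: real
  proof (cases "\<bar>y\<bar> \<le> 1")
    case True
    then have "\<bar>y\<bar> ^ k \<le> 1" by (intro power_le_one) auto
    then show ?thesis by (smt (verit) zero_le_even_power even_numeral)
  next
    case False
    then have "\<bar>y\<bar> ^ k \<le> \<bar>y\<bar> ^ 4" using assms by (intro power_increasing) auto
    then show ?thesis by simp
  qed
  then show "AE x in M. norm (X x ^ k) \<le> norm (1 + X x ^ 4)"
    by (auto simp: power_abs)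
qed (use assms in measurable)

lemma (in prob_space) expectation_square_le:
  fixes X :: "'a \<Rightarrow> real"
  assumes "integrable M (\<lambda>x. X x ^ 4)" "X \<in> borel_measurable M" "expectation (\<lambda>x. X x ^ 4) \<le> K"
  shows "expectation (\<lambda>x. (X x)\<^sup>2) \<le> sqrt K"
proof -
  have "(expectation (\<lambda>x. (X x)\<^sup>2))\<^sup>2 \<le> expectation (\<lambda>x. ((X x)\<^sup>2)\<^sup>2)"
    using variance_eq[of "\<lambda>x. (X x)\<^sup>2"] variance_positive[of "\<lambda>x. (X x)\<^sup>2"]
      integrable_power_le[OF assms(1,2), of 2] assms(1) by simp
  also have "\<dots> \<le> K" using assms by simp
  finally show ?thesis by (intro real_le_rsqrt)
qed

lemma (in prob_space) indep_var_power_products: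
  fixes X Y :: "'a \<Rightarrow> real"
  assumes "indep_var borel X borel Y"
    "integrable M (\<lambda>x. X x ^ 4)" "integrable M (\<lambda>x. Y x ^ 4)" "k \<le> 4" "l \<le> 4"
  shows "integrable M (\<lambda>x. X x ^ k * Y x ^ l)"
    and "expectation (\<lambda>x. X x ^ k * Y x ^ l) = expectation (\<lambda>x. X x ^ k) * expectation (\<lambda>x. Y x ^ l)"
proof -
  have "indep_var borel ((\<lambda>x. x ^ k) \<circ> X) borel ((\<lambda>x. x ^ l) \<circ> Y)"
    using assms(1) by (rule indep_var_compose) auto
  then have ind: "indep_var borel (\<lambda>x. X x ^ k) borel (\<lambda>x. Y x ^ l)" by (simp add: comp_def)
  have int: "integrable M (\<lambda>x. X x ^ k)" "integrable M (\<lambda>x. Y x ^ l)"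
    using integrable_power_le[of X k] integrable_power_le[of Y l] assms indep_var_rv1[OF assms(1)] indep_var_rv2[OF assms(1)]
    by auto
  show "integrable M (\<lambda>x. X x ^ k * Y x ^ l)"
    "expectation (\<lambda>x. X x ^ k * Y x ^ l) = expectation (\<lambda>x. X x ^ k) * expectation (\<lambda>x. Y x ^ l)"
    using indep_var_integrable[OF ind int] indep_var_lebesgue_integral[OF ind int] by auto
qed

text \<open>Adding one centred summand \<open>X\<close> to \<open>S\<close>, the mixed terms with a
  first power vanish, so the fourth moment gains the one of \<open>X\<close> and six times the
  product of the second moments. By \<open>s\<^sup>2 \<le> K\<close> the latter is at most
  \<open>6 N K\<close> for \<open>N\<close> previous terms, and
  \<open>1 + 3 N\<^sup>2 + 6 N \<le> 3 (N + 1)\<^sup>2\<close> closes the induction. The second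
  moment is carried along because the fourth needs it.\<close>

lemma (in prob_space) indep_sum_moments:
  fixes X :: "'i \<Rightarrow> 'a \<Rightarrow> real" and s :: real
  assumes "finite J" "indep_vars (\<lambda>_. borel) X J"
    and "\<And>i. i \<in> J \<Longrightarrow> integrable M (\<lambda>x. X i x ^ 4)"
    and "\<And>i. i \<in> J \<Longrightarrow> expectation (X i) = 0"
    and "\<And>i. i \<in> J \<Longrightarrow> expectation (\<lambda>x. X i x ^ 4) \<le> K"
    and "\<And>i. i \<in> J \<Longrightarrow> expectation (\<lambda>x. X i x ^ 2) \<le> s" and "s\<^sup>2 \<le> K" "0 \<le> s"
  shows "integrable M (\<lambda>x. (\<Sum>i\<in>J. X i x) ^ 4) \<and> expectation (\<lambda>x. \<Sum>i\<in>J. X i x) = 0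
     \<and> expectation (\<lambda>x. (\<Sum>i\<in>J. X i x)\<^sup>2) \<le> card J * s
     \<and> expectation (\<lambda>x. (\<Sum>i\<in>J. X i x) ^ 4) \<le> 3 * (real (card J))\<^sup>2 * K"
  using assms
proof (induction J rule: finite_induct)
  case empty
  then show ?case by simp
next
  case (insert k F)
  define S where "S x = (\<Sum>i\<in>F. X i x)" for x
  have IH: "integrable M (\<lambda>x. S x ^ 4)" "expectation S = 0"
     "expectation (\<lambda>x. S x ^ 2) \<le> card F * s" "expectation (\<lambda>x. S x ^ 4) \<le> 3 * (card F)\<^sup>2 * K"
    using insert.IH indep_vars_subset[OF insert.prems(1)] insert.prems by (auto simp: S_def[abs_def])
  have K: "0 \<le> K" using insert.prems by (meson order_trans zero_le_power2)
  have X: "integrable M (\<lambda>x. X k x ^ 4)" "expectation (X k) = 0"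
     "expectation (\<lambda>x. X k x ^ 2) \<le> s" "expectation (\<lambda>x. X k x ^ 4) \<le> K"
    using insert.prems by auto
  have ind: "indep_var borel (X k) borel S"
    unfolding S_def by (rule indep_vars_sum) (use insert in auto)
  note P = indep_var_power_products[OF ind X(1) IH(1)]
  \<comment> \<open>First powers are written as \<open>^ 1\<close> so that
    \<open>indep_var_power_products\<close> covers every mixed term.\<close>
  have E0: "expectation (\<lambda>x. X k x ^ 1) = 0" "expectation (\<lambda>x. S x ^ 1) = 0" using X IH by auto
  have rv: "random_variable borel (X k)" "random_variable borel S"
    using indep_var_rv1[OF ind] indep_var_rv2[OF ind] .
  have int: "integrable M (\<lambda>x. X k x ^ i)" "integrable M (\<lambda>x. S x ^ i)" if "i \<le> 4" for i
    using integrable_power_le[of _ i] X IH rv that by auto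
  have e2: "(X k x + S x)\<^sup>2 = X k x ^ 2 + S x ^ 2 + 2 * (X k x ^ 1 * S x ^ 1)" for x
    by (simp add: power2_eq_square algebra_simps)
  have e4: "(X k x + S x) ^ 4 = X k x ^ 4 + S x ^ 4 + 6 * (X k x ^ 2 * S x ^ 2)
      + 4 * (X k x ^ 1 * S x ^ 3) + 4 * (X k x ^ 3 * S x ^ 1)" for x
    by (simp add: eval_nat_numeral algebra_simps)
  have i4: "integrable M (\<lambda>x. (X k x + S x) ^ 4)"
    unfolding e4 using int[of 4] P(1)[of 2 2] P(1)[of 1 3] P(1)[of 3 1] by (intro Bochner_Integration.integrable_add) auto
  have "expectation (\<lambda>x. (X k x + S x)\<^sup>2) = expectation (\<lambda>x. X k x ^ 2) + expectation (\<lambda>x. S x ^ 2)"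
    unfolding e2 using int[of 2] P(1)[of 1 1] P(2)[of 1 1] E0 by simp
  also have "\<dots> \<le> card (insert k F) * s" using X IH insert.hyps by (simp add: algebra_simps)
  finally have v2: "expectation (\<lambda>x. (X k x + S x)\<^sup>2) \<le> card (insert k F) * s" .
  have "expectation (\<lambda>x. (X k x + S x) ^ 4) = expectation (\<lambda>x. X k x ^ 4) + expectation (\<lambda>x. S x ^ 4)
      + 6 * (expectation (\<lambda>x. X k x ^ 2) * expectation (\<lambda>x. S x ^ 2))"
    unfolding e4 using int[of 4] P(1)[of 2 2] P(1)[of 1 3] P(1)[of 3 1]
      P(2)[of 2 2] P(2)[of 1 3] P(2)[of 3 1] E0 by simp
  also have "\<dots> \<le> K + 3 * (card F)\<^sup>2 * K + 6 * (s * (card F * s))"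
    using X IH insert.prems by (intro add_mono mult_left_mono mult_mono) (auto intro!: integral_nonneg)
  also have "\<dots> \<le> K + 3 * (card F)\<^sup>2 * K + 6 * card F * K"
    using mult_left_mono[OF \<open>s\<^sup>2 \<le> K\<close>, of "6 * real (card F)"] by (simp add: power2_eq_square algebra_simps)
  also have "\<dots> \<le> 3 * (card (insert k F))\<^sup>2 * K"
    using insert.hyps K by (simp add: power2_eq_square algebra_simps)
  finally have v4: "expectation (\<lambda>x. (X k x + S x) ^ 4) \<le> 3 * (card (insert k F))\<^sup>2 * K" .
  have "expectation (\<lambda>x. X k x + S x) = 0"
    using int[of 1] X IH by simp
  then show ?case
    using i4 v2 v4 insert.hyps by (simp add: S_def)
qed

section \<open>Averages over an i.i.d. sample\<close>

context
  fixes Q :: "'a measure" and n :: nat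
  assumes Q: "prob_space Q"
begin

lemma prob_space_iid: "prob_space (Pi\<^sub>M {1..n} (\<lambda>_. Q))"
  by (intro prob_space_PiM Q)

lemma iid_component:
  fixes F :: "'a \<Rightarrow> real"
  assumes "F \<in> borel_measurable Q" "i \<in> {1..n}"
  shows "integral\<^sup>L (Pi\<^sub>M {1..n} (\<lambda>_. Q)) (\<lambda>s. F (s i)) = integral\<^sup>L Q F"
    and "integrable (Pi\<^sub>M {1..n} (\<lambda>_. Q)) (\<lambda>s. F (s i)) \<longleftrightarrow> integrable Q F"
proof -
  have meas: "(\<lambda>s. s i) \<in> measurable (Pi\<^sub>M {1..n} (\<lambda>_. Q)) Q" using assms(2) by (rule measurable_component_singleton)
  have eq: "distr (Pi\<^sub>M {1..n} (\<lambda>_. Q)) Q (\<lambda>s. s i) = Q"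
    using distr_PiM_component[of "{1..n}" "\<lambda>_. Q" i] Q assms by simp
  show "integral\<^sup>L (Pi\<^sub>M {1..n} (\<lambda>_. Q)) (\<lambda>s. F (s i)) = integral\<^sup>L Q F"
    using integral_distr[OF meas assms(1)] unfolding eq by simp
  show "integrable (Pi\<^sub>M {1..n} (\<lambda>_. Q)) (\<lambda>s. F (s i)) \<longleftrightarrow> integrable Q F"
    using integrable_distr_eq[OF meas assms(1)] unfolding eq by simp
qed

lemma iid_indep_vars:
  fixes F :: "'a \<Rightarrow> real"
  assumes "F \<in> borel_measurable Q" "1 \<le> n"
  shows "prob_space.indep_vars (Pi\<^sub>M {1..n} (\<lambda>_. Q)) (\<lambda>_. borel) (\<lambda>i s. F (s i)) {1..n}"
proof -
  interpret S: prob_space "Pi\<^sub>M {1..n} (\<lambda>_. Q)" by (rule prob_space_iid)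
  have "S.indep_vars (\<lambda>_. Q) (\<lambda>i s. s i) {1..n}"
  proof (subst S.indep_vars_iff_distr_eq_PiM')
    \<comment> \<open>Elements of the product space are undefined off the index set, so restriction
      to it is the identity there.\<close>
    have "distr (Pi\<^sub>M {1..n} (\<lambda>_. Q)) (Pi\<^sub>M {1..n} (\<lambda>_. Q)) (\<lambda>x. \<lambda>i\<in>{1..n}. x i)
        = distr (Pi\<^sub>M {1..n} (\<lambda>_. Q)) (Pi\<^sub>M {1..n} (\<lambda>_. Q)) (\<lambda>x. x)"
      by (intro distr_cong) (auto simp: space_PiM PiE_def extensional_def restrict_def fun_eq_iff)
    also have "\<dots> = Pi\<^sub>M {1..n} (\<lambda>_. Q)" by simp
    also have "\<dots> = Pi\<^sub>M {1..n} (\<lambda>i. distr (Pi\<^sub>M {1..n} (\<lambda>_. Q)) Q (\<lambda>x. x i))"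
      using distr_PiM_component[of "{1..n}" "\<lambda>_. Q"] Q by (intro PiM_cong) auto
    finally show "distr (Pi\<^sub>M {1..n} (\<lambda>_. Q)) (Pi\<^sub>M {1..n} (\<lambda>_. Q)) (\<lambda>x. \<lambda>i\<in>{1..n}. x i)
      = Pi\<^sub>M {1..n} (\<lambda>i. distr (Pi\<^sub>M {1..n} (\<lambda>_. Q)) Q (\<lambda>x. x i))" .
  qed (use assms in \<open>auto intro: measurable_component_singleton\<close>)
  from S.indep_vars_compose2[OF this, of "\<lambda>_. F" "\<lambda>_. borel"] show ?thesis using assms by simp
qed

lemma iid_mean_moments:
  fixes F :: "'a \<Rightarrow> real"
  assumes F: "F \<in> borel_measurable Q" and "1 \<le> n" and int: "integrable Q (\<lambda>x. F x ^ 4)"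
    and "integral\<^sup>L Q F = 0" "integral\<^sup>L Q (\<lambda>x. F x ^ 4) \<le> K"
  shows "integrable (Pi\<^sub>M {1..n} (\<lambda>_. Q)) (\<lambda>s. ((\<Sum>i=1..n. F (s i)) / n) ^ 4)"
    and "(\<integral>s. ((\<Sum>i=1..n. F (s i)) / n) ^ 4 \<partial>Pi\<^sub>M {1..n} (\<lambda>_. Q)) \<le> 3 * K / (real n)\<^sup>2"
proof -
  interpret Q: prob_space Q by (rule Q)
  interpret S: prob_space "Pi\<^sub>M {1..n} (\<lambda>_. Q)" by (rule prob_space_iid)
  have K: "0 \<le> K" using assms(5) by (rule order_trans[rotated]) auto
  have F2: "integral\<^sup>L Q (\<lambda>x. (F x)\<^sup>2) \<le> sqrt K"
    using Q.expectation_square_le assms by blast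
  note c = iid_component
  have *: "integrable (Pi\<^sub>M {1..n} (\<lambda>_. Q)) (\<lambda>s. (\<Sum>i=1..n. F (s i)) ^ 4) \<and> S.expectation (\<lambda>s. \<Sum>i=1..n. F (s i)) = 0
     \<and> S.expectation (\<lambda>s. (\<Sum>i=1..n. F (s i))\<^sup>2) \<le> card {1..n} * sqrt K
     \<and> S.expectation (\<lambda>s. (\<Sum>i=1..n. F (s i)) ^ 4) \<le> 3 * (real (card {1..n}))\<^sup>2 * K"
    by (rule S.indep_sum_moments[OF _ iid_indep_vars])
      (use assms F2 K c[of "\<lambda>x. F x ^ 4"] c[of "\<lambda>x. F x ^ 2"] c[of F] in auto)
  then show "integrable (Pi\<^sub>M {1..n} (\<lambda>_. Q)) (\<lambda>s. ((\<Sum>i=1..n. F (s i)) / n) ^ 4)"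
    by (simp add: power_divide)
  show "(\<integral>s. ((\<Sum>i=1..n. F (s i)) / n) ^ 4 \<partial>Pi\<^sub>M {1..n} (\<lambda>_. Q)) \<le> 3 * K / (real n)\<^sup>2"
    using * \<open>1 \<le> n\<close> by (simp add: power_divide field_simps eval_nat_numeral)
qed

lemma iid_mean_square:
  fixes F :: "'a \<Rightarrow> real"
  assumes F: "F \<in> borel_measurable Q" and "1 \<le> n" and int: "integrable Q (\<lambda>x. F x ^ 4)"
    and "integral\<^sup>L Q F = 0" "integral\<^sup>L Q (\<lambda>x. F x ^ 2) \<le> s" "0 \<le> s"
  shows "integrable (Pi\<^sub>M {1..n} (\<lambda>_. Q)) (\<lambda>s. ((\<Sum>i=1..n. F (s i)) / n) ^ 2)"
    and "(\<integral>s. ((\<Sum>i=1..n. F (s i)) / n) ^ 2 \<partial>Pi\<^sub>M {1..n} (\<lambda>_. Q)) \<le> s / n"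
proof -
  interpret Q: prob_space Q by (rule Q)
  interpret S: prob_space "Pi\<^sub>M {1..n} (\<lambda>_. Q)" by (rule prob_space_iid)
  \<comment> \<open>\<open>K\<close> only has to satisfy the hypotheses of
    \<open>indep_sum_moments\<close>; the second moment bound extracted here involves
    \<open>s\<close> alone.\<close>
  define K where "K = max (s\<^sup>2) (integral\<^sup>L Q (\<lambda>x. F x ^ 4))"
  note c = iid_component
  have *: "integrable (Pi\<^sub>M {1..n} (\<lambda>_. Q)) (\<lambda>s. (\<Sum>i=1..n. F (s i)) ^ 4) \<and> S.expectation (\<lambda>s. \<Sum>i=1..n. F (s i)) = 0
     \<and> S.expectation (\<lambda>s. (\<Sum>i=1..n. F (s i))\<^sup>2) \<le> card {1..n} * s
     \<and> S.expectation (\<lambda>s. (\<Sum>i=1..n. F (s i)) ^ 4) \<le> 3 * (real (card {1..n}))\<^sup>2 * K"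
    by (rule S.indep_sum_moments[OF _ iid_indep_vars])
      (use assms c[of "\<lambda>x. F x ^ 4"] c[of "\<lambda>x. F x ^ 2"] c[of F] in \<open>auto simp: K_def\<close>)
  have meas: "(\<lambda>s. \<Sum>i=1..n. F (s i)) \<in> borel_measurable (Pi\<^sub>M {1..n} (\<lambda>_. Q))"
    using F by (intro borel_measurable_sum measurable_compose[OF measurable_component_singleton]) auto
  show "integrable (Pi\<^sub>M {1..n} (\<lambda>_. Q)) (\<lambda>s. ((\<Sum>i=1..n. F (s i)) / n) ^ 2)"
    using S.integrable_power_le[OF _ meas, of 2] * by (simp add: power_divide)
  show "(\<integral>s. ((\<Sum>i=1..n. F (s i)) / n) ^ 2 \<partial>Pi\<^sub>M {1..n} (\<lambda>_. Q)) \<le> s / n"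
    using * \<open>1 \<le> n\<close> by (simp add: power_divide field_simps power2_eq_square)
qed

text \<open>Chernoff's bound. With nonnegative integrals, independence enters through the product
  formula and no integrability of the exponentials has to be established.\<close>

lemma iid_mean_upper_tail:
  fixes F :: "'a \<Rightarrow> real" and b c t :: real
  assumes F: "F \<in> borel_measurable Q" and "1 \<le> n" "0 < c" "0 < t"
    and mgf: "(\<integral>\<^sup>+x. ennreal (exp (c * F x)) \<partial>Q) \<le> ennreal (exp (2 * c\<^sup>2 * b))"
  shows "emeasure (Pi\<^sub>M {1..n} (\<lambda>_. Q)) {s \<in> space (Pi\<^sub>M {1..n} (\<lambda>_. Q)). t \<le> (\<Sum>i=1..n. F (s i)) / n}
    \<le> ennreal (exp (- c * (n * t) + 2 * real n * c\<^sup>2 * b))"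
proof -
  let ?S = "Pi\<^sub>M {1..n} (\<lambda>_. Q)"
  interpret S: prob_space ?S by (rule prob_space_iid)
  interpret Q: prob_space Q by (rule Q)
  interpret product_sigma_finite "\<lambda>_. Q" by standard
  have meas: "(\<lambda>s. \<Sum>i=1..n. F (s i)) \<in> borel_measurable ?S"
    using F by (intro borel_measurable_sum measurable_compose[OF measurable_component_singleton]) auto
  have "{s \<in> space ?S. t \<le> (\<Sum>i=1..n. F (s i)) / n} = {s \<in> space ?S. n * t \<le> (\<Sum>i=1..n. F (s i))}"
    using \<open>1 \<le> n\<close> by (auto simp: field_simps)
  also have "emeasure ?S \<dots> \<le> ennreal (exp (- c * (n * t))) *
       (\<integral>\<^sup>+s. ennreal (exp (c * (\<Sum>i=1..n. F (s i)))) * indicator (space ?S) s \<partial>?S)"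
    using meas assms by (intro Chernoff_ineq_nn_integral_ge) auto
  also have "(\<integral>\<^sup>+s. ennreal (exp (c * (\<Sum>i=1..n. F (s i)))) * indicator (space ?S) s \<partial>?S)
      = (\<integral>\<^sup>+s. (\<Prod>i\<in>{1..n}. ennreal (exp (c * F (s i)))) \<partial>?S)"
    by (intro nn_integral_cong) (auto simp: sum_distrib_left exp_sum prod_ennreal)
  also have "\<dots> = (\<Prod>i\<in>{1..n}. \<integral>\<^sup>+x. ennreal (exp (c * F x)) \<partial>Q)"
    using F by (intro product_nn_integral_prod) auto
  also have "\<dots> \<le> (\<Prod>i\<in>{1..n}. ennreal (exp (2 * c\<^sup>2 * b)))"
    using mgf by (simp add: power_mono)
  also have "\<dots> = ennreal (exp (2 * real n * c\<^sup>2 * b))"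
    by (simp add: ennreal_power exp_of_nat_mult[symmetric] mult_ac)
  also have "ennreal (exp (- c * (n * t))) * \<dots> = ennreal (exp (- c * (n * t) + 2 * real n * c\<^sup>2 * b))"
    by (simp only: exp_add ennreal_mult exp_ge_zero)
  finally show ?thesis by (simp add: mult_left_mono)
qed

end

text \<open>A majorant with nonnegative terms permits exchanging sum and integral in
  \<open>mgf_le\<close>. It starts at the second power, the linear part being removed later by
  centring.\<close>

lemma exp_minus_linear_le:
  "ennreal (exp x - 1 - x) \<le> (\<Sum>k. ennreal (\<bar>x\<bar> ^ (k + 2) / fact (k + 2)))" for x :: real
proof -
  have s: "(\<lambda>k. y ^ (k + 2) / fact (k + 2)) sums (exp y - 1 - y)" for y :: real
  proof -
    have "(\<lambda>k. y ^ k / fact k) sums exp y"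
      using exp_converges[of y] by (simp add: divide_inverse mult.commute)
    from sums_split_initial_segment[OF this, of 2]
    have "(\<lambda>k. y ^ (k + 2) / fact (k + 2)) sums (exp y - (\<Sum>i<2. y ^ i / fact i))" .
    moreover have "exp y - (\<Sum>i<2. y ^ i / fact i) = exp y - 1 - y" by (simp add: numeral_2_eq_2)
    ultimately show ?thesis by (simp only:)
  qed
  have "exp x - 1 - x \<le> exp \<bar>x\<bar> - 1 - \<bar>x\<bar>"
  proof (rule sums_le[OF _ s s])
    fix k
    have "x ^ (k + 2) \<le> \<bar>x\<bar> ^ (k + 2)" unfolding power_abs[symmetric] by (rule abs_ge_self)
    then show "x ^ (k + 2) / fact (k + 2) \<le> \<bar>x\<bar> ^ (k + 2) / fact (k + 2)"
      by (rule divide_right_mono) (rule fact_ge_zero)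
  qed
  then have "ennreal (exp x - 1 - x) \<le> ennreal (exp \<bar>x\<bar> - 1 - \<bar>x\<bar>)" by (rule ennreal_leI)
  also have "\<dots> = ennreal (\<Sum>k. \<bar>x\<bar> ^ (k + 2) / fact (k + 2))"
    by (rule arg_cong[OF sums_unique[OF s]])
  also have "\<dots> = (\<Sum>k. ennreal (\<bar>x\<bar> ^ (k + 2) / fact (k + 2)))"
    by (rule suminf_ennreal2[OF _ sums_summable[OF s], symmetric]) (intro divide_nonneg_nonneg zero_le_power abs_ge_zero fact_ge_zero)
  finally show ?thesis .
qed

text \<open>The factorials in the moment bounds cancel those of the exponential series, leaving a
  geometric series in \<open>q = \<bar>c\<bar> * \<eta>\<close>. As \<open>q\<close> is at most one
  half, it is bounded by \<open>2 * q\<^sup>2\<close>; the linear term has expectation zero, and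
  \<open>1 + y \<le> exp y\<close> concludes.\<close>

lemma (in prob_space) mgf_le:
  fixes F :: "'a \<Rightarrow> real" and c \<eta> :: real
  assumes F: "integrable M F" "expectation F = 0"
    and two: "(\<integral>\<^sup>+x. ennreal ((F x)\<^sup>2) \<partial>M) \<le> ennreal (\<eta>\<^sup>2)"
    and moments: "\<And>k. 3 \<le> k \<Longrightarrow> (\<integral>\<^sup>+x. ennreal (\<bar>F x\<bar> ^ k) \<partial>M) \<le> ennreal (\<eta> ^ k * fact k)"
    and c: "\<bar>c\<bar> * \<eta> \<le> 1 / 2" "0 \<le> \<eta>"
  shows "(\<integral>\<^sup>+x. ennreal (exp (c * F x)) \<partial>M) \<le> ennreal (exp (2 * c\<^sup>2 * \<eta>\<^sup>2))"
proof -
  have [measurable]: "F \<in> borel_measurable M" using F by auto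
  define q where "q = \<bar>c\<bar> * \<eta>"
  have q: "0 \<le> q" "q \<le> 1 / 2" using c by (auto simp: q_def)
  have moment: "(\<integral>\<^sup>+x. ennreal (\<bar>c * F x\<bar> ^ (k + 2) / fact (k + 2)) \<partial>M) \<le> ennreal (q ^ (k + 2))" for k
  proof -
    define p where "p = k + 2"
    \<comment> \<open>For \<open>k = 0\<close> the separate second moment bound is sharper than
      required by the factor \<open>fact 2\<close>.\<close>
    have "(\<integral>\<^sup>+x. ennreal (\<bar>F x\<bar> ^ (k + 2)) \<partial>M) \<le> ennreal (\<eta> ^ (k + 2) * fact (k + 2))"
    proof (cases "k = 0")
      case True
      have "ennreal (\<eta>\<^sup>2) \<le> ennreal (\<eta>\<^sup>2 * 2)" by (intro ennreal_leI) simp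
      then show ?thesis using True order_trans[OF two] by (simp add: numeral_2_eq_2)
    qed (use moments[of "k + 2"] in auto)
    then have le: "(\<integral>\<^sup>+x. ennreal (\<bar>F x\<bar> ^ p) \<partial>M) \<le> ennreal (\<eta> ^ p * fact p)" by (simp add: p_def)
    have "(\<integral>\<^sup>+x. ennreal (\<bar>c * F x\<bar> ^ p / fact p) \<partial>M) = (\<integral>\<^sup>+x. ennreal (\<bar>c\<bar> ^ p / fact p) * ennreal (\<bar>F x\<bar> ^ p) \<partial>M)"
      by (intro nn_integral_cong) (simp add: abs_mult power_mult_distrib flip: ennreal_mult)
    also have "\<dots> = ennreal (\<bar>c\<bar> ^ p / fact p) * (\<integral>\<^sup>+x. ennreal (\<bar>F x\<bar> ^ p) \<partial>M)"
      by (rule nn_integral_cmult) measurable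
    also have "\<dots> \<le> ennreal (\<bar>c\<bar> ^ p / fact p) * ennreal (\<eta> ^ p * fact p)"
      using le by (intro mult_left_mono) auto
    also have "\<dots> = ennreal (\<bar>c\<bar> ^ p / fact p * (\<eta> ^ p * fact p))"
      using c by (intro ennreal_mult[symmetric]) auto
    also have "\<bar>c\<bar> ^ p / fact p * (\<eta> ^ p * fact p) = q ^ p"
      by (simp add: q_def power_mult_distrib)
    finally show ?thesis by (simp add: p_def)
  qed
  have "(\<integral>\<^sup>+x. ennreal (exp (c * F x) - 1 - c * F x) \<partial>M)
      \<le> (\<integral>\<^sup>+x. (\<Sum>k. ennreal (\<bar>c * F x\<bar> ^ (k + 2) / fact (k + 2))) \<partial>M)"
    by (intro nn_integral_mono exp_minus_linear_le)
  also have "\<dots> = (\<Sum>k. \<integral>\<^sup>+x. ennreal (\<bar>c * F x\<bar> ^ (k + 2) / fact (k + 2)) \<partial>M)"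
    by (intro nn_integral_suminf) auto
  also have "\<dots> \<le> (\<Sum>k. ennreal (q ^ (k + 2)))"
    using moment by (intro suminf_le) auto
  also have "\<dots> = ennreal (q\<^sup>2 / (1 - q))"
  proof -
    have "(\<lambda>k. q\<^sup>2 * q ^ k) sums (q\<^sup>2 * (1 / (1 - q)))"
      using q by (intro sums_mult geometric_sums) auto
    then have "(\<lambda>k. q ^ (k + 2)) sums (q\<^sup>2 / (1 - q))" by (simp add: power_add power2_eq_square mult_ac)
    then show ?thesis using q by (subst suminf_ennreal2) (auto simp: sums_iff)
  qed
  also have "\<dots> \<le> ennreal (2 * q\<^sup>2)"
  proof (intro ennreal_leI)
    have "q\<^sup>2 \<le> (2 * q\<^sup>2) * (1 - q)"
      using mult_right_mono[of q "1 / 2" "q\<^sup>2"] q by (simp add: algebra_simps)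
    then show "q\<^sup>2 / (1 - q) \<le> 2 * q\<^sup>2" using q by (simp add: pos_divide_le_eq)
  qed
  finally have G: "(\<integral>\<^sup>+x. ennreal (exp (c * F x) - 1 - c * F x) \<partial>M) \<le> ennreal (2 * q\<^sup>2)" .
  have nn: "0 \<le> exp y - 1 - y" for y :: real using exp_ge_add_one_self[of y] by linarith
  have Gi: "integrable M (\<lambda>x. exp (c * F x) - 1 - c * F x)"
    using G nn by (intro integrableI_bounded) (auto intro: le_less_trans)
  have Gle: "expectation (\<lambda>x. exp (c * F x) - 1 - c * F x) \<le> 2 * q\<^sup>2"
    using G nn by (subst (asm) nn_integral_eq_integral[OF Gi]) auto
  have "integrable M (\<lambda>x. (exp (c * F x) - 1 - c * F x) + (1 + c * F x))"
    using Gi F by (intro Bochner_Integration.integrable_add) auto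
  then have ei: "integrable M (\<lambda>x. exp (c * F x))" by simp
  have "expectation (\<lambda>x. (exp (c * F x) - 1 - c * F x) + (1 + c * F x)) \<le> 2 * q\<^sup>2 + 1"
    using Gle F by (subst Bochner_Integration.integral_add[OF Gi]) (auto simp: prob_space)
  then have "expectation (\<lambda>x. exp (c * F x)) \<le> 1 + 2 * q\<^sup>2" by simp
  also have "\<dots> \<le> exp (2 * q\<^sup>2)" by (rule exp_ge_add_one_self)
  finally show ?thesis
    using nn_integral_eq_integral[OF ei] by (auto simp: q_def power_mult_distrib mult.assoc intro: ennreal_leI)
qed

lemma iid_mean_tail:
  fixes F :: "'a \<Rightarrow> real" and n :: nat and t \<eta> :: real
  assumes Q: "prob_space Q" and "1 \<le> n" and F: "integrable Q F" "integral\<^sup>L Q F = 0"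
    and two: "(\<integral>\<^sup>+x. ennreal ((F x)\<^sup>2) \<partial>Q) \<le> ennreal (\<eta>\<^sup>2)"
    and moments: "\<And>k. 3 \<le> k \<Longrightarrow> (\<integral>\<^sup>+x. ennreal (\<bar>F x\<bar> ^ k) \<partial>Q) \<le> ennreal (\<eta> ^ k * fact k)"
    and t: "0 < t" "t \<le> 2 * \<eta>"
  shows "measure (Pi\<^sub>M {1..n} (\<lambda>_. Q)) {s \<in> space (Pi\<^sub>M {1..n} (\<lambda>_. Q)). t \<le> \<bar>(\<Sum>i=1..n. F (s i)) / n\<bar>}
    \<le> 2 * exp (- (n * t\<^sup>2 / (8 * \<eta>\<^sup>2)))"
proof -
  let ?S = "Pi\<^sub>M {1..n} (\<lambda>_. Q)"
  interpret S: prob_space ?S by (rule prob_space_iid[OF Q])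
  have \<eta>: "0 < \<eta>" using t by simp
  \<comment> \<open>This \<open>c\<close> minimises the Chernoff exponent
    \<open>- c * (n * t) + 2 * n * c\<^sup>2 * \<eta>\<^sup>2\<close>, and
    \<open>t \<le> 2 * \<eta>\<close> says precisely that
    \<open>c * \<eta> \<le> 1 / 2\<close>.\<close>
  define c where "c = t / (4 * \<eta>\<^sup>2)"
  have c: "0 < c" "c * \<eta> \<le> 1 / 2" using \<eta> t by (auto simp: c_def field_simps power2_eq_square)
  have "- c * (n * t) + 2 * real n * c\<^sup>2 * \<eta>\<^sup>2 = - n * c * t + 2 * real n * c * (c * \<eta>\<^sup>2)"
    by (simp add: power2_eq_square)
  also have "c * \<eta>\<^sup>2 = t / 4" using \<eta> by (simp add: c_def)
  also have "- n * c * t + 2 * real n * c * (t / 4) = - (n * t\<^sup>2 / (8 * \<eta>\<^sup>2))"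
    by (simp add: c_def power2_eq_square)
  finally have e: "- c * (n * t) + 2 * real n * c\<^sup>2 * \<eta>\<^sup>2 = - (n * t\<^sup>2 / (8 * \<eta>\<^sup>2))" .
  \<comment> \<open>Both tails come from this one statement, used for \<open>F\<close> and for its
    negative.\<close>
  have one: "emeasure ?S {s \<in> space ?S. t \<le> (\<Sum>i=1..n. G (s i)) / n} \<le> ennreal (exp (- (n * t\<^sup>2 / (8 * \<eta>\<^sup>2))))"
    if G: "integrable Q G" "integral\<^sup>L Q G = 0" "\<And>x. \<bar>G x\<bar> = \<bar>F x\<bar>" for G
  proof -
    have "(G x)\<^sup>2 = (F x)\<^sup>2" for x using G(3)[of x] by (metis power2_abs)
    then have "(\<integral>\<^sup>+x. ennreal (exp (c * G x)) \<partial>Q) \<le> ennreal (exp (2 * c\<^sup>2 * \<eta>\<^sup>2))"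
      using c \<eta> two moments G by (intro prob_space.mgf_le[OF Q]) auto
    from iid_mean_upper_tail[OF Q borel_measurable_integrable[OF G(1)] \<open>1 \<le> n\<close> c(1) t(1) this] show ?thesis
      by (simp only: e)
  qed
  have [measurable]: "F \<in> borel_measurable Q" using F by auto
  have meas[measurable]: "(\<lambda>s. \<Sum>i=1..n. F (s i)) \<in> borel_measurable ?S"
    by (intro borel_measurable_sum measurable_compose[OF measurable_component_singleton]) auto
  have "emeasure ?S {s \<in> space ?S. t \<le> \<bar>(\<Sum>i=1..n. F (s i)) / n\<bar>}
     \<le> emeasure ?S ({s \<in> space ?S. t \<le> (\<Sum>i=1..n. F (s i)) / n} \<union> {s \<in> space ?S. t \<le> (\<Sum>i=1..n. - F (s i)) / n})"
    unfolding sum_negf by (intro emeasure_mono) (auto simp: abs_if split: if_splits)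
  also have "\<dots> \<le> emeasure ?S {s \<in> space ?S. t \<le> (\<Sum>i=1..n. F (s i)) / n} + emeasure ?S {s \<in> space ?S. t \<le> (\<Sum>i=1..n. - F (s i)) / n}"
    unfolding sum_negf by (intro emeasure_subadditive) auto
  also have "\<dots> \<le> ennreal (exp (- (n * t\<^sup>2 / (8 * \<eta>\<^sup>2)))) + ennreal (exp (- (n * t\<^sup>2 / (8 * \<eta>\<^sup>2))))"
    using F by (intro add_mono one) auto
  also have "\<dots> = ennreal (2 * exp (- (n * t\<^sup>2 / (8 * \<eta>\<^sup>2))))"
    by (simp add: ennreal_plus[symmetric] del: ennreal_plus)
  finally show ?thesis unfolding S.emeasure_eq_measure by simp
qed

section \<open>Orthonormal expansions\<close>

lemma L2_D: "g \<in> L2 M \<Longrightarrow> g \<in> borel_measurable M" "g \<in> L2 M \<Longrightarrow> integrable M (\<lambda>x. (g x)\<^sup>2)"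
  by (auto simp: L2_def)

lemma abs_mult_le_sum_squares: "\<bar>a * b\<bar> \<le> a\<^sup>2 + b\<^sup>2" for a b :: real
proof -
  have "2 * (\<bar>a\<bar> * \<bar>b\<bar>) \<le> a\<^sup>2 + b\<^sup>2" using sum_squares_bound[of "\<bar>a\<bar>" "\<bar>b\<bar>"] by simp
  moreover have "0 \<le> \<bar>a\<bar> * \<bar>b\<bar>" by simp
  ultimately show ?thesis unfolding abs_mult by linarith
qed

lemma L2_mult_integrable:
  assumes "g \<in> L2 M" "g' \<in> L2 M"
  shows "integrable M (\<lambda>x. g x * g' x)"
proof (rule Bochner_Integration.integrable_bound)
  show "integrable M (\<lambda>x. (g x)\<^sup>2 + (g' x)\<^sup>2)" using assms by (simp add: L2_def)
  show "AE x in M. norm (g x * g' x) \<le> norm ((g x)\<^sup>2 + (g' x)\<^sup>2)"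
    by (simp add: abs_mult_le_sum_squares)
qed (use assms in \<open>auto simp: L2_def\<close>)

lemma L2_cmult: "g \<in> L2 M \<Longrightarrow> (\<lambda>x. a * g x) \<in> L2 M"
  by (auto simp: L2_def power_mult_distrib)

lemma L2_add:
  assumes "g \<in> L2 M" "g' \<in> L2 M"
  shows "(\<lambda>x. g x + g' x) \<in> L2 M"
  using assms L2_mult_integrable[OF assms] by (auto simp: L2_def power2_sum mult.assoc)

lemma L2_sum: "(\<And>i. i \<in> I \<Longrightarrow> g i \<in> L2 M) \<Longrightarrow> (\<lambda>x. \<Sum>i\<in>I. g i x) \<in> L2 M"
proof (induction I rule: infinite_finite_induct)
  case (insert i I)
  then show ?case using L2_add[of "g i" M "\<lambda>x. \<Sum>i\<in>I. g i x"] by simp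
qed (simp_all add: L2_def)

lemma L2_diff:
  assumes "g \<in> L2 M" "g' \<in> L2 M"
  shows "(\<lambda>x. g x - g' x) \<in> L2 M"
  using L2_add[OF assms(1) L2_cmult[OF assms(2), of "-1"]] by simp

lemma ip_commute: "ip M g g' = ip M g' g"
  by (simp add: ip_def mult.commute)

lemma ip_diff:
  assumes "g \<in> L2 M" "g' \<in> L2 M" "k \<in> L2 M"
  shows "ip M (\<lambda>x. g x - g' x) k = ip M g k - ip M g' k"
  using assms by (simp add: ip_def left_diff_distrib L2_mult_integrable)

lemma ip_cmult:
  "ip M (\<lambda>x. a * g x) k = a * ip M g k"
  by (simp add: ip_def mult.assoc)

lemma ip_sum:
  assumes "\<And>i. i \<in> I \<Longrightarrow> g i \<in> L2 M" "k \<in> L2 M"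
  shows "ip M (\<lambda>x. \<Sum>i\<in>I. g i x) k = (\<Sum>i\<in>I. ip M (g i) k)"
  using assms by (simp add: ip_def sum_distrib_right L2_mult_integrable)

section \<open>Partial sums of an orthonormal expansion\<close>

context
  fixes M :: "'a measure" and e :: "nat \<Rightarrow> 'a \<Rightarrow> real"
  assumes onb: "orthonormal_basis M e"
begin

lemma onb_L2: "1 \<le> j \<Longrightarrow> e j \<in> L2 M"
  and onb_ip: "1 \<le> i \<Longrightarrow> 1 \<le> j \<Longrightarrow> ip M (e i) (e j) = (if i = j then 1 else 0)"
  using onb by (auto simp: orthonormal_basis_def)

lemma onb_sum_L2: "(\<lambda>x. \<Sum>j=1..m. c j * e j x) \<in> L2 M"
  by (intro L2_sum L2_cmult onb_L2) auto

lemma coefs_sum: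
  assumes "1 \<le> i"
  shows "ip M (\<lambda>x. \<Sum>j=1..m. c j * e j x) (e i) = (if i \<le> m then c i else 0)"
proof -
  have "ip M (\<lambda>x. \<Sum>j=1..m. c j * e j x) (e i) = (\<Sum>j=1..m. c j * (if j = i then 1 else 0))"
    using assms by (subst ip_sum) (auto intro!: L2_cmult onb_L2 sum.cong simp: ip_cmult onb_ip)
  then show ?thesis using assms by (simp add: if_distrib cong: if_cong)
qed

lemma onb_sum_sqnorm: "sqnorm M (\<lambda>x. \<Sum>j=1..m. c j * e j x) = (\<Sum>j=1..m. (c j)\<^sup>2)"
proof -
  have "sqnorm M (\<lambda>x. \<Sum>j=1..m. c j * e j x) = (\<Sum>i=1..m. ip M (\<lambda>x. c i * e i x) (\<lambda>x. \<Sum>j=1..m. c j * e j x))"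
    unfolding sqnorm_def by (intro ip_sum onb_sum_L2 L2_cmult onb_L2) auto
  also have "\<dots> = (\<Sum>i=1..m. (c i)\<^sup>2)"
    by (intro sum.cong) (auto simp: ip_cmult ip_commute[of M "e _"] coefs_sum power2_eq_square simp del: One_nat_def)
  finally show ?thesis .
qed

lemma bessel:
  assumes g: "g \<in> L2 M"
  shows "(\<Sum>j=1..m. (ip M g (e j))\<^sup>2) \<le> sqnorm M g"
proof -
  let ?S = "\<lambda>x. \<Sum>j=1..m. ip M g (e j) * e j x"
  have S: "?S \<in> L2 M" by (rule onb_sum_L2)
  have gS: "ip M g ?S = (\<Sum>j=1..m. (ip M g (e j))\<^sup>2)"
    unfolding ip_commute[of M g] by (subst ip_sum) (auto intro!: L2_cmult onb_L2 g sum.cong simp: ip_cmult ip_commute[of M g] power2_eq_square)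
  have "0 \<le> sqnorm M (\<lambda>x. g x - ?S x)" by (simp add: sqnorm_def ip_def)
  also have "\<dots> = ip M g (\<lambda>x. g x - ?S x) - ip M ?S (\<lambda>x. g x - ?S x)"
    unfolding sqnorm_def by (intro ip_diff g S L2_diff)
  also have "\<dots> = sqnorm M g - ip M g ?S - (ip M g ?S - sqnorm M ?S)"
    unfolding ip_commute[of M _ "\<lambda>x. g x - ?S x"] using ip_diff[OF g S] g S by (simp add: sqnorm_def ip_commute)
  also have "\<dots> = sqnorm M g - (\<Sum>j=1..m. (ip M g (e j))\<^sup>2)"
    unfolding gS onb_sum_sqnorm by simp
  finally show ?thesis by simp
qed

text \<open>Mean square convergence gives almost everywhere convergence along a subsequence, which
  is enough to carry pointwise bounds from partial sums to the limit.\<close>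

lemma onb_AE_subseq:
  assumes g: "g \<in> L2 M"
  shows "\<exists>r. strict_mono r \<and> (AE x in M. (\<lambda>k. \<Sum>j=1..r k. ip M g (e j) * e j x) \<longlonglongrightarrow> g x)"
proof -
  let ?d = "\<lambda>k x. g x - (\<Sum>j=1..k. ip M g (e j) * e j x)"
  have "?d k \<in> L2 M" for k by (intro L2_diff g onb_sum_L2)
  then have "integrable M (\<lambda>x. (?d k x)\<^sup>2)" for k by (rule L2_D)
  moreover have "(\<lambda>k. \<integral>x. norm ((?d k x)\<^sup>2) \<partial>M) \<longlonglongrightarrow> 0"
    using onb g by (simp add: orthonormal_basis_def sqnorm_def ip_def power2_eq_square)
  ultimately obtain r where r: "strict_mono r" "AE x in M. (\<lambda>k. (?d (r k) x)\<^sup>2) \<longlonglongrightarrow> 0"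
    using tendsto_L1_AE_subseq[of M "\<lambda>k x. (?d k x)\<^sup>2"] by blast
  have "AE x in M. (\<lambda>k. \<Sum>j=1..r k. ip M g (e j) * e j x) \<longlonglongrightarrow> g x"
    using r(2)
  proof eventually_elim
    case (elim x)
    then have "(\<lambda>k. sqrt ((?d (r k) x)\<^sup>2)) \<longlonglongrightarrow> sqrt 0" by (intro tendsto_real_sqrt)
    then have "(\<lambda>k. ?d (r k) x) \<longlonglongrightarrow> 0" by (simp add: tendsto_rabs_zero_iff)
    then have "(\<lambda>k. g x - ?d (r k) x) \<longlonglongrightarrow> g x - 0" by (intro tendsto_intros)
    then show ?case by simp
  qed
  then show ?thesis using r(1) by blast
qed

text \<open>The left side passes to the limit by continuity of \<open>F\<close>, while the right
  side is majorised by the full series. In the extended nonnegative reals that series may diverge at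
  some points without harm.\<close>

lemma onb_AE_le_suminf:
  fixes F :: "real \<Rightarrow> real"
  assumes g: "g \<in> L2 M" and F: "\<And>x. isCont F x"
    and q: "\<And>j x. 0 \<le> q j x" and A: "0 \<le> A"
    and bound: "\<And>k x. F (\<Sum>j=1..k. ip M g (e j) * e j x) \<le> A * (\<Sum>j=1..k. q j x)"
  shows "AE x in M. ennreal (F (g x)) \<le> ennreal A * (\<Sum>j. ennreal (q (Suc j) x))"
proof -
  obtain r where "AE x in M. (\<lambda>k. \<Sum>j=1..r k. ip M g (e j) * e j x) \<longlonglongrightarrow> g x"
    using onb_AE_subseq[OF g] by blast
  then show ?thesis
  proof eventually_elim
    case (elim x)
    then have "(\<lambda>k. F (\<Sum>j=1..r k. ip M g (e j) * e j x)) \<longlonglongrightarrow> F (g x)"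
      using F by (rule isCont_tendsto_compose[rotated])
    then have "(\<lambda>k. ennreal (F (\<Sum>j=1..r k. ip M g (e j) * e j x))) \<longlonglongrightarrow> ennreal (F (g x))"
      by (intro tendsto_ennrealI)
    moreover have "ennreal (F (\<Sum>j=1..r k. ip M g (e j) * e j x)) \<le> ennreal A * (\<Sum>j. ennreal (q (Suc j) x))" for k
    proof -
      have "ennreal (F (\<Sum>j=1..r k. ip M g (e j) * e j x)) \<le> ennreal (A * (\<Sum>j=1..r k. q j x))"
        by (intro ennreal_leI bound)
      also have "\<dots> = ennreal A * (\<Sum>j=1..r k. ennreal (q j x))"
        using A q by (simp add: ennreal_mult sum_ennreal sum_nonneg)
      also have "(\<Sum>j=1..r k. ennreal (q j x)) = (\<Sum>j<r k. ennreal (q (Suc j) x))"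
        unfolding One_nat_def by (rule sum.atLeast1_atMost_eq)
      also have "\<dots> \<le> (\<Sum>j. ennreal (q (Suc j) x))" by (intro sum_le_suminf) auto
      finally show ?thesis by (simp add: mult_left_mono)
    qed
    ultimately show ?case by (intro LIMSEQ_le_const2) auto
  qed
qed

text \<open>Weighting the Cauchy-Schwarz inequality by $\gamma$ gives access to the fourth moment of the
  approximation error although the basis functions need not be bounded.\<close>

lemma onb_AE_power_bounds:
  assumes g: "g \<in> L2 M" and \<gamma>: "\<And>j. 1 \<le> j \<Longrightarrow> 0 < \<gamma> j" and A: "0 \<le> A" and G: "0 \<le> G"
    and gA: "\<And>k. (\<Sum>j=1..k. \<gamma> j * (ip M g (e j))\<^sup>2) \<le> A"
    and \<gamma>G: "\<And>k. (\<Sum>j=1..k. 1 / \<gamma> j) \<le> G"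
  shows "AE x in M. ennreal ((g x)\<^sup>2) \<le> ennreal A * (\<Sum>j. ennreal ((e (Suc j) x)\<^sup>2 / \<gamma> (Suc j)))"
    and "AE x in M. ennreal ((g x) ^ 4) \<le> ennreal (A\<^sup>2 * G) * (\<Sum>j. ennreal ((e (Suc j) x) ^ 4 / \<gamma> (Suc j)))"
proof -
  \<comment> \<open>Cauchy-Schwarz after moving a factor \<open>sqrt (\<gamma> j)\<close> from the
    basis function to its coefficient.\<close>
  have two: "(\<Sum>j=1..k. ip M g (e j) * e j x)\<^sup>2 \<le> A * (\<Sum>j=1..k. (e j x)\<^sup>2 / \<gamma> j)" for k x
  proof -
    have "(\<Sum>j=1..k. ip M g (e j) * e j x)\<^sup>2 = (\<Sum>j=1..k. (sqrt (\<gamma> j) * ip M g (e j)) * (e j x / sqrt (\<gamma> j)))\<^sup>2"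
    proof (intro arg_cong[where f = "\<lambda>x. x\<^sup>2"] sum.cong)
      fix j assume "j \<in> {1..k}"
      then have "\<gamma> j > 0" using \<gamma> by simp
      then show "ip M g (e j) * e j x = (sqrt (\<gamma> j) * ip M g (e j)) * (e j x / sqrt (\<gamma> j))" by simp
    qed simp
    also have "\<dots> \<le> (\<Sum>j=1..k. (sqrt (\<gamma> j) * ip M g (e j))\<^sup>2) * (\<Sum>j=1..k. (e j x / sqrt (\<gamma> j))\<^sup>2)"
      by (rule Cauchy_Schwarz_ineq_sum)
    also have "\<dots> = (\<Sum>j=1..k. \<gamma> j * (ip M g (e j))\<^sup>2) * (\<Sum>j=1..k. (e j x)\<^sup>2 / \<gamma> j)"
      using \<gamma> by (intro arg_cong2[where f = "(*)"] sum.cong) (auto simp: power_mult_distrib power_divide less_imp_le)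
    also have "\<dots> \<le> A * (\<Sum>j=1..k. (e j x)\<^sup>2 / \<gamma> j)"
      using \<gamma> by (intro mult_right_mono gA sum_nonneg) (auto simp: less_imp_le)
    finally show ?thesis .
  qed
  \<comment> \<open>The square of the previous bound, followed by a second Cauchy-Schwarz that
    splits \<open>1 / \<gamma> j\<close> into two square roots; this is where the sum of the
    \<open>1 / \<gamma> j\<close> appears.\<close>
  have four: "(\<Sum>j=1..k. ip M g (e j) * e j x) ^ 4 \<le> (A\<^sup>2 * G) * (\<Sum>j=1..k. (e j x) ^ 4 / \<gamma> j)" for k x
  proof -
    have "(\<Sum>j=1..k. ip M g (e j) * e j x) ^ 4 = ((\<Sum>j=1..k. ip M g (e j) * e j x)\<^sup>2)\<^sup>2" by simp
    also have "\<dots> \<le> (A * (\<Sum>j=1..k. (e j x)\<^sup>2 / \<gamma> j))\<^sup>2" by (intro power_mono two) simp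
    also have "\<dots> = A\<^sup>2 * (\<Sum>j=1..k. (1 / sqrt (\<gamma> j)) * ((e j x)\<^sup>2 / sqrt (\<gamma> j)))\<^sup>2"
      using \<gamma> by (auto simp: power_mult_distrib less_imp_le intro!: arg_cong[where f = "\<lambda>x. x\<^sup>2"] sum.cong)
    also have "\<dots> \<le> A\<^sup>2 * ((\<Sum>j=1..k. (1 / sqrt (\<gamma> j))\<^sup>2) * (\<Sum>j=1..k. ((e j x)\<^sup>2 / sqrt (\<gamma> j))\<^sup>2))"
      by (intro mult_left_mono Cauchy_Schwarz_ineq_sum) simp
    also have "\<dots> = A\<^sup>2 * ((\<Sum>j=1..k. 1 / \<gamma> j) * (\<Sum>j=1..k. (e j x) ^ 4 / \<gamma> j))"
      using \<gamma> by (intro arg_cong2[where f = "(*)"] sum.cong) (auto simp: power_divide less_imp_le)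
    also have "\<dots> \<le> A\<^sup>2 * (G * (\<Sum>j=1..k. (e j x) ^ 4 / \<gamma> j))"
      using \<gamma> by (intro mult_left_mono mult_right_mono \<gamma>G sum_nonneg) (auto simp: less_imp_le)
    finally show ?thesis by (simp add: mult.assoc)
  qed
  \<comment> \<open>Nonnegativity is required at every index, whereas \<open>\<gamma>\<close> is
    known to be positive only from 1 on; hence the value 0 at index 0.\<close>
  define q where "q i j x = (if j = 0 then 0 else (e j x) ^ i / \<gamma> j)" for i j x
  have q: "0 \<le> q i j x" if "even i" for i j x using that \<gamma>[of j] by (auto simp: q_def zero_le_even_power)
  have qs: "(\<Sum>j=1..k. q i j x) = (\<Sum>j=1..k. (e j x) ^ i / \<gamma> j)" for i k x
    by (auto simp: q_def intro!: sum.cong)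
  show "AE x in M. ennreal ((g x)\<^sup>2) \<le> ennreal A * (\<Sum>j. ennreal ((e (Suc j) x)\<^sup>2 / \<gamma> (Suc j)))"
  proof -
    have "AE x in M. ennreal ((g x)\<^sup>2) \<le> ennreal A * (\<Sum>j. ennreal (q 2 (Suc j) x))"
    proof (rule onb_AE_le_suminf[OF g _ _ A])
      show "(\<Sum>j=1..k. ip M g (e j) * e j x)\<^sup>2 \<le> A * (\<Sum>j=1..k. q 2 j x)" for k x
        unfolding qs by (rule two)
    qed (auto intro!: q)
    then show ?thesis by (simp only: q_def nat.simps if_False)
  qed
  show "AE x in M. ennreal ((g x) ^ 4) \<le> ennreal (A\<^sup>2 * G) * (\<Sum>j. ennreal ((e (Suc j) x) ^ 4 / \<gamma> (Suc j)))"
  proof -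
    have "AE x in M. ennreal ((g x) ^ 4) \<le> ennreal (A\<^sup>2 * G) * (\<Sum>j. ennreal (q 4 (Suc j) x))"
    proof (rule onb_AE_le_suminf[OF g])
      show "(\<Sum>j=1..k. ip M g (e j) * e j x) ^ 4 \<le> (A\<^sup>2 * G) * (\<Sum>j=1..k. q 4 j x)" for k x
        unfolding qs by (rule four)
    qed (use A G in \<open>auto intro!: q\<close>)
    then show ?thesis by (simp only: q_def nat.simps if_False)
  qed
qed

end

section \<open>Moments under an admissible law\<close>

lemma power4_sum_le: "(a + b) ^ 4 \<le> 8 * (a ^ 4 + b ^ 4)" for a b :: real
proof -
  have "(a + b)\<^sup>2 \<le> 2 * (a\<^sup>2 + b\<^sup>2)" using sum_squares_bound[of a b] by (simp add: power2_sum)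
  then have "((a + b)\<^sup>2)\<^sup>2 \<le> (2 * (a\<^sup>2 + b\<^sup>2))\<^sup>2" by (intro power_mono) auto
  also have "\<dots> \<le> 4 * (2 * ((a\<^sup>2)\<^sup>2 + (b\<^sup>2)\<^sup>2))"
    using sum_squares_bound[of "a\<^sup>2" "b\<^sup>2"] by (simp add: power_mult_distrib power2_sum)
  finally show ?thesis by simp
qed

locale joint_model =
  fixes MZ :: "'z measure" and MW :: "'w measure" and e :: "nat \<Rightarrow> 'z \<Rightarrow> real" and f :: "nat \<Rightarrow> 'w \<Rightarrow> real"
    and \<sigma> \<eta> :: real and T :: "('z \<Rightarrow> real) \<Rightarrow> 'w \<Rightarrow> real" and P :: "(real \<times> 'z \<times> 'w) measure"
  assumes onb_e: "orthonormal_basis MZ e" and onb_f: "orthonormal_basis MW f"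
    and P: "P \<in> admissible_laws MZ MW e f \<sigma> \<eta> T"
    and \<sigma>: "0 < \<sigma>" and \<eta>: "1 \<le> \<eta>"
begin

section \<open>Coordinates and conditional moments\<close>

lemma joint_law: "joint_law MZ MW P" and noise: "P \<in> noise_class MW \<sigma>"
  and ass3: "assumption3 MW e f \<eta> P" and ce: "cond_exp_operator MZ MW P T"
  using P by (auto simp: admissible_laws_def)

sublocale P: prob_space P
  using joint_law by (simp add: joint_law_def)

text \<open>Projections replace the tuple patterns of the definitions;
  \<open>case_prod_beta'\<close> translates between the two.\<close>

abbreviation (input) uu :: "real \<times> 'z \<times> 'w \<Rightarrow> real" where "uu x \<equiv> fst x"
abbreviation (input) zz :: "real \<times> 'z \<times> 'w \<Rightarrow> 'z" where "zz x \<equiv> fst (snd x)"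
abbreviation (input) ww :: "real \<times> 'z \<times> 'w \<Rightarrow> 'w" where "ww x \<equiv> snd (snd x)"

lemma sets_P [measurable_cong]: "sets P = sets (borel \<Otimes>\<^sub>M MZ \<Otimes>\<^sub>M MW)"
  using joint_law by (simp add: joint_law_def)

lemma distr_Z: "distr P MZ (\<lambda>x. zz x) = MZ" and distr_W: "distr P MW (\<lambda>x. ww x) = MW"
  using joint_law by (simp_all add: joint_law_def case_prod_beta')

lemma measurable_proj [measurable]:
  "(\<lambda>x. uu x) \<in> borel_measurable P" "(\<lambda>x. zz x) \<in> measurable P MZ" "(\<lambda>x. ww x) \<in> measurable P MW"
  by measurable

lemma nn_integral_W: "H \<in> borel_measurable MW \<Longrightarrow> (\<integral>\<^sup>+x. H (ww x) \<partial>P) = (\<integral>\<^sup>+w. H w \<partial>MW)"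
  using nn_integral_distr[OF measurable_proj(3), of H] by (simp add: distr_W)

lemma integral_W: "G \<in> borel_measurable MW \<Longrightarrow> (\<integral>x. G (ww x) \<partial>P) = (\<integral>w. G w \<partial>MW)" for G :: "'w \<Rightarrow> real"
  using integral_distr[OF measurable_proj(3), of G] by (simp add: distr_W)

lemma integral_Z: "G \<in> borel_measurable MZ \<Longrightarrow> (\<integral>x. G (zz x) \<partial>P) = (\<integral>z. G z \<partial>MZ)" for G :: "'z \<Rightarrow> real"
  using integral_distr[OF measurable_proj(2), of G] by (simp add: distr_Z)

lemma integrable_W: "G \<in> borel_measurable MW \<Longrightarrow> integrable P (\<lambda>x. G (ww x)) \<longleftrightarrow> integrable MW G" for G :: "'w \<Rightarrow> real"
  using integrable_distr_eq[OF measurable_proj(3), of G] by (simp add: distr_W)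

lemma integrable_Z: "G \<in> borel_measurable MZ \<Longrightarrow> integrable P (\<lambda>x. G (zz x)) \<longleftrightarrow> integrable MZ G" for G :: "'z \<Rightarrow> real"
  using integrable_distr_eq[OF measurable_proj(2), of G] by (simp add: distr_Z)

lemma AE_Z: "AE z in MZ. R z \<Longrightarrow> AE x in P. R (zz x)"
  using AE_distrD[OF measurable_proj(2), of R] unfolding distr_Z .

lemma L2_Z: "g \<in> L2 MZ \<Longrightarrow> (\<lambda>x. g (zz x)) \<in> L2 P"
  by (auto simp: L2_def integrable_Z[of "\<lambda>z. (g z)\<^sup>2"])

lemma L2_W: "g \<in> L2 MW \<Longrightarrow> (\<lambda>x. g (ww x)) \<in> L2 P"
  by (auto simp: L2_def integrable_W[of "\<lambda>z. (g z)\<^sup>2"])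

sublocale F: sigma_finite_subalgebra P "sigma_W MW P"
proof -
  have "(\<lambda>x. ww x) \<in> space P \<rightarrow> space MW" using measurable_space[OF measurable_proj(3)] by auto
  then have "subalgebra P (sigma_W MW P)"
    unfolding subalgebra_def sigma_W_def case_prod_beta'
    by (auto simp: sets_vimage_algebra2 intro!: measurable_sets[OF measurable_proj(3)])
  then have "finite_measure_subalgebra P (sigma_W MW P)"
    by (simp add: finite_measure_subalgebra_def finite_measure_subalgebra_axioms_def P.finite_measure_axioms)
  then show "sigma_finite_subalgebra P (sigma_W MW P)"
    by (rule finite_measure_subalgebra_is_sigma_finite)
qed

lemma measurable_sigma_W:
  assumes "H \<in> measurable MW N"
  shows "(\<lambda>x. H (ww x)) \<in> measurable (sigma_W MW P) N"
proof -
  have "(\<lambda>x. ww x) \<in> space P \<rightarrow> space MW" using measurable_space[OF measurable_proj(3)] by auto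
  then have "(\<lambda>x. ww x) \<in> measurable (sigma_W MW P) MW"
    unfolding sigma_W_def case_prod_beta' by (rule measurable_vimage_algebra1)
  from measurable_compose[OF this assms] show ?thesis .
qed

text \<open>The form in which conditional moment assumptions are used: integrated against a
  nonnegative function of \<open>W\<close>, which may be pulled inside the conditional
  expectation.\<close>

lemma nn_cond_exp_bound:
  assumes H: "H \<in> borel_measurable MW" and g: "g \<in> borel_measurable P"
    and c: "AE x in P. nn_cond_exp P (sigma_W MW P) g x \<le> c"
  shows "(\<integral>\<^sup>+x. H (ww x) * g x \<partial>P) \<le> c * (\<integral>\<^sup>+w. H w \<partial>MW)"
proof -
  have "(\<integral>\<^sup>+x. H (ww x) * g x \<partial>P) = (\<integral>\<^sup>+x. H (ww x) * nn_cond_exp P (sigma_W MW P) g x \<partial>P)"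
    by (rule F.nn_cond_exp_intg[symmetric]) (use H g measurable_sigma_W in auto)
  also have "\<dots> \<le> (\<integral>\<^sup>+x. c * H (ww x) \<partial>P)"
  proof (rule nn_integral_mono_AE)
    show "AE x in P. H (ww x) * nn_cond_exp P (sigma_W MW P) g x \<le> c * H (ww x)"
      using c by eventually_elim (simp add: mult.commute[of c] mult_left_mono)
  qed
  also have "\<dots> = c * (\<integral>\<^sup>+w. H w \<partial>MW)"
    using H by (simp add: nn_integral_cmult nn_integral_W)
  finally show ?thesis .
qed

lemma e_L2: "1 \<le> j \<Longrightarrow> e j \<in> L2 MZ" and f_L2: "1 \<le> j \<Longrightarrow> f j \<in> L2 MW"
  using onb_L2 onb_e onb_f by blast+

lemma e_measurable: "1 \<le> j \<Longrightarrow> e j \<in> borel_measurable MZ" and f_measurable: "1 \<le> j \<Longrightarrow> f j \<in> borel_measurable MW"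
  using L2_D e_L2 f_L2 by blast+

lemma e_cond_bound:
  assumes "1 \<le> j" and H: "H \<in> borel_measurable MW"
  shows "(\<integral>\<^sup>+x. H (ww x) * ennreal ((e j (zz x))\<^sup>2) \<partial>P) \<le> ennreal (\<eta>\<^sup>2) * (\<integral>\<^sup>+w. H w \<partial>MW)"
proof (rule nn_cond_exp_bound[OF H])
  note e_measurable[OF assms(1), measurable]
  show "(\<lambda>x. ennreal ((e j (zz x))\<^sup>2)) \<in> borel_measurable P" by measurable
  show "AE x in P. nn_cond_exp P (sigma_W MW P) (\<lambda>x. ennreal ((e j (zz x))\<^sup>2)) x \<le> ennreal (\<eta>\<^sup>2)"
    using ass3 assms by (auto simp: assumption3_def case_prod_beta')
qed

lemma noise_fourth:
  assumes H: "H \<in> borel_measurable MW"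
  shows "(\<integral>\<^sup>+x. H (ww x) * ennreal ((uu x) ^ 4) \<partial>P) \<le> ennreal (\<sigma> ^ 4) * (\<integral>\<^sup>+w. H w \<partial>MW)"
  by (rule nn_cond_exp_bound[OF H]) (use noise in \<open>auto simp: noise_class_def case_prod_beta'\<close>)

text \<open>In place of a conditional Jensen inequality, \<open>u\<^sup>2 \<le> \<sigma>\<^sup>2 / 2
  + u ^ 4 / (2 * \<sigma>\<^sup>2)\<close>. The weights are such that the fourth moment bound
  returns exactly \<open>\<sigma>\<^sup>2\<close>.\<close>

lemma noise_second:
  assumes H[measurable]: "H \<in> borel_measurable MW"
  shows "(\<integral>\<^sup>+x. H (ww x) * ennreal ((uu x)\<^sup>2) \<partial>P) \<le> ennreal (\<sigma>\<^sup>2) * (\<integral>\<^sup>+w. H w \<partial>MW)"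
proof -
  have "(uu x)\<^sup>2 \<le> \<sigma>\<^sup>2 / 2 + 1 / (2 * \<sigma>\<^sup>2) * (uu x) ^ 4" for x :: "real \<times> 'z \<times> 'w"
  proof -
    have "0 \<le> ((uu x)\<^sup>2 - \<sigma>\<^sup>2)\<^sup>2" by simp
    then show ?thesis using \<sigma> by (simp add: field_simps power2_diff)
  qed
  then have *: "ennreal ((uu x)\<^sup>2) \<le> ennreal (\<sigma>\<^sup>2 / 2) + ennreal (1 / (2 * \<sigma>\<^sup>2)) * ennreal ((uu x) ^ 4)" for x :: "real \<times> 'z \<times> 'w"
    by (simp add: ennreal_mult[symmetric] ennreal_plus[symmetric] ennreal_leI del: ennreal_plus)
  have "H (ww x) * ennreal ((uu x)\<^sup>2) \<le> ennreal (\<sigma>\<^sup>2 / 2) * H (ww x) + ennreal (1 / (2 * \<sigma>\<^sup>2)) * (H (ww x) * ennreal ((uu x) ^ 4))" for x :: "real \<times> 'z \<times> 'w"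
    using mult_left_mono[OF *, of "H (ww x)" x] by (simp add: algebra_simps)
  then have "(\<integral>\<^sup>+x. H (ww x) * ennreal ((uu x)\<^sup>2) \<partial>P)
     \<le> (\<integral>\<^sup>+x. ennreal (\<sigma>\<^sup>2 / 2) * H (ww x) + ennreal (1 / (2 * \<sigma>\<^sup>2)) * (H (ww x) * ennreal ((uu x) ^ 4)) \<partial>P)"
    by (intro nn_integral_mono)
  also have "\<dots> = ennreal (\<sigma>\<^sup>2 / 2) * (\<integral>\<^sup>+w. H w \<partial>MW) + ennreal (1 / (2 * \<sigma>\<^sup>2)) * (\<integral>\<^sup>+x. H (ww x) * ennreal ((uu x) ^ 4) \<partial>P)"
    by (simp add: nn_integral_add nn_integral_cmult nn_integral_W)
  also have "\<dots> \<le> ennreal (\<sigma>\<^sup>2 / 2) * (\<integral>\<^sup>+w. H w \<partial>MW) + ennreal (1 / (2 * \<sigma>\<^sup>2)) * (ennreal (\<sigma> ^ 4) * (\<integral>\<^sup>+w. H w \<partial>MW))"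
    by (intro add_left_mono mult_left_mono noise_fourth H) simp
  also have "\<dots> = (ennreal (\<sigma>\<^sup>2 / 2) + ennreal (1 / (2 * \<sigma>\<^sup>2)) * ennreal (\<sigma> ^ 4)) * (\<integral>\<^sup>+w. H w \<partial>MW)"
    by (simp add: algebra_simps)
  also have "ennreal (\<sigma>\<^sup>2 / 2) + ennreal (1 / (2 * \<sigma>\<^sup>2)) * ennreal (\<sigma> ^ 4) = ennreal (\<sigma>\<^sup>2)"
    using \<sigma> by (simp add: ennreal_mult[symmetric] ennreal_plus[symmetric] eval_nat_numeral field_simps del: ennreal_plus)
  finally show ?thesis .
qed

lemma f_fourth: "1 \<le> l \<Longrightarrow> (\<integral>\<^sup>+w. ennreal ((f l w) ^ 4) \<partial>MW) \<le> ennreal (\<eta> ^ 4)"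
  using ass3 nn_integral_W[of "\<lambda>w. ennreal ((f l w) ^ 4)"] f_measurable[of l]
  by (auto simp: assumption3_def case_prod_beta' simp del: One_nat_def)

lemma noise_L2: "(\<lambda>x. uu x) \<in> L2 P"
proof -
  interpret W: prob_space MW using P.prob_space_distr[OF measurable_proj(3)] by (simp add: distr_W)
  have "(\<integral>\<^sup>+x. 1 * ennreal ((uu x)\<^sup>2) \<partial>P) \<le> ennreal (\<sigma>\<^sup>2) * (\<integral>\<^sup>+w. 1 \<partial>MW)" by (rule noise_second) simp
  then have "(\<integral>\<^sup>+x. ennreal ((uu x)\<^sup>2) \<partial>P) < \<infinity>" by (auto simp: W.emeasure_space_1 intro: le_less_trans)
  then show ?thesis by (auto simp: L2_def intro!: integrableI_nonneg)
qed

text \<open>Identifies the mean of an entry of the empirical matrix with the corresponding entry of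
  the operator matrix, and lets statements about \<open>T\<close> be proved through integrals under
  \<open>P\<close>.\<close>

lemma cond_exp_ip:
  assumes g: "g \<in> L2 MZ" and k: "k \<in> L2 MW"
  shows "(\<integral>x. g (zz x) * k (ww x) \<partial>P) = ip MW (T g) k"
proof -
  have [measurable]: "g \<in> borel_measurable MZ" "k \<in> borel_measurable MW" using g k by (auto simp: L2_def)
  have Tg: "T g \<in> L2 MW" and AE: "AE x in P. T g (ww x) = real_cond_exp P (sigma_W MW P) (\<lambda>x. g (zz x)) x"
    using ce g by (auto simp: cond_exp_operator_def case_prod_beta')
  have [measurable]: "T g \<in> borel_measurable MW" using Tg by (auto simp: L2_def)
  have int: "integrable P (\<lambda>x. k (ww x) * g (zz x))"
    by (rule L2_mult_integrable[OF L2_W[OF k] L2_Z[OF g]])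
  have "(\<integral>x. g (zz x) * k (ww x) \<partial>P) = (\<integral>x. k (ww x) * real_cond_exp P (sigma_W MW P) (\<lambda>x. g (zz x)) x \<partial>P)"
    using F.real_cond_exp_intg(2)[OF int] measurable_sigma_W[of k borel] by (simp add: mult.commute)
  also have "\<dots> = (\<integral>x. T g (ww x) * k (ww x) \<partial>P)"
    using AE by (intro integral_cong_AE) (auto simp: mult.commute)
  also have "\<dots> = ip MW (T g) k"
    using integral_W[of "\<lambda>w. T g w * k w"] by (simp add: ip_def)
  finally show ?thesis .
qed

lemma noise_orthogonal:
  assumes k: "k \<in> L2 MW"
  shows "(\<integral>x. uu x * k (ww x) \<partial>P) = 0"
proof -
  have [measurable]: "k \<in> borel_measurable MW" using k by (auto simp: L2_def)
  have int: "integrable P (\<lambda>x. k (ww x) * uu x)"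
    by (rule L2_mult_integrable[OF L2_W[OF k] noise_L2])
  have AE: "AE x in P. real_cond_exp P (sigma_W MW P) (\<lambda>x. uu x) x = 0"
    using noise by (auto simp: noise_class_def)
  have "(\<integral>x. uu x * k (ww x) \<partial>P) = (\<integral>x. k (ww x) * real_cond_exp P (sigma_W MW P) (\<lambda>x. uu x) x \<partial>P)"
    using F.real_cond_exp_intg(2)[OF int] measurable_sigma_W[of k borel] by (simp add: mult.commute)
  also have "\<dots> = (\<integral>x. 0 \<partial>P)"
    using AE by (intro integral_cong_AE) auto
  finally show ?thesis by simp
qed

section \<open>Products of basis functions\<close>

lemma ef_mean_le:
  assumes "1 \<le> j" "1 \<le> l"
  shows "\<bar>\<integral>x. e j (zz x) * f l (ww x) \<partial>P\<bar> \<le> 1"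
proof -
  note [measurable] = e_measurable[OF assms(1)] f_measurable[OF assms(2)]
  have int: "integrable P (\<lambda>x. (e j (zz x))\<^sup>2)" "integrable P (\<lambda>x. (f l (ww x))\<^sup>2)"
    using L2_Z[OF e_L2] L2_W[OF f_L2] assms by (auto simp: L2_def)
  have one: "(\<integral>x. (e j (zz x))\<^sup>2 \<partial>P) = 1" "(\<integral>x. (f l (ww x))\<^sup>2 \<partial>P) = 1"
    using integral_Z[of "\<lambda>z. (e j z)\<^sup>2"] integral_W[of "\<lambda>z. (f l z)\<^sup>2"] onb_ip[OF onb_e, of j j] onb_ip[OF onb_f, of l l] assms
    by (simp_all add: ip_def power2_eq_square)
  have "\<bar>\<integral>x. e j (zz x) * f l (ww x) \<partial>P\<bar> \<le> (\<integral>x. \<bar>e j (zz x) * f l (ww x)\<bar> \<partial>P)"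
    by (rule integral_abs_bound)
  also have "\<dots> \<le> (\<integral>x. ((e j (zz x))\<^sup>2 + (f l (ww x))\<^sup>2) / 2 \<partial>P)"
  proof (rule integral_mono)
    show "integrable P (\<lambda>x. \<bar>e j (zz x) * f l (ww x)\<bar>)"
      by (intro integrable_abs L2_mult_integrable L2_Z L2_W e_L2 f_L2 assms)
    show "\<bar>e j (zz x) * f l (ww x)\<bar> \<le> ((e j (zz x))\<^sup>2 + (f l (ww x))\<^sup>2) / 2" for x :: "real \<times> 'z \<times> 'w"
      using sum_squares_bound[of "\<bar>e j (zz x)\<bar>" "\<bar>f l (ww x)\<bar>"] by (simp add: abs_mult)
  qed (use int in auto)
  also have "\<dots> = 1" using int one by simp
  finally show ?thesis .
qed

lemma ef_moment:
  assumes "1 \<le> j" "1 \<le> l" "3 \<le> k"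
  shows "(\<integral>\<^sup>+x. ennreal (\<bar>e j (zz x) * f l (ww x) - (\<integral>x. e j (zz x) * f l (ww x) \<partial>P)\<bar> ^ k) \<partial>P) \<le> ennreal (\<eta> ^ k * fact k)"
  using ass3 assms by (simp add: assumption3_def case_prod_beta' del: One_nat_def)

text \<open>The moment condition controls the centred product, with \<open>24\<close> being
  \<open>fact 4\<close>; the mean is at most 1 in modulus, and \<open>power4_sum_le\<close> joins
  the two.\<close>

lemma ef_fourth:
  assumes "1 \<le> j" "1 \<le> l"
  shows "(\<integral>\<^sup>+x. ennreal ((e j (zz x) * f l (ww x)) ^ 4) \<partial>P) \<le> ennreal (8 * (24 * \<eta> ^ 4 + 1))"
proof -
  note [measurable] = e_measurable[OF assms(1)] f_measurable[OF assms(2)]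
  define t where "t = (\<integral>x. e j (zz x) * f l (ww x) \<partial>P)"
  have t: "t ^ 4 \<le> 1" using ef_mean_le[OF assms] power_le_one[of "\<bar>t\<bar>" 4] by (simp add: t_def)
  have "(y :: real) ^ 4 \<le> 8 * (\<bar>y - t\<bar> ^ 4 + 1)" for y
    using power4_sum_le[of "y - t" t] t by simp
  then have "(\<integral>\<^sup>+x. ennreal ((e j (zz x) * f l (ww x)) ^ 4) \<partial>P)
      \<le> (\<integral>\<^sup>+x. ennreal (8 * (\<bar>e j (zz x) * f l (ww x) - t\<bar> ^ 4 + 1)) \<partial>P)"
    by (intro nn_integral_mono ennreal_leI)
  also have "\<dots> = 8 * ((\<integral>\<^sup>+x. ennreal (\<bar>e j (zz x) * f l (ww x) - t\<bar> ^ 4) \<partial>P) + 1)"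
    by (simp add: ennreal_mult nn_integral_cmult nn_integral_add P.emeasure_space_1)
  also have "\<dots> \<le> 8 * (ennreal (24 * \<eta> ^ 4) + 1)"
    using ef_moment[OF assms, of 4] by (intro mult_left_mono add_right_mono) (auto simp: t_def fact_numeral mult.commute)
  also have "\<dots> = ennreal (8 * (24 * \<eta> ^ 4 + 1))"
    by (simp add: ennreal_mult)
  finally show ?thesis .
qed

lemma suminf_weights_le:
  fixes \<gamma> :: "nat \<Rightarrow> real" and x :: "nat \<Rightarrow> ennreal"
  assumes \<gamma>: "\<And>j. 1 \<le> j \<Longrightarrow> 0 < \<gamma> j" and \<gamma>G: "\<And>k. (\<Sum>j=1..k. 1 / \<gamma> j) \<le> G"
    and x: "\<And>j. 1 \<le> j \<Longrightarrow> x j \<le> c"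
  shows "(\<Sum>j. x (Suc j) * ennreal (1 / \<gamma> (Suc j))) \<le> c * ennreal G"
proof (rule suminf_le_const)
  fix k
  have "(\<Sum>j<k. x (Suc j) * ennreal (1 / \<gamma> (Suc j))) \<le> (\<Sum>j<k. c * ennreal (1 / \<gamma> (Suc j)))"
    using x by (intro sum_mono mult_right_mono) auto
  also have "\<dots> = c * ennreal (\<Sum>j=1..k. 1 / \<gamma> j)"
    unfolding sum_distrib_left[symmetric] One_nat_def sum.atLeast1_atMost_eq
    using \<gamma> by (subst sum_ennreal) (auto simp: less_imp_le)
  also have "\<dots> \<le> c * ennreal G"
    using \<gamma>G by (intro mult_left_mono ennreal_leI) auto
  finally show "(\<Sum>j<k. x (Suc j) * ennreal (1 / \<gamma> (Suc j))) \<le> c * ennreal G" .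
qed simp

section \<open>Moments of a residual with a smooth approximation error\<close>

context
  fixes \<gamma> :: "nat \<Rightarrow> real" and A G :: real and \<delta> :: "'z \<Rightarrow> real"
  assumes \<gamma>: "\<And>j. 1 \<le> j \<Longrightarrow> 0 < \<gamma> j" and A: "0 \<le> A" and G: "0 \<le> G"
    and \<delta>: "\<delta> \<in> L2 MZ"
    and \<delta>A: "\<And>k. (\<Sum>j=1..k. \<gamma> j * (coefs MZ e \<delta> j)\<^sup>2) \<le> A"
    and \<gamma>G: "\<And>k. (\<Sum>j=1..k. 1 / \<gamma> j) \<le> G"
begin

lemma \<delta>_measurable [measurable]: "\<delta> \<in> borel_measurable MZ"
  using \<delta> by (auto simp: L2_def)

text \<open>The weighted expansion bounds the square of \<open>\<delta>\<close> by a series in the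
  squared basis functions, each of bounded conditional second moment given \<open>W\<close>.
  Termwise integration and the bound \<open>G\<close> on the sum of the weights finish the proof. A
  general \<open>H\<close> is kept so that linear combinations of the \<open>f l\<close> can be
  inserted later.\<close>

lemma \<delta>_second:
  assumes H[measurable]: "H \<in> borel_measurable MW"
  shows "(\<integral>\<^sup>+x. H (ww x) * ennreal ((\<delta> (zz x))\<^sup>2) \<partial>P) \<le> ennreal (A * G * \<eta>\<^sup>2) * (\<integral>\<^sup>+w. H w \<partial>MW)"
proof -
  let ?q = "\<lambda>j x. H (ww x) * ennreal ((e (Suc j) (zz x))\<^sup>2) * ennreal (1 / \<gamma> (Suc j))"
  have q: "?q j \<in> borel_measurable P" for j using e_measurable[of "Suc j"] by measurable
  have eq: "ennreal ((e (Suc j) z)\<^sup>2 / \<gamma> (Suc j)) = ennreal ((e (Suc j) z)\<^sup>2) * ennreal (1 / \<gamma> (Suc j))" for j z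
    using \<gamma>[of "Suc j"] by (simp add: ennreal_mult[symmetric])
  have "AE z in MZ. ennreal ((\<delta> z)\<^sup>2) \<le> ennreal A * (\<Sum>j. ennreal ((e (Suc j) z)\<^sup>2 / \<gamma> (Suc j)))"
    by (rule onb_AE_power_bounds(1)[OF onb_e \<delta>, where \<gamma> = \<gamma> and A = A and G = G])
      (use \<gamma> A G \<delta>A \<gamma>G in \<open>auto simp: coefs_def simp del: One_nat_def\<close>)
  from AE_Z[OF this] have "AE x in P. H (ww x) * ennreal ((\<delta> (zz x))\<^sup>2) \<le> ennreal A * (\<Sum>j. ?q j x)"
  proof eventually_elim
    case (elim x)
    then have "H (ww x) * ennreal ((\<delta> (zz x))\<^sup>2) \<le> H (ww x) * (ennreal A * (\<Sum>j. ennreal ((e (Suc j) (zz x))\<^sup>2 / \<gamma> (Suc j))))"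
      by (rule mult_left_mono) simp
    also have "\<dots> = ennreal A * (\<Sum>j. ?q j x)"
      unfolding eq mult.assoc ennreal_suminf_cmult by (simp only: mult.left_commute)
    finally show ?case .
  qed
  then have "(\<integral>\<^sup>+x. H (ww x) * ennreal ((\<delta> (zz x))\<^sup>2) \<partial>P) \<le> (\<integral>\<^sup>+x. ennreal A * (\<Sum>j. ?q j x) \<partial>P)"
    by (rule nn_integral_mono_AE)
  also have "\<dots> = ennreal A * (\<Sum>j. \<integral>\<^sup>+x. ?q j x \<partial>P)"
    using q by (simp add: nn_integral_cmult nn_integral_suminf)
  also have "(\<Sum>j. \<integral>\<^sup>+x. ?q j x \<partial>P) = (\<Sum>j. (\<integral>\<^sup>+x. H (ww x) * ennreal ((e (Suc j) (zz x))\<^sup>2) \<partial>P) * ennreal (1 / \<gamma> (Suc j)))"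
    using e_measurable by (intro suminf_cong nn_integral_multc) auto
  also have "\<dots> \<le> (ennreal (\<eta>\<^sup>2) * (\<integral>\<^sup>+w. H w \<partial>MW)) * ennreal G"
    by (rule suminf_weights_le[OF \<gamma> \<gamma>G e_cond_bound]) (use H in auto)
  finally have "(\<integral>\<^sup>+x. H (ww x) * ennreal ((\<delta> (zz x))\<^sup>2) \<partial>P)
      \<le> ennreal A * (ennreal (\<eta>\<^sup>2) * (\<integral>\<^sup>+w. H w \<partial>MW) * ennreal G)"
    by (simp only: mult_left_mono zero_le)
  then show ?thesis using A G by (simp add: ennreal_mult ac_simps)
qed

text \<open>Fourth moments of \<open>e j\<close> are available only in products with
  \<open>f l\<close>. The factor \<open>f l\<close> is therefore moved inside the series, where
  \<open>ef_fourth\<close> holds uniformly in \<open>j\<close>.\<close>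

lemma \<delta>_fourth:
  assumes "1 \<le> l"
  shows "(\<integral>\<^sup>+x. ennreal ((\<delta> (zz x) * f l (ww x)) ^ 4) \<partial>P) \<le> ennreal (A\<^sup>2 * G\<^sup>2 * (8 * (24 * \<eta> ^ 4 + 1)))"
proof -
  note [measurable] = f_measurable[OF assms]
  let ?q = "\<lambda>j x. ennreal ((e (Suc j) (zz x) * f l (ww x)) ^ 4) * ennreal (1 / \<gamma> (Suc j))"
  have q: "?q j \<in> borel_measurable P" for j using e_measurable[of "Suc j"] by measurable
  have eq: "ennreal ((f l w) ^ 4) * ennreal ((e (Suc j) z) ^ 4 / \<gamma> (Suc j)) = ennreal ((e (Suc j) z * f l w) ^ 4) * ennreal (1 / \<gamma> (Suc j))" for j z w
    using \<gamma>[of "Suc j"] by (simp add: ennreal_mult[symmetric] power_mult_distrib mult.commute)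
  have "AE z in MZ. ennreal ((\<delta> z) ^ 4) \<le> ennreal (A\<^sup>2 * G) * (\<Sum>j. ennreal ((e (Suc j) z) ^ 4 / \<gamma> (Suc j)))"
    by (rule onb_AE_power_bounds(2)[OF onb_e \<delta>, where \<gamma> = \<gamma> and A = A and G = G])
      (use \<gamma> A G \<delta>A \<gamma>G in \<open>auto simp: coefs_def simp del: One_nat_def\<close>)
  from AE_Z[OF this] have "AE x in P. ennreal ((\<delta> (zz x) * f l (ww x)) ^ 4) \<le> ennreal (A\<^sup>2 * G) * (\<Sum>j. ?q j x)"
  proof eventually_elim
    case (elim x)
    then have "ennreal ((f l (ww x)) ^ 4) * ennreal ((\<delta> (zz x)) ^ 4)
      \<le> ennreal ((f l (ww x)) ^ 4) * (ennreal (A\<^sup>2 * G) * (\<Sum>j. ennreal ((e (Suc j) (zz x)) ^ 4 / \<gamma> (Suc j))))"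
      by (rule mult_left_mono) simp
    also have "\<dots> = ennreal (A\<^sup>2 * G) * (\<Sum>j. ?q j x)"
      unfolding eq[symmetric] ennreal_suminf_cmult by (simp only: ac_simps)
    finally show ?case by (simp add: power_mult_distrib ennreal_mult mult.commute)
  qed
  then have "(\<integral>\<^sup>+x. ennreal ((\<delta> (zz x) * f l (ww x)) ^ 4) \<partial>P) \<le> (\<integral>\<^sup>+x. ennreal (A\<^sup>2 * G) * (\<Sum>j. ?q j x) \<partial>P)"
    by (rule nn_integral_mono_AE)
  also have "\<dots> = ennreal (A\<^sup>2 * G) * (\<Sum>j. \<integral>\<^sup>+x. ?q j x \<partial>P)"
    using q by (simp add: nn_integral_cmult nn_integral_suminf)
  also have "(\<Sum>j. \<integral>\<^sup>+x. ?q j x \<partial>P) = (\<Sum>j. (\<integral>\<^sup>+x. ennreal ((e (Suc j) (zz x) * f l (ww x)) ^ 4) \<partial>P) * ennreal (1 / \<gamma> (Suc j)))"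
    using e_measurable by (intro suminf_cong nn_integral_multc) auto
  also have "\<dots> \<le> ennreal (8 * (24 * \<eta> ^ 4 + 1)) * ennreal G"
    by (rule suminf_weights_le[OF \<gamma> \<gamma>G ef_fourth]) (use assms in auto)
  also have "ennreal (A\<^sup>2 * G) * \<dots> = ennreal (A\<^sup>2 * G\<^sup>2 * (8 * (24 * \<eta> ^ 4 + 1)))"
  proof -
    have "ennreal (A\<^sup>2 * G) * (ennreal M * ennreal G) = ennreal (A\<^sup>2 * G\<^sup>2 * M)" if "0 \<le> M" for M
      using A G that by (simp add: ennreal_mult[symmetric] power2_eq_square ac_simps)
    moreover have "0 \<le> 8 * (24 * \<eta> ^ 4 + 1)" by simp
    ultimately show ?thesis by blast
  qed
  finally show ?thesis by (simp add: mult_left_mono)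
qed

lemma residual_fourth:
  assumes "1 \<le> l"
  defines "K \<equiv> 8 * (\<sigma> ^ 4 * \<eta> ^ 4 + A\<^sup>2 * G\<^sup>2 * (8 * (24 * \<eta> ^ 4 + 1)))"
  shows "integrable P (\<lambda>x. ((uu x + \<delta> (zz x)) * f l (ww x)) ^ 4)"
    and "(\<integral>x. ((uu x + \<delta> (zz x)) * f l (ww x)) ^ 4 \<partial>P) \<le> K"
proof -
  note [measurable] = f_measurable[OF assms(1)]
  have le: "((uu x + \<delta> (zz x)) * f l (ww x)) ^ 4 \<le> 8 * ((uu x) ^ 4 * (f l (ww x)) ^ 4 + (\<delta> (zz x) * f l (ww x)) ^ 4)" for x :: "real \<times> 'z \<times> 'w"
    using power4_sum_le[of "uu x * f l (ww x)" "\<delta> (zz x) * f l (ww x)"] by (simp add: algebra_simps power_mult_distrib)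
  have "(\<integral>\<^sup>+x. ennreal (((uu x + \<delta> (zz x)) * f l (ww x)) ^ 4) \<partial>P)
      \<le> (\<integral>\<^sup>+x. ennreal (8 * ((uu x) ^ 4 * (f l (ww x)) ^ 4 + (\<delta> (zz x) * f l (ww x)) ^ 4)) \<partial>P)"
    by (intro nn_integral_mono ennreal_leI le)
  also have "\<dots> = 8 * ((\<integral>\<^sup>+x. ennreal ((f l (ww x)) ^ 4) * ennreal ((uu x) ^ 4) \<partial>P) + (\<integral>\<^sup>+x. ennreal ((\<delta> (zz x) * f l (ww x)) ^ 4) \<partial>P))"
    by (simp add: ennreal_mult nn_integral_cmult nn_integral_add mult.commute)
  also have "\<dots> \<le> 8 * (ennreal (\<sigma> ^ 4) * ennreal (\<eta> ^ 4) + ennreal (A\<^sup>2 * G\<^sup>2 * (8 * (24 * \<eta> ^ 4 + 1))))"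
  proof (intro mult_left_mono add_mono \<delta>_fourth assms(1))
    have "(\<integral>\<^sup>+x. ennreal ((f l (ww x)) ^ 4) * ennreal ((uu x) ^ 4) \<partial>P) \<le> ennreal (\<sigma> ^ 4) * (\<integral>\<^sup>+w. ennreal ((f l w) ^ 4) \<partial>MW)"
      by (rule noise_fourth) simp
    also have "\<dots> \<le> ennreal (\<sigma> ^ 4) * ennreal (\<eta> ^ 4)" by (intro mult_left_mono f_fourth assms(1)) simp
    finally show "(\<integral>\<^sup>+x. ennreal ((f l (ww x)) ^ 4) * ennreal ((uu x) ^ 4) \<partial>P) \<le> ennreal (\<sigma> ^ 4) * ennreal (\<eta> ^ 4)" .
  qed simp
  also have "ennreal (\<sigma> ^ 4) * ennreal (\<eta> ^ 4) + ennreal (A\<^sup>2 * G\<^sup>2 * (8 * (24 * \<eta> ^ 4 + 1)))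
      = ennreal (\<sigma> ^ 4 * \<eta> ^ 4 + A\<^sup>2 * G\<^sup>2 * (8 * (24 * \<eta> ^ 4 + 1)))"
    by (simp add: ennreal_mult[symmetric] ennreal_plus[symmetric] del: ennreal_plus)
  also have "8 * \<dots> = ennreal K"
    unfolding K_def by (subst ennreal_mult') auto
  finally have *: "(\<integral>\<^sup>+x. ennreal (((uu x + \<delta> (zz x)) * f l (ww x)) ^ 4) \<partial>P) \<le> ennreal K" .
  then show int: "integrable P (\<lambda>x. ((uu x + \<delta> (zz x)) * f l (ww x)) ^ 4)"
    by (intro integrableI_nonneg) (auto intro: le_less_trans)
  have "0 \<le> K" unfolding K_def using \<eta> by (auto intro!: add_nonneg_nonneg mult_nonneg_nonneg)
  then show "(\<integral>x. ((uu x + \<delta> (zz x)) * f l (ww x)) ^ 4 \<partial>P) \<le> K"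
    using * by (subst (asm) nn_integral_eq_integral[OF int]) auto
qed

text \<open>The bound is proportional to the squared norm of \<open>g\<close>. For \<open>g\<close>
  a combination of the \<open>f l\<close> it yields the sum of squared coefficients with no
  dimension factor.\<close>

lemma residual_second:
  assumes g: "g \<in> L2 MW"
  shows "(\<integral>x. ((uu x + \<delta> (zz x)) * g (ww x))\<^sup>2 \<partial>P) \<le> 2 * (\<sigma>\<^sup>2 + A * G * \<eta>\<^sup>2) * sqnorm MW g"
proof -
  have [measurable]: "g \<in> borel_measurable MW" using g by (auto simp: L2_def)
  have le: "((uu x + \<delta> (zz x)) * g (ww x))\<^sup>2 \<le> 2 * ((uu x)\<^sup>2 * (g (ww x))\<^sup>2 + (\<delta> (zz x))\<^sup>2 * (g (ww x))\<^sup>2)" for x :: "real \<times> 'z \<times> 'w"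
  proof -
    have "(uu x + \<delta> (zz x))\<^sup>2 \<le> 2 * ((uu x)\<^sup>2 + (\<delta> (zz x))\<^sup>2)" using sum_squares_bound[of "uu x" "\<delta> (zz x)"] by (simp add: power2_sum)
    then have "(uu x + \<delta> (zz x))\<^sup>2 * (g (ww x))\<^sup>2 \<le> 2 * ((uu x)\<^sup>2 + (\<delta> (zz x))\<^sup>2) * (g (ww x))\<^sup>2" by (rule mult_right_mono) simp
    then show ?thesis unfolding power_mult_distrib by (simp add: algebra_simps)
  qed
  have g2: "(\<integral>\<^sup>+w. ennreal ((g w)\<^sup>2) \<partial>MW) = ennreal (sqnorm MW g)"
    using g nn_integral_eq_integral[of MW "\<lambda>w. (g w)\<^sup>2"] by (auto simp: L2_def sqnorm_def ip_def power2_eq_square)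
  have sq0: "0 \<le> sqnorm MW g" by (simp add: sqnorm_def ip_def)
  have "(\<integral>\<^sup>+x. ennreal (((uu x + \<delta> (zz x)) * g (ww x))\<^sup>2) \<partial>P)
      \<le> (\<integral>\<^sup>+x. ennreal (2 * ((uu x)\<^sup>2 * (g (ww x))\<^sup>2 + (\<delta> (zz x))\<^sup>2 * (g (ww x))\<^sup>2)) \<partial>P)"
    by (intro nn_integral_mono ennreal_leI le)
  also have "\<dots> = 2 * ((\<integral>\<^sup>+x. ennreal ((g (ww x))\<^sup>2) * ennreal ((uu x)\<^sup>2) \<partial>P) + (\<integral>\<^sup>+x. ennreal ((g (ww x))\<^sup>2) * ennreal ((\<delta> (zz x))\<^sup>2) \<partial>P))"
    by (simp add: ennreal_mult nn_integral_cmult nn_integral_add mult.commute)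
  also have "\<dots> \<le> 2 * (ennreal (\<sigma>\<^sup>2) * ennreal (sqnorm MW g) + ennreal (A * G * \<eta>\<^sup>2) * ennreal (sqnorm MW g))"
    unfolding g2[symmetric] by (intro mult_left_mono add_mono \<delta>_second noise_second) auto
  also have "ennreal (\<sigma>\<^sup>2) * ennreal (sqnorm MW g) + ennreal (A * G * \<eta>\<^sup>2) * ennreal (sqnorm MW g)
      = ennreal ((\<sigma>\<^sup>2 + A * G * \<eta>\<^sup>2) * sqnorm MW g)"
    using A G sq0 by (simp add: ennreal_mult[symmetric] ennreal_plus[symmetric] distrib_right del: ennreal_plus)
  also have "2 * \<dots> = ennreal (2 * (\<sigma>\<^sup>2 + A * G * \<eta>\<^sup>2) * sqnorm MW g)"
    unfolding mult.assoc by (subst (2) ennreal_mult') auto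
  finally have *: "(\<integral>\<^sup>+x. ennreal (((uu x + \<delta> (zz x)) * g (ww x))\<^sup>2) \<partial>P) \<le> ennreal (2 * (\<sigma>\<^sup>2 + A * G * \<eta>\<^sup>2) * sqnorm MW g)" .
  then have int: "integrable P (\<lambda>x. ((uu x + \<delta> (zz x)) * g (ww x))\<^sup>2)"
    by (intro integrableI_nonneg) (auto intro: le_less_trans)
  have "0 \<le> 2 * (\<sigma>\<^sup>2 + A * G * \<eta>\<^sup>2) * sqnorm MW g" using A G sq0 by auto
  then show ?thesis
    using * by (subst (asm) nn_integral_eq_integral[OF int]) auto
qed

lemma residual_mean:
  assumes "g \<in> L2 MW"
  shows "integrable P (\<lambda>x. (uu x + \<delta> (zz x)) * g (ww x))"
    and "(\<integral>x. (uu x + \<delta> (zz x)) * g (ww x) \<partial>P) = ip MW (T \<delta>) g"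
proof -
  have int: "integrable P (\<lambda>x. uu x * g (ww x))" "integrable P (\<lambda>x. \<delta> (zz x) * g (ww x))"
    by (intro L2_mult_integrable noise_L2 L2_W L2_Z assms \<delta>)+
  then show "integrable P (\<lambda>x. (uu x + \<delta> (zz x)) * g (ww x))" by (simp add: distrib_right)
  show "(\<integral>x. (uu x + \<delta> (zz x)) * g (ww x) \<partial>P) = ip MW (T \<delta>) g"
    using int by (simp add: distrib_right noise_orthogonal[OF assms] cond_exp_ip[OF \<delta> assms])
qed

end

text \<open>The moment condition on centred products starts at the third power. The second power
  follows from the conditional bound on the squared basis functions and the unit norm of
  \<open>f l\<close>, as centring only lowers it.\<close>

lemma ef_centred_second:
  assumes "1 \<le> j" "1 \<le> l"
  shows "(\<integral>\<^sup>+x. ennreal ((e j (zz x) * f l (ww x) - (\<integral>x. e j (zz x) * f l (ww x) \<partial>P))\<^sup>2) \<partial>P) \<le> ennreal (\<eta>\<^sup>2)"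
proof -
  note [measurable] = e_measurable[OF assms(1)] f_measurable[OF assms(2)]
  let ?X = "\<lambda>x. e j (zz x) * f l (ww x)"
  have "(\<integral>\<^sup>+x. ennreal ((?X x)\<^sup>2) \<partial>P) = (\<integral>\<^sup>+x. ennreal ((f l (ww x))\<^sup>2) * ennreal ((e j (zz x))\<^sup>2) \<partial>P)"
    by (intro nn_integral_cong) (simp add: power_mult_distrib ennreal_mult mult.commute)
  also have "\<dots> \<le> ennreal (\<eta>\<^sup>2) * (\<integral>\<^sup>+w. ennreal ((f l w)\<^sup>2) \<partial>MW)"
    by (rule e_cond_bound[OF assms(1)]) simp
  also have "(\<integral>\<^sup>+w. ennreal ((f l w)\<^sup>2) \<partial>MW) = 1"
    using f_L2[OF assms(2)] onb_ip[OF onb_f assms(2,2)] nn_integral_eq_integral[of MW "\<lambda>w. (f l w)\<^sup>2"]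
    by (auto simp: L2_def ip_def power2_eq_square)
  finally have *: "(\<integral>\<^sup>+x. ennreal ((?X x)\<^sup>2) \<partial>P) \<le> ennreal (\<eta>\<^sup>2)" by simp
  then have i2: "integrable P (\<lambda>x. (?X x)\<^sup>2)"
    by (intro integrableI_nonneg) (auto intro: le_less_trans)
  have i1: "integrable P ?X" by (intro L2_mult_integrable L2_Z L2_W e_L2 f_L2 assms)
  have "(\<integral>x. (?X x - (\<integral>x. ?X x \<partial>P))\<^sup>2 \<partial>P) \<le> (\<integral>x. (?X x)\<^sup>2 \<partial>P)"
    using P.variance_eq[OF i1 i2] by simp
  also have "\<dots> \<le> \<eta>\<^sup>2" using * by (subst (asm) nn_integral_eq_integral[OF i2]) auto
  finally have **: "(\<integral>x. (?X x - (\<integral>x. ?X x \<partial>P))\<^sup>2 \<partial>P) \<le> \<eta>\<^sup>2" .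
  have "integrable P (\<lambda>x. (?X x - (\<integral>x. ?X x \<partial>P))\<^sup>2)"
    unfolding power2_diff using i1 i2 by simp
  from nn_integral_eq_integral[OF this] show ?thesis using ** by (simp add: ennreal_leI)
qed

end

section \<open>Approximation error and bias\<close>

text \<open>Serves infinite index sets with the weights \<open>\<gamma>\<close> as well as the
  finite head \<open>{1..m}\<close> with the weights \<open>\<upsilon>\<close>.\<close>

lemma infsum_weighted_Cauchy_Schwarz:
  fixes a c w :: "'i \<Rightarrow> real"
  assumes w: "\<And>i. i \<in> I \<Longrightarrow> 0 < w i"
    and a: "(\<lambda>i. (a i)\<^sup>2 / w i) summable_on I" and c: "(\<lambda>i. w i * (c i)\<^sup>2) summable_on I"
  shows "(\<lambda>i. a i * c i) summable_on I"
    and "(\<Sum>\<^sub>\<infinity>i\<in>I. a i * c i)\<^sup>2 \<le> (\<Sum>\<^sub>\<infinity>i\<in>I. (a i)\<^sup>2 / w i) * (\<Sum>\<^sub>\<infinity>i\<in>I. w i * (c i)\<^sup>2)"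
proof -
  have le: "\<bar>a i * c i\<bar> \<le> (a i)\<^sup>2 / w i + w i * (c i)\<^sup>2" if "i \<in> I" for i
  proof -
    have "a i * c i = (a i / sqrt (w i)) * (sqrt (w i) * c i)" using w[OF that] by simp
    then have "\<bar>a i * c i\<bar> \<le> (a i / sqrt (w i))\<^sup>2 + (sqrt (w i) * c i)\<^sup>2" using abs_mult_le_sum_squares by metis
    then show ?thesis using w[OF that] by (simp add: power_divide power_mult_distrib less_imp_le)
  qed
  have "(\<lambda>i. (a i)\<^sup>2 / w i + w i * (c i)\<^sup>2) summable_on I" by (intro summable_on_add a c)
  then have "(\<lambda>i. norm (a i * c i)) summable_on I"
    by (rule summable_on_comparison_test) (use le in auto)
  then show s: "(\<lambda>i. a i * c i) summable_on I" by (rule abs_summable_summable)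
  have fin: "(\<Sum>i\<in>F. a i * c i)\<^sup>2 \<le> (\<Sum>\<^sub>\<infinity>i\<in>I. (a i)\<^sup>2 / w i) * (\<Sum>\<^sub>\<infinity>i\<in>I. w i * (c i)\<^sup>2)"
    if F: "finite F" "F \<subseteq> I" for F
  proof -
    have "(\<Sum>i\<in>F. a i * c i)\<^sup>2 = (\<Sum>i\<in>F. (a i / sqrt (w i)) * (sqrt (w i) * c i))\<^sup>2"
      using w F by (intro arg_cong[where f = "\<lambda>x. x\<^sup>2"] sum.cong) (auto dest!: subsetD w)
    also have "\<dots> \<le> (\<Sum>i\<in>F. (a i / sqrt (w i))\<^sup>2) * (\<Sum>i\<in>F. (sqrt (w i) * c i)\<^sup>2)"
      by (rule Cauchy_Schwarz_ineq_sum)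
    also have "\<dots> = (\<Sum>i\<in>F. (a i)\<^sup>2 / w i) * (\<Sum>i\<in>F. w i * (c i)\<^sup>2)"
      using w F by (intro arg_cong2[where f = "(*)"] sum.cong) (auto simp: power_divide power_mult_distrib less_imp_le subset_iff)
    also have "\<dots> \<le> (\<Sum>\<^sub>\<infinity>i\<in>I. (a i)\<^sup>2 / w i) * (\<Sum>\<^sub>\<infinity>i\<in>I. w i * (c i)\<^sup>2)"
      using w F a c
      by (intro mult_mono finite_sum_le_infsum infsum_nonneg sum_nonneg) (auto simp: subset_iff less_imp_le)
    finally show ?thesis .
  qed
  have "((\<lambda>F. (\<Sum>i\<in>F. a i * c i)\<^sup>2) \<longlongrightarrow> (\<Sum>\<^sub>\<infinity>i\<in>I. a i * c i)\<^sup>2) (finite_subsets_at_top I)"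
    using has_sum_infsum[OF s] unfolding has_sum_def by (rule tendsto_power)
  then show "(\<Sum>\<^sub>\<infinity>i\<in>I. a i * c i)\<^sup>2 \<le> (\<Sum>\<^sub>\<infinity>i\<in>I. (a i)\<^sup>2 / w i) * (\<Sum>\<^sub>\<infinity>i\<in>I. w i * (c i)\<^sup>2)"
    by (rule tendsto_upperbound) (auto intro!: eventually_finite_subsets_at_top_weakI fin)
qed

lemma sum_lessThan_Suc_shift: "(\<Sum>j<m. g (Suc j)) = (\<Sum>j=1..m. g j)"
  unfolding One_nat_def by (rule sum.atLeast1_atMost_eq[symmetric])

text \<open>Here \<open>m\<close> and \<open>n\<close> are arbitrary positive numbers; the choice of
  \<open>m\<close> as \<open>m_star\<close> and the balance with \<open>n\<close> come in only when
  the risk bounds are compared with the rate. \<open>G\<close> is any bound on the partial sums of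
  \<open>1 / \<gamma> j\<close>.\<close>

locale npiv = joint_model MZ MW e f \<sigma> \<eta> T P
  for MZ :: "'z measure" and MW :: "'w measure" and e f \<sigma> \<eta> T P +
  fixes \<gamma> \<upsilon> h :: "nat \<Rightarrow> real" and d D \<rho> G :: real and \<phi> :: "'z \<Rightarrow> real" and m n :: nat
  assumes \<gamma>: "\<And>j. 1 \<le> j \<Longrightarrow> 0 < \<gamma> j" and \<upsilon>: "\<And>j. 1 \<le> j \<Longrightarrow> 0 < \<upsilon> j"
    and \<gamma>_mono: "\<And>i j. 1 \<le> i \<Longrightarrow> i \<le> j \<Longrightarrow> \<gamma> i \<le> \<gamma> j"
    and \<upsilon>_anti: "\<And>i j. 1 \<le> i \<Longrightarrow> i \<le> j \<Longrightarrow> \<upsilon> j \<le> \<upsilon> i"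
    and \<gamma>G: "\<And>k. (\<Sum>j=1..k. 1 / \<gamma> j) \<le> G" and G: "0 \<le> G"
    and T: "T \<in> ext_link_class MZ MW e f \<upsilon> d D" and dD: "1 \<le> d" "d \<le> D"
    and \<phi>: "\<phi> \<in> ellipsoid MZ e \<gamma> \<rho>" and \<rho>: "0 \<le> \<rho>"
    and h: "h \<in> weighted_space (\<lambda>j. 1 / \<gamma> j)"
    and m: "1 \<le> m" and n: "1 \<le> n"
begin

definition "Tm = op_matrix MW e f T m"
definition "hv = vec m (\<lambda>j. h (Suc j))"
text \<open>Coefficients of the Galerkin solution: in the span of the first \<open>m\<close> basis
  functions, its image under \<open>T\<close> agrees with \<open>T \<phi>\<close> in the first
  \<open>m\<close> coefficients.\<close>

definition "cv = mult_mat_vec (inv_mat Tm) (vec m (\<lambda>l. ip MW (T \<phi>) (f (Suc l))))"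
text \<open>The direction along which the averaged residuals enter the linear part of the
  error.\<close>

definition "bv = mult_mat_vec (transpose_mat (inv_mat Tm)) hv"
definition "cc j = vec_index cv (j - 1)"
definition "\<delta> z = \<phi> z - (\<Sum>j=1..m. cc j * e j z)"
definition "bias = scalar_prod hv cv - lin_functional h (coefs MZ e \<phi>)"
definition "Sh = (\<Sum>j=1..m. (h j)\<^sup>2 / \<upsilon> j)"
definition "Rh = (\<Sum>\<^sub>\<infinity>j\<in>{m<..}. (h j)\<^sup>2 / \<gamma> j)"

lemma \<gamma>_nonneg: "1 \<le> j \<Longrightarrow> 0 \<le> \<gamma> j" and \<upsilon>_nonneg: "1 \<le> j \<Longrightarrow> 0 \<le> \<upsilon> j"
  using \<gamma> \<upsilon> by (simp_all add: less_imp_le)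

lemma \<phi>_L2: "\<phi> \<in> L2 MZ" using \<phi> by (simp add: ellipsoid_def)

lemma Tm: "Tm \<in> carrier_mat m m" "invertible_mat Tm"
  "(spectral_norm (sqrt_diag \<upsilon> m * inv_mat Tm))\<^sup>2 \<le> D"
  using T m by (auto simp: Tm_def ext_link_class_def op_matrix_def)

lemma vec_carriers: "hv \<in> carrier_vec m" "cv \<in> carrier_vec m" "bv \<in> carrier_vec m"
  using inv_mat[OF Tm(1,2)] by (auto simp: hv_def cv_def bv_def)

lemma T_bounds: "sqnorm MW (T g) \<le> d * weighted_sqnorm \<upsilon> (coefs MZ e g)" if "g \<in> L2 MZ"
  using T that by (auto simp: ext_link_class_def link_class_def)

lemma T_L2: "g \<in> L2 MZ \<Longrightarrow> T g \<in> L2 MW"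
  using ce by (auto simp: cond_exp_operator_def)

text \<open>In the operator class \<open>T\<close> is linear only up to null sets. Inside an inner
  product, linearity can be read off the integral representation \<open>cond_exp_ip\<close>.\<close>

lemma T_residual:
  assumes "g \<in> L2 MZ" "k \<in> L2 MW"
  shows "ip MW (T (\<lambda>z. g z - (\<Sum>j=1..m. a j * e j z))) k = ip MW (T g) k - (\<Sum>j=1..m. a j * ip MW (T (e j)) k)"
proof -
  have r: "(\<lambda>z. g z - (\<Sum>j=1..m. a j * e j z)) \<in> L2 MZ"
    by (intro L2_diff assms onb_sum_L2[OF onb_e])
  have i1: "integrable P (\<lambda>x. g (zz x) * k (ww x))" and i2: "integrable P (\<lambda>x. e j (zz x) * k (ww x))" if "1 \<le> j" for j
    using that by (auto intro!: L2_mult_integrable L2_Z L2_W assms e_L2)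
  have "ip MW (T (\<lambda>z. g z - (\<Sum>j=1..m. a j * e j z))) k
      = (\<integral>x. g (zz x) * k (ww x) - (\<Sum>j=1..m. a j * (e j (zz x) * k (ww x))) \<partial>P)"
    unfolding cond_exp_ip[OF r assms(2), symmetric] by (simp add: left_diff_distrib sum_distrib_right mult.assoc)
  also have "\<dots> = (\<integral>x. g (zz x) * k (ww x) \<partial>P) - (\<Sum>j=1..m. a j * (\<integral>x. e j (zz x) * k (ww x) \<partial>P))"
    using i1[of 1] i2 by (subst Bochner_Integration.integral_diff) (auto simp del: One_nat_def)
  also have "\<dots> = ip MW (T g) k - (\<Sum>j=1..m. a j * ip MW (T (e j)) k)"
    using assms e_L2 by (simp add: cond_exp_ip)
  finally show ?thesis .
qed

lemma Tm_mult:
  assumes "l < m" "v \<in> carrier_vec m"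
  shows "vec_index (mult_mat_vec Tm v) l = (\<Sum>j=1..m. vec_index v (j - 1) * ip MW (T (e j)) (f (Suc l)))"
proof -
  have "vec_index (mult_mat_vec Tm v) l = (\<Sum>j<m. vec_index v j * ip MW (T (e (Suc j))) (f (Suc l)))"
    using assms by (simp add: Tm_def op_matrix_def scalar_prod_def lessThan_atLeast0 mult.commute)
  then show ?thesis
    using sum_lessThan_Suc_shift[of "\<lambda>j. vec_index v (j - 1) * ip MW (T (e j)) (f (Suc l))" m] by simp
qed

lemma \<delta>_L2: "\<delta> \<in> L2 MZ"
  unfolding \<delta>_def[abs_def] by (intro L2_diff \<phi>_L2 onb_sum_L2[OF onb_e])

text \<open>The Galerkin equations. They make the residuals
  \<open>(U + \<delta>(Z)) * f l (W)\<close> exactly centred for \<open>l \<le> m\<close>.\<close>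

lemma \<delta>_orthogonal:
  assumes "1 \<le> l" "l \<le> m"
  shows "ip MW (T \<delta>) (f l) = 0"
proof -
  have "mult_mat_vec Tm cv = vec m (\<lambda>l. ip MW (T \<phi>) (f (Suc l)))"
    unfolding cv_def by (rule inv_mat_cancel(2)[OF Tm(1,2)]) simp
  then have "ip MW (T \<phi>) (f l) = vec_index (mult_mat_vec Tm cv) (l - 1)"
    using assms by (cases l) simp_all
  also have "\<dots> = (\<Sum>j=1..m. cc j * ip MW (T (e j)) (f l))"
    using assms vec_carriers Tm_mult[of "l - 1" cv] by (simp add: cc_def)
  finally show ?thesis
    unfolding \<delta>_def[abs_def] using T_residual[OF \<phi>_L2 f_L2, of l cc] assms by simp
qed

lemma coefs_\<delta>: "1 \<le> j \<Longrightarrow> coefs MZ e \<delta> j = coefs MZ e \<phi> j - (if j \<le> m then cc j else 0)"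
  unfolding coefs_def \<delta>_def[abs_def]
  by (subst ip_diff) (auto simp: coefs_sum[OF onb_e] \<phi>_L2 e_L2 onb_sum_L2[OF onb_e] simp del: One_nat_def)

lemma \<phi>_summable: "(\<lambda>j. \<gamma> j * (coefs MZ e \<phi> j)\<^sup>2) summable_on {1..}"
  and \<phi>_le: "(\<Sum>\<^sub>\<infinity>j\<in>{1..}. \<gamma> j * (coefs MZ e \<phi> j)\<^sup>2) \<le> \<rho>"
  using \<phi> by (auto simp: ellipsoid_def weighted_space_def weighted_sqnorm_def)

lemma \<phi>_tail: "I \<subseteq> {1..} \<Longrightarrow> (\<Sum>\<^sub>\<infinity>j\<in>I. \<gamma> j * (coefs MZ e \<phi> j)\<^sup>2) \<le> \<rho>"
  by (rule order_trans[OF infsum_mono_neutral \<phi>_le])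
    (auto intro: summable_on_subset_banach[OF \<phi>_summable] \<phi>_summable mult_nonneg_nonneg \<gamma>_nonneg simp del: One_nat_def)

lemma D0: "0 < D" using dD by simp

text \<open>Let \<open>\<psi>\<close> be the tail of \<open>\<phi>\<close> beyond \<open>m\<close>.
  The difference between Galerkin and true coefficients is the inverse matrix applied to the first
  \<open>m\<close> coefficients of \<open>T \<psi>\<close>. The extended link condition costs
  \<open>D\<close>, Bessel's inequality and the link condition cost \<open>d\<close>, and the
  monotone weights turn the \<open>\<upsilon>\<close>-norm of the tail into
  \<open>\<upsilon> m / \<gamma> m\<close> times \<open>\<rho>\<close>.\<close>

lemma approximation_error: "(\<Sum>j=1..m. \<upsilon> j * (coefs MZ e \<delta> j)\<^sup>2) \<le> D * d * \<rho> * (\<upsilon> m / \<gamma> m)"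
proof -
  define \<psi> where "\<psi> z = \<phi> z - (\<Sum>j=1..m. coefs MZ e \<phi> j * e j z)" for z
  have \<psi>: "\<psi> \<in> L2 MZ"
    unfolding \<psi>_def[abs_def] by (intro L2_diff \<phi>_L2 onb_sum_L2[OF onb_e])
  have c\<psi>: "coefs MZ e \<psi> j = (if j \<le> m then 0 else coefs MZ e \<phi> j)" if "1 \<le> j" for j
    unfolding \<psi>_def[abs_def] coefs_def using that
    by (subst ip_diff) (auto simp: coefs_sum[OF onb_e] \<phi>_L2 e_L2 onb_sum_L2[OF onb_e] simp del: One_nat_def)
  define t where "t = vec m (\<lambda>l. ip MW (T \<psi>) (f (Suc l)))"
  define a where "a = vec m (\<lambda>j. - coefs MZ e \<delta> (Suc j))"
  have carr: "t \<in> carrier_vec m" "a \<in> carrier_vec m" by (auto simp: t_def a_def)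
  have "mult_mat_vec Tm a = t"
  proof (rule eq_vecI)
    fix l assume "l < dim_vec t"
    then have l: "l < m" by (simp add: t_def)
    then have fl: "f (Suc l) \<in> L2 MW" by (intro f_L2) simp
    have "vec_index (mult_mat_vec Tm a) l = (\<Sum>j=1..m. (cc j - coefs MZ e \<phi> j) * ip MW (T (e j)) (f (Suc l)))"
      unfolding Tm_mult[OF l carr(2)] by (intro sum.cong) (auto simp: a_def coefs_\<delta> simp del: One_nat_def)
    also have "\<dots> = (\<Sum>j=1..m. cc j * ip MW (T (e j)) (f (Suc l))) - (\<Sum>j=1..m. coefs MZ e \<phi> j * ip MW (T (e j)) (f (Suc l)))"
      by (simp add: left_diff_distrib sum_subtractf)
    also have "(\<Sum>j=1..m. cc j * ip MW (T (e j)) (f (Suc l))) = ip MW (T \<phi>) (f (Suc l))"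
      using T_residual[OF \<phi>_L2 fl, of cc] \<delta>_orthogonal[of "Suc l"] l by (simp add: \<delta>_def[abs_def])
    also have "ip MW (T \<phi>) (f (Suc l)) - (\<Sum>j=1..m. coefs MZ e \<phi> j * ip MW (T (e j)) (f (Suc l))) = vec_index t l"
      using T_residual[OF \<phi>_L2 fl, of "coefs MZ e \<phi>"] l by (simp add: t_def \<psi>_def[abs_def])
    finally show "vec_index (mult_mat_vec Tm a) l = vec_index t l" .
  qed (use Tm in \<open>auto simp: t_def\<close>)
  then have a: "a = mult_mat_vec (inv_mat Tm) t"
    using inv_mat_cancel(1)[OF Tm(1,2) carr(2)] by simp
  have "(\<Sum>j=1..m. \<upsilon> j * (coefs MZ e \<delta> j)\<^sup>2) = (\<Sum>j<m. \<upsilon> (Suc j) * (vec_index a j)\<^sup>2)"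
    unfolding sum_lessThan_Suc_shift[symmetric] by (simp add: a_def)
  also have "\<dots> \<le> D * (euclid_norm t)\<^sup>2"
    unfolding a using \<upsilon> carr by (intro weighted_inv_le Tm) auto
  also have "(euclid_norm t)\<^sup>2 = (\<Sum>l=1..m. (ip MW (T \<psi>) (f l))\<^sup>2)"
    unfolding sum_lessThan_Suc_shift[symmetric] by (simp add: euclid_norm_sq t_def)
  also have "\<dots> \<le> sqnorm MW (T \<psi>)" by (rule bessel[OF onb_f T_L2[OF \<psi>]])
  also have "\<dots> \<le> d * weighted_sqnorm \<upsilon> (coefs MZ e \<psi>)" by (rule T_bounds[OF \<psi>])
  also have "weighted_sqnorm \<upsilon> (coefs MZ e \<psi>) \<le> \<upsilon> m / \<gamma> m * \<rho>"
  proof -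
    \<comment> \<open>For \<open>j \<le> m\<close> the left side is zero; beyond \<open>m\<close>
      the ratio \<open>\<upsilon> j / \<gamma> j\<close> is at most its value at
      \<open>m\<close>.\<close>
    have pt: "\<upsilon> j * (coefs MZ e \<psi> j)\<^sup>2 \<le> \<upsilon> m / \<gamma> m * (\<gamma> j * (coefs MZ e \<phi> j)\<^sup>2)" if "1 \<le> j" for j
    proof (cases "j \<le> m")
      case True
      then show ?thesis using that \<gamma>[of j] \<gamma>[OF m] \<upsilon>[OF m] by (simp add: c\<psi>)
    next
      case False
      have "\<upsilon> j * \<gamma> m \<le> \<upsilon> m * \<gamma> j"
        using False \<upsilon>_anti[OF m, of j] \<gamma>_mono[OF m, of j] \<gamma>[OF m] \<upsilon>[OF m] by (intro mult_mono) auto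
      then have "\<upsilon> j \<le> \<upsilon> m / \<gamma> m * \<gamma> j" using \<gamma>[OF m] by (simp add: field_simps)
      from mult_right_mono[OF this, of "(coefs MZ e \<phi> j)\<^sup>2"] show ?thesis
        using False that by (simp add: c\<psi> mult.assoc)
    qed
    have s: "(\<lambda>j. \<upsilon> m / \<gamma> m * (\<gamma> j * (coefs MZ e \<phi> j)\<^sup>2)) summable_on {1..}"
      by (intro summable_on_cmult_right \<phi>_summable)
    have "weighted_sqnorm \<upsilon> (coefs MZ e \<psi>) \<le> (\<Sum>\<^sub>\<infinity>j\<in>{1..}. \<upsilon> m / \<gamma> m * (\<gamma> j * (coefs MZ e \<phi> j)\<^sup>2))"
      unfolding weighted_sqnorm_def
    proof (rule infsum_mono[OF _ s])
      show "(\<lambda>j. \<upsilon> j * (coefs MZ e \<psi> j)\<^sup>2) summable_on {1..}"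
        by (rule summable_on_comparison_test[OF s]) (use pt \<upsilon>_nonneg in \<open>auto intro: mult_nonneg_nonneg simp del: One_nat_def\<close>)
    qed (use pt in auto)
    also have "\<dots> \<le> \<upsilon> m / \<gamma> m * \<rho>"
      unfolding infsum_cmult_right' using \<gamma>[OF m] \<upsilon>[OF m] by (intro mult_left_mono \<phi>_le) auto
    finally show ?thesis .
  qed
  finally show ?thesis using D0 dD by (simp add: mult_left_mono mult_ac)
qed

text \<open>For \<open>j \<le> m\<close>,
  \<open>\<gamma> j \<le> \<gamma> m / \<upsilon> m * \<upsilon> j\<close>, and this factor cancels
  the one in \<open>approximation_error\<close>; beyond \<open>m\<close> the coefficients are those
  of \<open>\<phi>\<close>. The resulting radius is free of \<open>m\<close>, so the moment bounds
  for residuals apply uniformly.\<close>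

lemma \<delta>_smooth: "(\<Sum>j=1..k. \<gamma> j * (coefs MZ e \<delta> j)\<^sup>2) \<le> \<rho> * (1 + D * d)"
proof -
  have "(\<Sum>j=1..m. \<gamma> j * (coefs MZ e \<delta> j)\<^sup>2) \<le> (\<Sum>j=1..m. \<gamma> m / \<upsilon> m * (\<upsilon> j * (coefs MZ e \<delta> j)\<^sup>2))"
  proof (rule sum_mono)
    fix j assume j: "j \<in> {1..m}"
    have "\<gamma> j * \<upsilon> m \<le> \<gamma> m * \<upsilon> j"
      using j \<upsilon>_anti[of j m] \<gamma>_mono[of j m] \<gamma>[of m] \<upsilon>[of m] m by (intro mult_mono) auto
    then have "\<gamma> j \<le> \<gamma> m / \<upsilon> m * \<upsilon> j" using \<upsilon>[OF m] by (simp add: field_simps)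
    from mult_right_mono[OF this, of "(coefs MZ e \<delta> j)\<^sup>2"]
    show "\<gamma> j * (coefs MZ e \<delta> j)\<^sup>2 \<le> \<gamma> m / \<upsilon> m * (\<upsilon> j * (coefs MZ e \<delta> j)\<^sup>2)" by (simp add: mult.assoc)
  qed
  also have "\<dots> \<le> \<gamma> m / \<upsilon> m * (D * d * \<rho> * (\<upsilon> m / \<gamma> m))"
    unfolding sum_distrib_left[symmetric] using \<gamma>[OF m] \<upsilon>[OF m] by (intro mult_left_mono approximation_error) auto
  also have "\<dots> = D * d * \<rho>" using \<gamma>[OF m] \<upsilon>[OF m] by simp
  finally have head: "(\<Sum>j=1..m. \<gamma> j * (coefs MZ e \<delta> j)\<^sup>2) \<le> D * d * \<rho>" .
  have "(\<Sum>j=1..k. \<gamma> j * (coefs MZ e \<delta> j)\<^sup>2) \<le> (\<Sum>j\<in>{1..m} \<union> {m<..k}. \<gamma> j * (coefs MZ e \<delta> j)\<^sup>2)"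
    using \<gamma>_nonneg by (intro sum_mono2) auto
  also have "\<dots> = (\<Sum>j=1..m. \<gamma> j * (coefs MZ e \<delta> j)\<^sup>2) + (\<Sum>j\<in>{m<..k}. \<gamma> j * (coefs MZ e \<phi> j)\<^sup>2)"
    by (subst sum.union_disjoint) (auto simp: coefs_\<delta> intro!: sum.cong)
  also have "(\<Sum>j\<in>{m<..k}. \<gamma> j * (coefs MZ e \<phi> j)\<^sup>2) \<le> \<rho>"
    using \<phi>_tail[of "{m<..k}"] m by (simp add: subset_iff)
  finally show ?thesis using head by (simp add: algebra_simps)
qed

lemma h_summable: "(\<lambda>j. (h j)\<^sup>2 / \<gamma> j) summable_on {1..}"
  using h by (simp add: weighted_space_def)

lemma Rh_nonneg: "0 \<le> Rh" and Sh_nonneg: "0 \<le> Sh"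
  unfolding Rh_def Sh_def using \<gamma>_nonneg \<upsilon>_nonneg m
  by (auto intro!: infsum_nonneg sum_nonneg divide_nonneg_nonneg)

lemma lin_functional_le: "(lin_functional h (coefs MZ e \<phi>))\<^sup>2 \<le> (\<Sum>\<^sub>\<infinity>j\<in>{1..}. (h j)\<^sup>2 / \<gamma> j) * \<rho>"
proof -
  have "(lin_functional h (coefs MZ e \<phi>))\<^sup>2 \<le> (\<Sum>\<^sub>\<infinity>j\<in>{1..}. (h j)\<^sup>2 / \<gamma> j) * (\<Sum>\<^sub>\<infinity>j\<in>{1..}. \<gamma> j * (coefs MZ e \<phi> j)\<^sup>2)"
    unfolding lin_functional_def by (rule infsum_weighted_Cauchy_Schwarz[OF _ h_summable \<phi>_summable]) (use \<gamma> in auto)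
  also have "\<dots> \<le> (\<Sum>\<^sub>\<infinity>j\<in>{1..}. (h j)\<^sup>2 / \<gamma> j) * \<rho>"
    using \<gamma>_nonneg by (intro mult_left_mono \<phi>_le infsum_nonneg) auto
  finally show ?thesis .
qed

text \<open>The bias splits at \<open>m\<close>. Weights \<open>\<upsilon>\<close> on the head pair
  \<open>Sh\<close> with the approximation error, and weights \<open>\<gamma>\<close> on the tail
  pair \<open>Rh\<close> with the radius of the ellipsoid.\<close>

lemma bias_le: "bias\<^sup>2 \<le> 2 * \<rho> * (1 + D * d) * max (\<upsilon> m / \<gamma> m * Sh) Rh"
proof -
  have sub: "{m<..} \<subseteq> {1..}" using m by auto
  note cs = infsum_weighted_Cauchy_Schwarz[of "{m<..}" \<gamma> h "coefs MZ e \<phi>",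
      OF _ summable_on_subset_banach[OF h_summable sub] summable_on_subset_banach[OF \<phi>_summable sub]]
  have \<gamma>': "0 < \<gamma> i" if "i \<in> {m<..}" for i using that m by (intro \<gamma>) auto
  define head where "head = (\<Sum>j=1..m. h j * coefs MZ e \<delta> j)"
  define tail where "tail = (\<Sum>\<^sub>\<infinity>j\<in>{m<..}. h j * coefs MZ e \<phi> j)"
  have "lin_functional h (coefs MZ e \<phi>) = (\<Sum>\<^sub>\<infinity>j\<in>{1..m} \<union> {m<..}. h j * coefs MZ e \<phi> j)"
    unfolding lin_functional_def using m by (intro infsum_cong_neutral) auto
  also have "\<dots> = (\<Sum>j=1..m. h j * coefs MZ e \<phi> j) + tail"
    unfolding tail_def by (subst infsum_Un_disjoint) (auto intro!: cs(1) \<gamma>')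
  finally have lf: "lin_functional h (coefs MZ e \<phi>) = (\<Sum>j=1..m. h j * coefs MZ e \<phi> j) + tail" .
  have "scalar_prod hv cv = (\<Sum>j<m. h (Suc j) * vec_index cv j)"
    using vec_carriers by (simp add: scalar_prod_def hv_def lessThan_atLeast0)
  also have "\<dots> = (\<Sum>j=1..m. h j * cc j)"
    using sum_lessThan_Suc_shift[of "\<lambda>j. h j * cc j" m] by (simp add: cc_def)
  finally have bias_eq: "bias = - head - tail"
    unfolding bias_def lf head_def by (simp add: coefs_\<delta> right_diff_distrib sum_subtractf)
  have "bias\<^sup>2 = (head + tail)\<^sup>2" unfolding bias_eq power2_eq_square by (simp add: algebra_simps)
  also have "\<dots> \<le> 2 * head\<^sup>2 + 2 * tail\<^sup>2" using sum_squares_bound[of head tail] by (simp add: power2_sum)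
  also have "\<dots> \<le> 2 * (Sh * (D * d * \<rho> * (\<upsilon> m / \<gamma> m))) + 2 * (Rh * \<rho>)"
  proof (intro add_mono mult_left_mono)
    have "head\<^sup>2 \<le> Sh * (\<Sum>j=1..m. \<upsilon> j * (coefs MZ e \<delta> j)\<^sup>2)"
      using infsum_weighted_Cauchy_Schwarz(2)[of "{1..m}" \<upsilon> h "coefs MZ e \<delta>"] \<upsilon> by (simp add: head_def Sh_def)
    also have "\<dots> \<le> Sh * (D * d * \<rho> * (\<upsilon> m / \<gamma> m))" by (intro mult_left_mono approximation_error Sh_nonneg)
    finally show "head\<^sup>2 \<le> Sh * (D * d * \<rho> * (\<upsilon> m / \<gamma> m))" .
    have "tail\<^sup>2 \<le> Rh * (\<Sum>\<^sub>\<infinity>j\<in>{m<..}. \<gamma> j * (coefs MZ e \<phi> j)\<^sup>2)"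
      unfolding tail_def Rh_def by (intro cs(2) \<gamma>')
    also have "\<dots> \<le> Rh * \<rho>" by (intro mult_left_mono \<phi>_tail sub Rh_nonneg)
    finally show "tail\<^sup>2 \<le> Rh * \<rho>" .
  qed auto
  also have "\<dots> = 2 * \<rho> * (D * d) * (\<upsilon> m / \<gamma> m * Sh) + 2 * \<rho> * Rh" by (simp add: algebra_simps)
  also have "\<dots> \<le> 2 * \<rho> * (D * d) * max (\<upsilon> m / \<gamma> m * Sh) Rh + 2 * \<rho> * max (\<upsilon> m / \<gamma> m * Sh) Rh"
    using \<rho> dD by (intro add_mono mult_left_mono) auto
  finally show ?thesis by (simp add: algebra_simps)
qed

lemma bv_norm: "(euclid_norm bv)\<^sup>2 \<le> D * Sh"
proof -
  have "(euclid_norm bv)\<^sup>2 \<le> D * (\<Sum>j<m. (vec_index hv j)\<^sup>2 / \<upsilon> (Suc j))"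
    unfolding bv_def using \<upsilon> vec_carriers by (intro inv_transpose_le Tm) auto
  also have "(\<Sum>j<m. (vec_index hv j)\<^sup>2 / \<upsilon> (Suc j)) = Sh"
    unfolding Sh_def sum_lessThan_Suc_shift[symmetric] by (simp add: hv_def)
  finally show ?thesis .
qed

lemma bv_prod: "v \<in> carrier_vec m \<Longrightarrow> scalar_prod hv (mult_mat_vec (inv_mat Tm) v) = scalar_prod bv v"
  unfolding bv_def using transpose_vec_mult_scalar[of "inv_mat Tm" m m v hv] inv_mat[OF Tm(1,2)] vec_carriers
  by (metis comm_scalar_prod mult_mat_vec_carrier transpose_carrier_mat)

lemma inv_Tm_norm:
  assumes v: "v \<in> carrier_vec m"
  shows "euclid_norm (mult_mat_vec (inv_mat Tm) v) \<le> sqrt (D / \<upsilon> m) * euclid_norm v"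
proof (rule power2_le_imp_le)
  define w where "w = mult_mat_vec (inv_mat Tm) v"
  have w: "w \<in> carrier_vec m" using inv_mat[OF Tm(1,2)] v by (auto simp: w_def)
  have "\<upsilon> m * (euclid_norm w)\<^sup>2 = (\<Sum>j<m. \<upsilon> m * (vec_index w j)\<^sup>2)"
    using w by (simp add: euclid_norm_sq sum_distrib_left)
  also have "\<dots> \<le> (\<Sum>j<m. \<upsilon> (Suc j) * (vec_index w j)\<^sup>2)"
    using \<upsilon>_anti by (intro sum_mono mult_right_mono) auto
  also have "\<dots> \<le> D * (euclid_norm v)\<^sup>2"
    unfolding w_def using \<upsilon> v by (intro weighted_inv_le Tm) auto
  finally show "(euclid_norm (mult_mat_vec (inv_mat Tm) v))\<^sup>2 \<le> (sqrt (D / \<upsilon> m) * euclid_norm v)\<^sup>2"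
    unfolding w_def[symmetric] using \<upsilon>[OF m] D0 by (simp add: power_mult_distrib field_simps)
qed (use D0 \<upsilon>[OF m] in auto)

end

section \<open>Risk bounds\<close>

lemma integrable_power4_sum:
  fixes X :: "'i \<Rightarrow> 'a \<Rightarrow> real"
  assumes "finite I" "\<And>i. i \<in> I \<Longrightarrow> X i \<in> borel_measurable M" "\<And>i. i \<in> I \<Longrightarrow> integrable M (\<lambda>x. X i x ^ 4)"
  shows "integrable M (\<lambda>x. (\<Sum>i\<in>I. X i x) ^ 4)"
  using assms
proof (induction I rule: finite_induct)
  case (insert i I)
  have "integrable M (\<lambda>x. 8 * (X i x ^ 4 + (\<Sum>i\<in>I. X i x) ^ 4))" using insert by auto
  moreover have "(\<lambda>x. (X i x + (\<Sum>i\<in>I. X i x)) ^ 4) \<in> borel_measurable M"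
    using insert.prems(1) by (intro borel_measurable_power borel_measurable_add borel_measurable_sum) auto
  ultimately have "integrable M (\<lambda>x. (X i x + (\<Sum>i\<in>I. X i x)) ^ 4)"
    by (rule Bochner_Integration.integrable_bound) (simp only: real_norm_def zero_le_even_power even_numeral abs_of_nonneg mult_nonneg_nonneg add_nonneg_nonneg power4_sum_le zero_le_numeral eventually_True)
  then show ?case using insert.hyps by simp
qed simp

lemma sum_power2_le: "(\<Sum>i\<in>I. x i)\<^sup>2 \<le> real (card I) * (\<Sum>i\<in>I. (x i)\<^sup>2)" for x :: "'i \<Rightarrow> real"
  using Cauchy_Schwarz_ineq_sum[of "\<lambda>_. 1" x I] by simp

context npiv
begin

section \<open>The sample and its centred averages\<close>

definition "Q = obs_law P \<phi>"
definition "S = sample_law P \<phi> n"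
text \<open>A function of an observation, so that \<open>uu x\<close> is here the observed response
  and not the noise. At \<open>Y = \<phi>(Z) + U\<close> it becomes
  \<open>(U + \<delta>(Z)) * f l (W)\<close>.\<close>

definition "resid l x = (uu x - (\<Sum>j=1..m. cc j * e j (zz x))) * f l (ww x)"
definition "V l s = (\<Sum>i=1..n. resid l (s i)) / n"
definition "cent j l x = e j (zz x) * f l (ww x) - ip MW (T (e j)) (f l)"
definition "Xi j l s = (\<Sum>i=1..n. cent j l (s i)) / n"
text \<open>\<open>K4\<close> and \<open>K2\<close> are the constants of
  \<open>residual_fourth\<close> and \<open>residual_second\<close> at the radius from
  \<open>\<delta>_smooth\<close>. They depend neither on \<open>m\<close> and \<open>n\<close> nor
  on the law.\<close>

definition "K4 = 8 * (\<sigma> ^ 4 * \<eta> ^ 4 + (\<rho> * (1 + D * d))\<^sup>2 * G\<^sup>2 * (8 * (24 * \<eta> ^ 4 + 1)))"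
definition "K2 = 2 * (\<sigma>\<^sup>2 + \<rho> * (1 + D * d) * G * \<eta>\<^sup>2)"

lemma K_nonneg: "0 \<le> K4" "0 \<le> K2"
  unfolding K4_def K2_def using \<eta> \<rho> D0 dD G by (auto intro!: add_nonneg_nonneg mult_nonneg_nonneg)

lemma \<phi>_measurable [measurable]: "\<phi> \<in> borel_measurable MZ"
  using \<phi>_L2 by (simp add: L2_def)

lemma obs_map: "(\<lambda>x. (\<phi> (zz x) + uu x, snd x)) \<in> measurable P P"
  by measurable

lemma Q_eq: "Q = distr P P (\<lambda>x. (\<phi> (zz x) + uu x, snd x))"
  by (simp add: Q_def obs_law_def case_prod_beta')

lemma S_eq: "S = Pi\<^sub>M {1..n} (\<lambda>_. Q)"
  by (simp add: S_def sample_law_def Q_def)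

lemma prob_space_Q: "prob_space Q"
  unfolding Q_eq by (rule P.prob_space_distr[OF obs_map])

sublocale S: prob_space S
  unfolding S_eq by (rule prob_space_iid[OF prob_space_Q])

lemma Q_measurable: "borel_measurable Q = borel_measurable P"
proof -
  have "sets Q = sets P" by (simp add: Q_eq)
  then show ?thesis by (rule measurable_cong_sets[OF _ refl])
qed

lemma integral_Q: "F \<in> borel_measurable P \<Longrightarrow> integral\<^sup>L Q F = (\<integral>x. F (\<phi> (zz x) + uu x, snd x) \<partial>P)" for F :: "_ \<Rightarrow> real"
  unfolding Q_eq by (rule integral_distr[OF obs_map])

lemma integrable_Q: "F \<in> borel_measurable P \<Longrightarrow> integrable Q F \<longleftrightarrow> integrable P (\<lambda>x. F (\<phi> (zz x) + uu x, snd x))" for F :: "_ \<Rightarrow> real"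
  unfolding Q_eq by (rule integrable_distr_eq[OF obs_map])

lemma nn_integral_Q: "F \<in> borel_measurable P \<Longrightarrow> integral\<^sup>N Q F = (\<integral>\<^sup>+x. F (\<phi> (zz x) + uu x, snd x) \<partial>P)" for F :: "_ \<Rightarrow> ennreal"
  unfolding Q_eq by (rule nn_integral_distr[OF obs_map]) simp

lemma resid_measurable: "1 \<le> l \<Longrightarrow> resid l \<in> borel_measurable P"
proof -
  assume l: "1 \<le> l"
  have [measurable]: "(\<lambda>z. \<Sum>j=1..m. cc j * e j z) \<in> borel_measurable MZ"
    using onb_sum_L2[OF onb_e] by (simp add: L2_def)
  note [measurable] = f_measurable[OF l]
  show ?thesis unfolding resid_def[abs_def] by measurable
qed

lemma cent_measurable: "1 \<le> j \<Longrightarrow> 1 \<le> l \<Longrightarrow> cent j l \<in> borel_measurable P"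
proof -
  assume j: "1 \<le> j" and l: "1 \<le> l"
  note [measurable] = f_measurable[OF l] e_measurable[OF j]
  show ?thesis unfolding cent_def[abs_def] by measurable
qed

lemma resid_obs: "resid l (\<phi> (zz x) + uu x, snd x) = (uu x + \<delta> (zz x)) * f l (ww x)"
  by (simp add: resid_def \<delta>_def)

lemma cent_obs: "cent j l (\<phi> (zz x) + uu x, snd x) = cent j l x"
  by (simp add: cent_def)

lemma smooth_nonneg: "0 \<le> \<rho> * (1 + D * d)" using \<rho> D0 dD by simp

lemma resid_moments:
  assumes l: "1 \<le> l" "l \<le> m"
  shows "integrable Q (\<lambda>x. resid l x ^ 4)" "integral\<^sup>L Q (resid l) = 0" "integral\<^sup>L Q (\<lambda>x. resid l x ^ 4) \<le> K4"
proof -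
  have meas: "resid l \<in> borel_measurable P" "(\<lambda>x. resid l x ^ 4) \<in> borel_measurable P"
    using resid_measurable[OF l(1)] by auto
  note r4 = residual_fourth[OF \<gamma> smooth_nonneg G \<delta>_L2 \<delta>_smooth \<gamma>G l(1)]
  show "integrable Q (\<lambda>x. resid l x ^ 4)" using r4(1) by (subst integrable_Q[OF meas(2)]) (simp add: resid_obs)
  show "integral\<^sup>L Q (\<lambda>x. resid l x ^ 4) \<le> K4" using r4(2) by (subst integral_Q[OF meas(2)]) (simp add: resid_obs K4_def)
  show "integral\<^sup>L Q (resid l) = 0"
    using residual_mean(2)[OF \<gamma> smooth_nonneg G \<delta>_L2 \<delta>_smooth \<gamma>G f_L2[OF l(1)]] \<delta>_orthogonal[OF l]
    by (subst integral_Q[OF meas(1)]) (simp add: resid_obs)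
qed

lemma V_fourth:
  assumes l: "1 \<le> l" "l \<le> m"
  shows "integrable S (\<lambda>s. V l s ^ 4)" "S.expectation (\<lambda>s. V l s ^ 4) \<le> 3 * K4 / (real n)\<^sup>2"
  using iid_mean_moments[OF prob_space_Q _ n resid_moments[OF l]] resid_measurable[OF l(1)]
  unfolding V_def S_eq Q_measurable by auto

lemma measurable_mean:
  fixes F :: "real \<times> 'z \<times> 'w \<Rightarrow> real"
  assumes "F \<in> borel_measurable P"
  shows "(\<lambda>s. (\<Sum>i=1..n. F (s i)) / real n) \<in> borel_measurable S"
proof -
  have "(\<lambda>s. F (s i)) \<in> borel_measurable S" if "i \<in> {1..n}" for i
    unfolding S_eq using assms that
    by (intro measurable_compose[OF measurable_component_singleton[of i "{1..n}"]]) (auto simp: Q_measurable)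
  then show ?thesis by (intro borel_measurable_divide borel_measurable_sum) auto
qed

lemma Xi_measurable: "1 \<le> j \<Longrightarrow> 1 \<le> l \<Longrightarrow> Xi j l \<in> borel_measurable S"
  unfolding Xi_def[abs_def] by (intro measurable_mean cent_measurable)

text \<open>The combination is treated as one average, of the residual multiplied by
  \<open>\<Sum>l=1..m. b l * f l w\<close>. Cauchy-Schwarz over the \<open>V l\<close> would lose a
  factor \<open>m\<close>, which the linear term cannot afford.\<close>

lemma linear_V_second:
  fixes b :: "nat \<Rightarrow> real"
  shows "integrable S (\<lambda>s. (\<Sum>l=1..m. b l * V l s)\<^sup>2)"
    and "S.expectation (\<lambda>s. (\<Sum>l=1..m. b l * V l s)\<^sup>2) \<le> K2 * (\<Sum>l=1..m. (b l)\<^sup>2) / n"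
proof -
  let ?F = "\<lambda>x. \<Sum>l=1..m. b l * resid l x"
  let ?g = "\<lambda>w. \<Sum>l=1..m. b l * f l w"
  have meas: "?F \<in> borel_measurable P" "(\<lambda>x. (?F x)\<^sup>2) \<in> borel_measurable P"
    using resid_measurable by (auto intro!: borel_measurable_sum borel_measurable_power)
  have eq: "(\<Sum>l=1..m. b l * V l s) = (\<Sum>i=1..n. ?F (s i)) / n" for s
    unfolding V_def times_divide_eq_right sum_divide_distrib[symmetric] sum_distrib_left by (subst sum.swap) simp
  have g: "?g \<in> L2 MW" by (rule onb_sum_L2[OF onb_f])
  have obs: "?F (\<phi> (zz x) + uu x, snd x) = (uu x + \<delta> (zz x)) * ?g (ww x)" for x
    by (simp add: resid_obs sum_distrib_left mult_ac)
  have i4: "integrable Q (\<lambda>x. ?F x ^ 4)"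
    using resid_measurable resid_moments(1)
    by (intro integrable_power4_sum) (auto simp: Q_measurable power_mult_distrib simp del: One_nat_def)
  have mean: "integral\<^sup>L Q ?F = 0"
  proof -
    have "integral\<^sup>L Q ?F = ip MW (T \<delta>) ?g"
      unfolding integral_Q[OF meas(1)] obs
      by (rule residual_mean(2)[OF \<gamma> smooth_nonneg G \<delta>_L2 \<delta>_smooth \<gamma>G g])
    also have "\<dots> = (\<Sum>l=1..m. b l * ip MW (T \<delta>) (f l))"
      unfolding ip_commute[of MW "T \<delta>"]
      by (subst ip_sum) (auto intro!: L2_cmult f_L2 T_L2[OF \<delta>_L2] simp: ip_cmult)
    finally show ?thesis using \<delta>_orthogonal by (simp del: One_nat_def)
  qed
  have var: "integral\<^sup>L Q (\<lambda>x. (?F x)\<^sup>2) \<le> K2 * (\<Sum>l=1..m. (b l)\<^sup>2)"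
    unfolding integral_Q[OF meas(2)] obs K2_def onb_sum_sqnorm[OF onb_f, symmetric]
    by (rule residual_second[OF \<gamma> smooth_nonneg G \<delta>_L2 \<delta>_smooth \<gamma>G g])
  have nn: "0 \<le> K2 * (\<Sum>l=1..m. (b l)\<^sup>2)" using K_nonneg by (intro mult_nonneg_nonneg sum_nonneg) auto
  have "?F \<in> borel_measurable Q" using meas by (simp add: Q_measurable)
  note r = iid_mean_square[OF prob_space_Q this n i4 mean var nn]
  show "integrable S (\<lambda>s. (\<Sum>l=1..m. b l * V l s)\<^sup>2)"
    using r(1) unfolding eq S_eq .
  show "S.expectation (\<lambda>s. (\<Sum>l=1..m. b l * V l s)\<^sup>2) \<le> K2 * (\<Sum>l=1..m. (b l)\<^sup>2) / n"
    using r(2) unfolding eq S_eq .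
qed

lemma cent_moments:
  assumes j: "1 \<le> j" and l: "1 \<le> l"
  shows "integrable Q (cent j l)" "integral\<^sup>L Q (cent j l) = 0"
    and "(\<integral>\<^sup>+x. ennreal ((cent j l x)\<^sup>2) \<partial>Q) \<le> ennreal (\<eta>\<^sup>2)"
    and "3 \<le> k \<Longrightarrow> (\<integral>\<^sup>+x. ennreal (\<bar>cent j l x\<bar> ^ k) \<partial>Q) \<le> ennreal (\<eta> ^ k * fact k)"
    and "integrable Q (\<lambda>x. cent j l x ^ 4)" "integral\<^sup>L Q (\<lambda>x. cent j l x ^ 4) \<le> 24 * \<eta> ^ 4"
proof -
  note [measurable] = cent_measurable[OF j l]
  have mean: "(\<integral>x. e j (zz x) * f l (ww x) \<partial>P) = ip MW (T (e j)) (f l)"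
    by (rule cond_exp_ip[OF e_L2[OF j] f_L2[OF l]])
  have i: "integrable P (\<lambda>x. e j (zz x) * f l (ww x))"
    by (intro L2_mult_integrable L2_Z L2_W e_L2 f_L2 j l)
  show "integrable Q (cent j l)"
    using i by (subst integrable_Q) (simp_all add: cent_obs, simp add: cent_def)
  show "integral\<^sup>L Q (cent j l) = 0"
    using i mean by (subst integral_Q) (simp_all add: cent_obs, simp add: cent_def P.prob_space)
  show "(\<integral>\<^sup>+x. ennreal ((cent j l x)\<^sup>2) \<partial>Q) \<le> ennreal (\<eta>\<^sup>2)"
    using ef_centred_second[OF j l] by (subst nn_integral_Q) (simp_all add: cent_obs, simp add: cent_def mean)
  show mom: "(\<integral>\<^sup>+x. ennreal (\<bar>cent j l x\<bar> ^ k) \<partial>Q) \<le> ennreal (\<eta> ^ k * fact k)" if "3 \<le> k" for k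
    using ef_moment[OF j l that] by (subst nn_integral_Q) (simp_all add: cent_obs, simp add: cent_def mean)
  have 4: "(\<integral>\<^sup>+x. ennreal (cent j l x ^ 4) \<partial>Q) \<le> ennreal (24 * \<eta> ^ 4)"
    using mom[of 4] by (simp add: fact_numeral mult.commute)
  then show int: "integrable Q (\<lambda>x. cent j l x ^ 4)"
    by (intro integrableI_nonneg) (auto simp: Q_measurable intro: le_less_trans)
  show "integral\<^sup>L Q (\<lambda>x. cent j l x ^ 4) \<le> 24 * \<eta> ^ 4"
    using 4 by (subst (asm) nn_integral_eq_integral[OF int]) auto
qed

lemma Xi_fourth:
  assumes "1 \<le> j" "1 \<le> l"
  shows "integrable S (\<lambda>s. Xi j l s ^ 4)" "S.expectation (\<lambda>s. Xi j l s ^ 4) \<le> 72 * \<eta> ^ 4 / (real n)\<^sup>2"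
  using iid_mean_moments[OF prob_space_Q _ n cent_moments(5)[OF assms] cent_moments(2)[OF assms] cent_moments(6)[OF assms]]
    cent_measurable[OF assms]
  unfolding Xi_def S_eq Q_measurable by auto

lemma Xi_tail:
  fixes t :: real
  assumes "1 \<le> j" "1 \<le> l" "0 < t" "t \<le> 2 * \<eta>"
  shows "S.prob {s \<in> space S. t \<le> \<bar>Xi j l s\<bar>} \<le> 2 * exp (- (n * t\<^sup>2 / (8 * \<eta>\<^sup>2)))"
  unfolding Xi_def S_eq
  by (rule iid_mean_tail[OF prob_space_Q n cent_moments(1,2,3)[OF assms(1,2)] _ assms(3,4)])
    (rule cent_moments(4)[OF assms(1,2)])

text \<open>The empirical residual of the Galerkin solution consists of averages of mean-zero
  variables, which is the reason for centring there.\<close>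

lemma residual_vec: "g_hat f n m s - mult_mat_vec (T_hat e f n m s) cv = vec m (\<lambda>l. V (Suc l) s)"
proof (rule eq_vecI)
  fix l assume "l < dim_vec (vec m (\<lambda>l. V (Suc l) s))"
  then have l: "l < m" by simp
  have "vec_index (mult_mat_vec (T_hat e f n m s) cv) l
      = (\<Sum>j<m. (\<Sum>i=1..n. f (Suc l) (ww (s i)) * e (Suc j) (zz (s i))) / real n * cc (Suc j))"
    using l vec_carriers(2) by (simp add: T_hat_def scalar_prod_def case_prod_beta' cc_def lessThan_atLeast0)
  also have "\<dots> = (\<Sum>j=1..m. (\<Sum>i=1..n. f (Suc l) (ww (s i)) * e j (zz (s i))) / real n * cc j)"
    by (rule sum_lessThan_Suc_shift)
  also have "\<dots> = (\<Sum>j=1..m. \<Sum>i=1..n. f (Suc l) (ww (s i)) * (cc j * e j (zz (s i)))) / real n"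
    by (simp only: sum_divide_distrib sum_distrib_right) (simp add: mult_ac)
  also have "\<dots> = (\<Sum>i=1..n. f (Suc l) (ww (s i)) * (\<Sum>j=1..m. cc j * e j (zz (s i)))) / real n"
    by (subst sum.swap) (simp add: sum_distrib_left)
  finally have "vec_index (mult_mat_vec (T_hat e f n m s) cv) l
      = (\<Sum>i=1..n. f (Suc l) (ww (s i)) * (\<Sum>j=1..m. cc j * e j (zz (s i)))) / real n" .
  moreover have "vec_index (g_hat f n m s) l = (\<Sum>i=1..n. uu (s i) * f (Suc l) (ww (s i))) / real n"
    using l by (simp add: g_hat_def case_prod_beta')
  moreover have "(\<Sum>i=1..n. uu (s i) * f (Suc l) (ww (s i))) / real n
      - (\<Sum>i=1..n. f (Suc l) (ww (s i)) * (\<Sum>j=1..m. cc j * e j (zz (s i)))) / real n = V (Suc l) s"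
    unfolding V_def resid_def left_diff_distrib sum_subtractf diff_divide_distrib by (simp only: mult.commute)
  moreover have "vec_index (g_hat f n m s - mult_mat_vec (T_hat e f n m s) cv) l
      = vec_index (g_hat f n m s) l - vec_index (mult_mat_vec (T_hat e f n m s) cv) l"
    using l by (intro index_minus_vec) (simp add: T_hat_def)
  ultimately show "vec_index (g_hat f n m s - mult_mat_vec (T_hat e f n m s) cv) l = vec_index (vec m (\<lambda>l. V (Suc l) s)) l"
    using l by simp
qed (simp add: g_hat_def T_hat_def)

lemma T_hat_error: "T_hat e f n m s - Tm = mat m m (\<lambda>(l, j). Xi (Suc j) (Suc l) s)"
proof (rule eq_matI)
  fix l j assume "l < dim_row (mat m m (\<lambda>(l, j). Xi (Suc j) (Suc l) s))" "j < dim_col (mat m m (\<lambda>(l, j). Xi (Suc j) (Suc l) s))"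
  then have "l < m" "j < m" by auto
  then show "(T_hat e f n m s - Tm) $$ (l, j) = mat m m (\<lambda>(l, j). Xi (Suc j) (Suc l) s) $$ (l, j)"
    using n by (simp add: T_hat_def Tm_def op_matrix_def Xi_def cent_def case_prod_beta' sum_subtractf diff_divide_distrib mult.commute)
qed (simp_all add: T_hat_def Tm_def op_matrix_def)

text \<open>\<open>NV\<close> is the squared norm of the empirical residual, \<open>NX\<close> the
  squared Frobenius norm of the matrix error, and \<open>bV\<close> the linear part of the
  error.\<close>

definition "NV s = (\<Sum>l<m. (V (Suc l) s)\<^sup>2)"
definition "NX s = (\<Sum>l<m. \<Sum>j<m. (Xi (Suc j) (Suc l) s)\<^sup>2)"
definition "err s = l_hat e f h n m s - lin_functional h (coefs MZ e \<phi>)"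
definition "bV s = (\<Sum>l=1..m. vec_index bv (l - 1) * V l s)"

lemma N_nonneg: "0 \<le> NV s" "0 \<le> NX s"
  by (auto simp: NV_def NX_def intro!: sum_nonneg)

lemma T_hat_carrier: "T_hat e f n m s \<in> carrier_mat m m" and g_hat_carrier: "g_hat f n m s \<in> carrier_vec m"
  by (auto simp: T_hat_def g_hat_def)

lemma frob_T_hat: "frob_sq (T_hat e f n m s - Tm) = NX s"
  unfolding T_hat_error frob_sq_def NX_def by (auto intro!: sum.cong)

lemma norm_residual: "(euclid_norm (g_hat f n m s - mult_mat_vec (T_hat e f n m s) cv))\<^sup>2 = NV s"
  unfolding residual_vec euclid_norm_sq NV_def by simp

lemma bv_residual: "scalar_prod bv (g_hat f n m s - mult_mat_vec (T_hat e f n m s) cv) = bV s"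
  unfolding residual_vec bV_def
  using sum_lessThan_Suc_shift[of "\<lambda>l. vec_index bv (l - 1) * V l s" m] by (simp add: scalar_prod_def lessThan_atLeast0)

section \<open>Pointwise error bounds\<close>

lemma hv_norm: "(euclid_norm hv)\<^sup>2 = (\<Sum>j=1..m. (h j)\<^sup>2)"
  unfolding sum_lessThan_Suc_shift[symmetric] by (simp add: euclid_norm_sq hv_def)

lemma l_hat_eq: "l_hat e f h n m s =
     (if invertible_mat (T_hat e f n m s) \<and> spectral_norm (inv_mat (T_hat e f n m s)) \<le> sqrt n
      then scalar_prod hv (mult_mat_vec (inv_mat (T_hat e f n m s)) (g_hat f n m s)) else 0)"
  by (simp add: l_hat_def hv_def)

text \<open>Valid for every sample: either the cut-off bounds the inverse by \<open>sqrt n\<close>,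
  or the estimator is 0 and the error is the target value itself.\<close>

lemma err_crude:
  "(err s)\<^sup>2 \<le> 2 * n * (\<Sum>j=1..m. (h j)\<^sup>2) * NV s + 2 * bias\<^sup>2 + (lin_functional h (coefs MZ e \<phi>))\<^sup>2"
proof (cases "invertible_mat (T_hat e f n m s) \<and> spectral_norm (inv_mat (T_hat e f n m s)) \<le> sqrt n")
  case True
  define x where "x = scalar_prod hv (mult_mat_vec (inv_mat (T_hat e f n m s)) (g_hat f n m s)) - scalar_prod hv cv"
  have "\<bar>x\<bar> \<le> euclid_norm hv * (sqrt n * euclid_norm (g_hat f n m s - mult_mat_vec (T_hat e f n m s) cv))"
    unfolding x_def using True by (intro plug_in_error_crude[OF T_hat_carrier _ _ g_hat_carrier vec_carriers(2,1)]) auto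
  then have "\<bar>x\<bar>\<^sup>2 \<le> (euclid_norm hv * (sqrt n * euclid_norm (g_hat f n m s - mult_mat_vec (T_hat e f n m s) cv)))\<^sup>2"
    by (intro power_mono) auto
  then have x: "x\<^sup>2 \<le> (\<Sum>j=1..m. (h j)\<^sup>2) * (n * NV s)"
    unfolding power_mult_distrib norm_residual hv_norm by simp
  have "(err s)\<^sup>2 = (x + bias)\<^sup>2" using True by (simp add: err_def l_hat_eq x_def bias_def)
  also have "\<dots> \<le> 2 * x\<^sup>2 + 2 * bias\<^sup>2" using sum_squares_bound[of x bias] by (simp add: power2_sum)
  finally have "(err s)\<^sup>2 \<le> 2 * x\<^sup>2 + 2 * bias\<^sup>2" .
  moreover have "2 * n * (\<Sum>j=1..m. (h j)\<^sup>2) * NV s = 2 * ((\<Sum>j=1..m. (h j)\<^sup>2) * (n * NV s))" by simp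
  ultimately show ?thesis
    using x zero_le_power2[of "lin_functional h (coefs MZ e \<phi>)"] by linarith
next
  case False
  then have "(err s)\<^sup>2 = (lin_functional h (coefs MZ e \<phi>))\<^sup>2" by (auto simp: err_def l_hat_eq)
  then show ?thesis using N_nonneg by (auto intro!: add_nonneg_nonneg mult_nonneg_nonneg sum_nonneg)
qed

text \<open>With \<open>\<beta> = sqrt (D / \<upsilon> m)\<close>, the condition on
  \<open>NX\<close> is exactly what makes \<open>\<beta>\<close> times the Frobenius norm at most
  one half. The perturbed inverse then has norm at most \<open>2 * \<beta>\<close>, which
  \<open>large\<close> bounds by \<open>sqrt n\<close>, so the cut-off is inactive.\<close>

lemma err_fine:
  assumes X: "NX s \<le> \<upsilon> m / (4 * D)" and large: "4 * D / \<upsilon> m \<le> n"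
  shows "(err s)\<^sup>2 \<le> 3 * (bV s)\<^sup>2 + 12 * (D / \<upsilon> m) * (D * Sh) * (NX s * NV s) + 3 * bias\<^sup>2"
proof -
  define \<beta> where "\<beta> = sqrt (D / \<upsilon> m)"
  have \<upsilon>m: "0 < \<upsilon> m" using \<upsilon> m by simp
  have \<beta>: "0 \<le> \<beta>" "\<beta>\<^sup>2 = D / \<upsilon> m" using D0 \<upsilon>m by (auto simp: \<beta>_def)
  have "\<beta> * sqrt (NX s) \<le> \<beta> * sqrt (\<upsilon> m / (4 * D))"
    using X \<beta> by (intro mult_left_mono real_sqrt_le_mono) auto
  also have "\<dots> = sqrt (1 / 4)" unfolding \<beta>_def real_sqrt_mult[symmetric] using D0 \<upsilon>m by simp
  also have "\<dots> = 1 / 2" by (simp add: real_sqrt_divide)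
  finally have small: "\<beta> * sqrt (frob_sq (T_hat e f n m s - Tm)) \<le> 1 / 2" unfolding frob_T_hat .
  note B = inv_Tm_norm[folded \<beta>_def]
  note pert = perturbed_inverse[OF Tm(1,2) T_hat_carrier B \<beta>(1) small]
  have "2 * \<beta> = sqrt (4 * D / \<upsilon> m)" by (simp add: \<beta>_def real_sqrt_mult real_sqrt_divide)
  also have "\<dots> \<le> sqrt n" using large by (rule real_sqrt_le_mono)
  finally have "spectral_norm (inv_mat (T_hat e f n m s)) \<le> sqrt n"
    using inv_mat(1)[OF T_hat_carrier pert(1)] \<beta>(1)
    by (intro spectral_norm_le[of _ m m]) (auto intro!: order_trans[OF pert(2)] mult_right_mono)
  then have lhat: "l_hat e f h n m s = scalar_prod hv (mult_mat_vec (inv_mat (T_hat e f n m s)) (g_hat f n m s))"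
    using pert(1) by (simp add: l_hat_eq)
  define x where "x = l_hat e f h n m s - scalar_prod hv cv - bV s"
  have "\<bar>x\<bar> \<le> euclid_norm bv * (sqrt (NX s) * (2 * \<beta> * euclid_norm (g_hat f n m s - mult_mat_vec (T_hat e f n m s) cv)))"
    unfolding x_def lhat bv_residual[symmetric] frob_T_hat[symmetric]
    by (rule plug_in_error_fine[OF Tm(1,2) T_hat_carrier B \<beta>(1) small g_hat_carrier vec_carriers(2,1,3) bv_prod])
  then have "\<bar>x\<bar>\<^sup>2 \<le> (euclid_norm bv * (sqrt (NX s) * (2 * \<beta> * euclid_norm (g_hat f n m s - mult_mat_vec (T_hat e f n m s) cv))))\<^sup>2"
    by (intro power_mono) auto
  then have "x\<^sup>2 \<le> (euclid_norm bv)\<^sup>2 * (NX s * (4 * (D / \<upsilon> m) * NV s))"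
    unfolding power_mult_distrib norm_residual \<beta>(2) using N_nonneg by simp
  also have "\<dots> \<le> (D * Sh) * (NX s * (4 * (D / \<upsilon> m) * NV s))"
    using bv_norm N_nonneg D0 \<upsilon>m by (intro mult_right_mono) auto
  finally have x: "x\<^sup>2 \<le> (D * Sh) * (NX s * (4 * (D / \<upsilon> m) * NV s))" .
  have "(err s)\<^sup>2 = (bV s + x + bias)\<^sup>2" by (simp add: err_def x_def bias_def)
  also have "\<dots> \<le> 3 * ((bV s)\<^sup>2 + x\<^sup>2 + bias\<^sup>2)"
  proof -
    have "0 \<le> (bV s - x)\<^sup>2 + (bV s - bias)\<^sup>2 + (x - bias)\<^sup>2" by simp
    then show ?thesis by (simp add: power2_eq_square algebra_simps)
  qed
  also have "\<dots> \<le> 3 * ((bV s)\<^sup>2 + (D * Sh) * (NX s * (4 * (D / \<upsilon> m) * NV s)) + bias\<^sup>2)" using x by simp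
  also have "\<dots> = 3 * (bV s)\<^sup>2 + 12 * (D / \<upsilon> m) * (D * Sh) * (NX s * NV s) + 3 * bias\<^sup>2" by (simp add: algebra_simps)
  finally show ?thesis .
qed

text \<open>Sums of fourth powers over entries bound the squares of \<open>NV\<close> and
  \<open>NX\<close> pointwise. Products of dependent quantities thus reduce to expectations of
  single entries.\<close>

definition "SV s = (\<Sum>l<m. V (Suc l) s ^ 4)"
definition "SX s = (\<Sum>l<m. \<Sum>j<m. Xi (Suc j) (Suc l) s ^ 4)"

lemma S_nonneg: "0 \<le> SV s" "0 \<le> SX s"
  by (auto simp: SV_def SX_def intro!: sum_nonneg)

lemma NV_sq: "(NV s)\<^sup>2 \<le> m * SV s"
  unfolding NV_def SV_def using sum_power2_le[of "\<lambda>l. (V (Suc l) s)\<^sup>2" "{..<m}"] by simp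

lemma NX_sq: "(NX s)\<^sup>2 \<le> m\<^sup>2 * SX s"
proof -
  have "(NX s)\<^sup>2 \<le> m * (\<Sum>l<m. (\<Sum>j<m. (Xi (Suc j) (Suc l) s)\<^sup>2)\<^sup>2)"
    unfolding NX_def using sum_power2_le[of _ "{..<m}"] by simp
  also have "\<dots> \<le> m * (\<Sum>l<m. m * (\<Sum>j<m. ((Xi (Suc j) (Suc l) s)\<^sup>2)\<^sup>2))"
  proof (intro mult_left_mono sum_mono)
    show "(\<Sum>j<m. (Xi (Suc j) (Suc l) s)\<^sup>2)\<^sup>2 \<le> m * (\<Sum>j<m. ((Xi (Suc j) (Suc l) s)\<^sup>2)\<^sup>2)" for l
      using sum_power2_le[of "\<lambda>j. (Xi (Suc j) (Suc l) s)\<^sup>2" "{..<m}"] by simp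
  qed simp
  also have "\<dots> = m\<^sup>2 * SX s"
    by (simp add: SX_def power2_eq_square[of "real m"] sum_distrib_left[symmetric] mult.assoc)
  finally show ?thesis .
qed

lemma SV_expectation: "integrable S SV" "S.expectation SV \<le> m * (3 * K4 / (real n)\<^sup>2)"
proof -
  have i: "integrable S (\<lambda>s. V (Suc l) s ^ 4)" "S.expectation (\<lambda>s. V (Suc l) s ^ 4) \<le> 3 * K4 / (real n)\<^sup>2" if "l < m" for l
    using V_fourth[of "Suc l"] that by auto
  show "integrable S SV" unfolding SV_def[abs_def] using i by auto
  have "S.expectation SV = (\<Sum>l<m. S.expectation (\<lambda>s. V (Suc l) s ^ 4))"
    unfolding SV_def[abs_def] using i by auto
  also have "\<dots> \<le> (\<Sum>l<m. 3 * K4 / (real n)\<^sup>2)" using i by (intro sum_mono) auto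
  finally show "S.expectation SV \<le> m * (3 * K4 / (real n)\<^sup>2)" by simp
qed

lemma SX_expectation: "integrable S SX" "S.expectation SX \<le> m\<^sup>2 * (72 * \<eta> ^ 4 / (real n)\<^sup>2)"
proof -
  have i: "integrable S (\<lambda>s. Xi (Suc j) (Suc l) s ^ 4)" "S.expectation (\<lambda>s. Xi (Suc j) (Suc l) s ^ 4) \<le> 72 * \<eta> ^ 4 / (real n)\<^sup>2" for l j
    using Xi_fourth[of "Suc j" "Suc l"] by auto
  show "integrable S SX" unfolding SX_def[abs_def] using i by auto
  have "S.expectation SX = (\<Sum>l<m. \<Sum>j<m. S.expectation (\<lambda>s. Xi (Suc j) (Suc l) s ^ 4))"
    unfolding SX_def[abs_def] using i by auto
  also have "\<dots> \<le> (\<Sum>l<m. \<Sum>j<m. 72 * \<eta> ^ 4 / (real n)\<^sup>2)" using i by (intro sum_mono) auto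
  finally show "S.expectation SX \<le> m\<^sup>2 * (72 * \<eta> ^ 4 / (real n)\<^sup>2)" by (simp add: power2_eq_square)
qed

lemma bV_expectation: "integrable S (\<lambda>s. (bV s)\<^sup>2)" "S.expectation (\<lambda>s. (bV s)\<^sup>2) \<le> K2 * (D * Sh) / n"
proof -
  show "integrable S (\<lambda>s. (bV s)\<^sup>2)" unfolding bV_def by (rule linear_V_second)
  have "(\<Sum>l=1..m. (vec_index bv (l - 1))\<^sup>2) = (euclid_norm bv)\<^sup>2"
    unfolding sum_lessThan_Suc_shift[symmetric] using vec_carriers by (simp add: euclid_norm_sq)
  then have "S.expectation (\<lambda>s. (bV s)\<^sup>2) \<le> K2 * (euclid_norm bv)\<^sup>2 / n"
    unfolding bV_def using linear_V_second(2)[of "\<lambda>l. vec_index bv (l - 1)"] by simp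
  also have "\<dots> \<le> K2 * (D * Sh) / n"
    using bv_norm K_nonneg by (intro divide_right_mono mult_left_mono) auto
  finally show "S.expectation (\<lambda>s. (bV s)\<^sup>2) \<le> K2 * (D * Sh) / n" .
qed

section \<open>The exceptional event\<close>

definition "bad = {s \<in> space S. \<upsilon> m / (4 * D) < NX s}"
definition "pbad = 2 * (real m)\<^sup>2 * exp (- (n * \<upsilon> m / (32 * D * \<eta>\<^sup>2 * (real m)\<^sup>2)))"

lemma NX_measurable [measurable]: "NX \<in> borel_measurable S"
  unfolding NX_def[abs_def] using Xi_measurable by (intro borel_measurable_sum borel_measurable_power) auto

lemma bad_sets [measurable]: "bad \<in> sets S"
  unfolding bad_def by measurable

text \<open>If the squared Frobenius norm exceeds \<open>\<upsilon> m / (4 * D)\<close>, one of the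
  \<open>m\<^sup>2\<close> entries reaches the square root of this threshold divided by
  \<open>m\<close>. A union bound with two tails per entry gives \<open>pbad\<close>; since
  \<open>\<upsilon> m \<le> 1 \<le> D\<close> and \<open>1 \<le> \<eta>\<close>, the threshold is in
  the range where \<open>Xi_tail\<close> applies.\<close>

lemma bad_prob:
  assumes "\<upsilon> m \<le> 1"
  shows "S.prob bad \<le> pbad"
proof -
  have \<upsilon>m: "0 < \<upsilon> m" using \<upsilon> m by simp
  define t where "t = sqrt (\<upsilon> m / (4 * D)) / m"
  have t: "0 < t" "m\<^sup>2 * t\<^sup>2 = \<upsilon> m / (4 * D)" using \<upsilon>m D0 m by (auto simp: t_def power_divide)
  have "t \<le> sqrt (\<upsilon> m / (4 * D))" using m \<upsilon>m D0 by (simp add: t_def field_simps mult_le_cancel_left1)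
  also have "\<dots> \<le> sqrt 1" using assms dD D0 \<upsilon>m by (intro real_sqrt_le_mono) (simp add: field_simps)
  finally have t2: "t \<le> 2 * \<eta>" using \<eta> by simp
  let ?B = "\<lambda>l j. {s \<in> space S. t \<le> \<bar>Xi (Suc j) (Suc l) s\<bar>}"
  have meas: "?B l j \<in> sets S" for l j
    using Xi_measurable[of "Suc j" "Suc l"] by measurable
  have "bad \<subseteq> (\<Union>p\<in>{..<m} \<times> {..<m}. ?B (fst p) (snd p))"
  proof
    fix s assume "s \<in> bad"
    then have s: "s \<in> space S" "\<upsilon> m / (4 * D) < NX s" by (auto simp: bad_def)
    have "\<exists>l<m. \<exists>j<m. t \<le> \<bar>Xi (Suc j) (Suc l) s\<bar>"
    proof (rule ccontr)
      assume "\<not> ?thesis"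
      then have lt: "\<bar>Xi (Suc j) (Suc l) s\<bar> < t" if "l < m" "j < m" for l j using that by (meson not_le)
      have "(Xi (Suc j) (Suc l) s)\<^sup>2 \<le> t\<^sup>2" if "l < m" "j < m" for l j
        using lt[OF that] t(1) by (intro abs_le_square_iff[THEN iffD1]) auto
      then have "NX s \<le> (\<Sum>l<m. \<Sum>j<m. t\<^sup>2)" unfolding NX_def by (intro sum_mono) auto
      then have "NX s \<le> m\<^sup>2 * t\<^sup>2" by (simp add: power2_eq_square)
      then show False using s t by simp
    qed
    then show "s \<in> (\<Union>p\<in>{..<m} \<times> {..<m}. ?B (fst p) (snd p))" using s by force
  qed
  then have "S.prob bad \<le> S.prob (\<Union>p\<in>{..<m} \<times> {..<m}. ?B (fst p) (snd p))"
    using meas by (intro S.finite_measure_mono sets.finite_UN) auto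
  also have "\<dots> \<le> (\<Sum>p\<in>{..<m} \<times> {..<m}. S.prob (?B (fst p) (snd p)))"
    using meas by (intro S.finite_measure_subadditive_finite) auto
  also have "\<dots> \<le> (\<Sum>p\<in>{..<m} \<times> {..<m}. 2 * exp (- (n * t\<^sup>2 / (8 * \<eta>\<^sup>2))))"
    using t t2 by (intro sum_mono Xi_tail) auto
  also have "\<dots> = 2 * (real m)\<^sup>2 * exp (- (n * t\<^sup>2 / (8 * \<eta>\<^sup>2)))"
    by (simp add: power2_eq_square)
  also have "n * t\<^sup>2 / (8 * \<eta>\<^sup>2) = n * \<upsilon> m / (32 * D * \<eta>\<^sup>2 * (real m)\<^sup>2)"
    using \<upsilon>m D0 m by (simp add: t_def power_divide)
  finally show ?thesis by (simp add: pbad_def)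
qed

text \<open>\<open>Rn\<close> is the order of the squared bias, \<open>Hm\<close> the squared norm
  of \<open>hv\<close>, and \<open>HH\<close> the squared norm of \<open>h\<close> in the dual
  weighted space.\<close>

definition "Rn = max (\<upsilon> m / \<gamma> m * Sh) Rh"
definition "Hm = (\<Sum>j=1..m. (h j)\<^sup>2)"
definition "HH = (\<Sum>\<^sub>\<infinity>j\<in>{1..}. (h j)\<^sup>2 / \<gamma> j)"

lemma Hm_nonneg: "0 \<le> Hm" and HH_nonneg: "0 \<le> HH"
  unfolding Hm_def HH_def using \<gamma>_nonneg by (auto intro!: sum_nonneg infsum_nonneg)

text \<open>The nonnegative integral is monotone for arbitrary functions. An integrable majorant
  therefore settles the risk, and measurability of the estimator, which contains a matrix inverse,
  does not come up.\<close>

lemma nn_integral_le_expectation: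
  assumes "\<And>s. s \<in> space S \<Longrightarrow> 0 \<le> F s" "\<And>s. s \<in> space S \<Longrightarrow> (err s)\<^sup>2 \<le> F s" "integrable S F" "S.expectation F \<le> c"
  shows "(\<integral>\<^sup>+s. ennreal ((err s)\<^sup>2) \<partial>S) \<le> ennreal c"
proof -
  have "(\<integral>\<^sup>+s. ennreal ((err s)\<^sup>2) \<partial>S) \<le> (\<integral>\<^sup>+s. ennreal (F s) \<partial>S)"
    using assms(2) by (intro nn_integral_mono ennreal_leI)
  also have "\<dots> = ennreal (S.expectation F)"
    using assms by (intro nn_integral_eq_integral) auto
  also have "\<dots> \<le> ennreal c" by (intro ennreal_leI assms)
  finally show ?thesis .
qed

text \<open>Of no use as a rate but valid for all \<open>m\<close> and \<open>n\<close>. It handles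
  the finitely many small \<open>n\<close> and the degenerate case of a vanishing rate.\<close>

lemma risk_crude:
  "(\<integral>\<^sup>+s. ennreal ((err s)\<^sup>2) \<partial>S)
    \<le> ennreal (2 * n * Hm * (1 + m\<^sup>2 * (3 * K4 / (real n)\<^sup>2)) + 4 * \<rho> * (1 + D * d) * Rn + HH * \<rho>)"
proof (rule nn_integral_le_expectation)
  let ?F = "\<lambda>s. 2 * n * Hm * (1 + m * SV s) + (4 * \<rho> * (1 + D * d) * Rn + HH * \<rho>)"
  have Rn: "0 \<le> 4 * \<rho> * (1 + D * d) * Rn + HH * \<rho>"
    using \<rho> D0 dD Rh_nonneg HH_nonneg by (auto simp: Rn_def intro!: add_nonneg_nonneg mult_nonneg_nonneg max.coboundedI2)
  show "0 \<le> ?F s" for s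
  proof (rule add_nonneg_nonneg[OF _ Rn])
    show "0 \<le> 2 * n * Hm * (1 + m * SV s)" using Hm_nonneg S_nonneg[of s] by simp
  qed
  show "(err s)\<^sup>2 \<le> ?F s" for s
  proof -
    have "2 * NV s \<le> (NV s)\<^sup>2 + 1" using sum_squares_bound[of "NV s" 1] by simp
    then have "NV s \<le> 1 + (NV s)\<^sup>2" using zero_le_power2[of "NV s"] by linarith
    also have "\<dots> \<le> 1 + m * SV s" using NV_sq by simp
    finally have "2 * n * Hm * NV s \<le> 2 * n * Hm * (1 + m * SV s)"
      using Hm_nonneg by (intro mult_left_mono) auto
    then show ?thesis
      using err_crude[of s] bias_le lin_functional_le by (simp add: Hm_def HH_def Rn_def)
  qed
  show "integrable S ?F" using SV_expectation(1) by simp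
  have "S.expectation ?F = 2 * n * Hm * (1 + m * S.expectation SV) + (4 * \<rho> * (1 + D * d) * Rn + HH * \<rho>)"
    using SV_expectation(1) by (simp add: S.prob_space)
  also have "\<dots> \<le> 2 * n * Hm * (1 + m * (m * (3 * K4 / (real n)\<^sup>2))) + (4 * \<rho> * (1 + D * d) * Rn + HH * \<rho>)"
    using SV_expectation(2) Hm_nonneg by (intro add_right_mono mult_left_mono add_left_mono) auto
  finally show "S.expectation ?F \<le> 2 * n * Hm * (1 + m\<^sup>2 * (3 * K4 / (real n)\<^sup>2)) + 4 * \<rho> * (1 + D * d) * Rn + HH * \<rho>"
    by (simp add: power2_eq_square mult.assoc add.assoc)
qed

text \<open>Takes the place of Cauchy-Schwarz for expectations: the weight \<open>c\<close> is
  chosen so that the two expectations balance.\<close>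

lemma weighted_am_gm: "2 * (x * y) \<le> c * x\<^sup>2 + y\<^sup>2 / c" if "0 < c" for x y c :: real
proof -
  have "0 \<le> (c * x - y)\<^sup>2 / c" using that by simp
  also have "(c * x - y)\<^sup>2 = c * (c * x\<^sup>2 - 2 * (x * y)) + y\<^sup>2"
    by (simp add: power2_eq_square algebra_simps)
  also have "\<dots> / c = c * x\<^sup>2 - 2 * (x * y) + y\<^sup>2 / c" using that by (simp add: add_divide_distrib)
  finally show ?thesis by simp
qed

text \<open>One majorant dominates the squared error on both events: \<open>err_fine\<close> applies
  off \<open>bad\<close>, and on \<open>bad\<close> the terms with the indicator take over through
  \<open>err_crude\<close>.\<close>

lemma risk_fine:
  assumes "\<upsilon> m \<le> 1" and large: "4 * D / \<upsilon> m \<le> n"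
  shows "(\<integral>\<^sup>+s. ennreal ((err s)\<^sup>2) \<partial>S)
    \<le> ennreal (3 * (K2 * (D * Sh) / n) + 18 * D\<^sup>2 * (K4 + 24 * \<eta> ^ 4) * Sh * real m ^ 3 / (\<upsilon> m * (real n)\<^sup>2)
        + 6 * \<rho> * (1 + D * d) * Rn + (3 * K4 + 1) * Hm * m * sqrt pbad + HH * \<rho> * pbad)"
proof (rule nn_integral_le_expectation)
  have \<upsilon>m: "0 < \<upsilon> m" using \<upsilon> m by simp
  have pb: "0 < pbad" unfolding pbad_def using m by simp
  \<comment> \<open>In expectation, \<open>L * (m * SV)\<close> is at most
    \<open>3 * K4 * L * m\<^sup>2 / n\<^sup>2\<close> and the indicator term at most
    \<open>pbad / L\<close>. This \<open>L\<close> makes both of order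
    \<open>m * sqrt pbad / n\<close>.\<close>
  define L where "L = n * sqrt pbad / m"
  have L: "0 < L" using n m pb by (simp add: L_def)
  \<comment> \<open>Half the coefficient in \<open>err_fine\<close>, because AM-GM is applied to
    twice the product.\<close>
  define C where "C = 6 * (D / \<upsilon> m) * (D * Sh)"
  have C: "0 \<le> C" using D0 \<upsilon>m Sh_nonneg by (simp add: C_def)
  define I where "I s = (indicator bad s :: real)" for s
  let ?F = "\<lambda>s. 3 * (bV s)\<^sup>2 + C * (m * (m * SV s) + m * SX s) + 6 * \<rho> * (1 + D * d) * Rn
     + n * Hm * (L * (m * SV s) + I s / L) + HH * \<rho> * I s"
  have Rn: "0 \<le> Rn" using Rh_nonneg by (auto simp: Rn_def max.coboundedI2)
  have I: "I s = 0 \<or> I s = 1" for s by (simp add: I_def indicator_def)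
  have nn: "0 \<le> C * (m * (m * SV s) + m * SX s)" "0 \<le> n * Hm * (L * (m * SV s) + I s / L)" "0 \<le> HH * \<rho> * I s"
     "0 \<le> 6 * \<rho> * (1 + D * d) * Rn" for s
    using C S_nonneg Hm_nonneg HH_nonneg L Rn \<rho> D0 dD I[of s] by auto
  show "0 \<le> ?F s" for s using nn by (intro add_nonneg_nonneg) auto
  show "(err s)\<^sup>2 \<le> ?F s" if s: "s \<in> space S" for s
  proof (cases "s \<in> bad")
    case False
    then have "NX s \<le> \<upsilon> m / (4 * D)" using s by (auto simp: bad_def)
    from err_fine[OF this large]
    have "(err s)\<^sup>2 \<le> 3 * (bV s)\<^sup>2 + C * (2 * (NX s * NV s)) + 3 * bias\<^sup>2" by (simp add: C_def)
    \<comment> \<open>The weight \<open>m\<close> equalises the two sides: both resulting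
      expectations are of order \<open>m\<^sup>3 / n\<^sup>2\<close>.\<close>
    also have "2 * (NX s * NV s) \<le> m * (NV s)\<^sup>2 + (NX s)\<^sup>2 / m"
      using weighted_am_gm[of "real m" "NV s" "NX s"] m by (simp add: mult.commute)
    also have "\<dots> \<le> m * (m * SV s) + m * SX s"
    proof (intro add_mono mult_left_mono NV_sq)
      show "(NX s)\<^sup>2 / m \<le> m * SX s"
        using NX_sq[of s] m by (simp add: field_simps power2_eq_square)
    qed simp
    also have "3 * bias\<^sup>2 \<le> 6 * \<rho> * (1 + D * d) * Rn" using bias_le by (simp add: Rn_def)
    finally show ?thesis using nn(2,3)[of s] C by (simp add: mult_left_mono)
  next
    case True
    then have I1: "I s = 1" by (simp add: I_def)
    have "2 * (NV s * 1) \<le> L * (NV s)\<^sup>2 + 1\<^sup>2 / L" by (rule weighted_am_gm[OF L])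
    also have "\<dots> \<le> L * (m * SV s) + I s / L" using NV_sq[of s] L I1 by simp
    finally have "n * Hm * (2 * NV s) \<le> n * Hm * (L * (m * SV s) + I s / L)"
      using Hm_nonneg by (intro mult_left_mono) auto
    moreover have "2 * bias\<^sup>2 \<le> 6 * \<rho> * (1 + D * d) * Rn"
      using bias_le zero_le_power2[of bias] unfolding Rn_def[symmetric] by linarith
    moreover have "2 * n * Hm * NV s = n * Hm * (2 * NV s)" "HH * \<rho> * I s = HH * \<rho>" using I1 by simp_all
    ultimately show ?thesis
      using err_crude[of s] lin_functional_le nn(1)[of s] zero_le_power2[of "bV s"]
      unfolding Hm_def[symmetric] HH_def[symmetric] by linarith
  qed
  have iI: "integrable S I" unfolding I_def[abs_def] by (simp add: S.emeasure_eq_measure)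
  have eI: "S.expectation I \<le> pbad"
    unfolding I_def[abs_def] using bad_prob[OF assms(1)] sets.sets_into_space[OF bad_sets] by (simp add: Int_absorb2)
  note ints = SV_expectation(1) SX_expectation(1) bV_expectation(1) iI
  show "integrable S ?F" using ints by simp
  have "S.expectation ?F = 3 * S.expectation (\<lambda>s. (bV s)\<^sup>2) + C * (m * (m * S.expectation SV) + m * S.expectation SX)
     + 6 * \<rho> * (1 + D * d) * Rn + n * Hm * (L * (m * S.expectation SV) + S.expectation I / L) + HH * \<rho> * S.expectation I"
    using ints by (simp add: S.prob_space)
  also have "\<dots> \<le> 3 * (K2 * (D * Sh) / n)
     + C * (m * (m * (m * (3 * K4 / (real n)\<^sup>2))) + m * (m\<^sup>2 * (72 * \<eta> ^ 4 / (real n)\<^sup>2)))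
     + 6 * \<rho> * (1 + D * d) * Rn + n * Hm * (L * (m * (m * (3 * K4 / (real n)\<^sup>2))) + pbad / L) + HH * \<rho> * pbad"
    using C Hm_nonneg L HH_nonneg \<rho> SV_expectation(2) SX_expectation(2) bV_expectation(2) eI
    by (intro add_mono mult_left_mono divide_right_mono order_refl mult_nonneg_nonneg) auto
  also have "C * (m * (m * (m * (3 * K4 / (real n)\<^sup>2))) + m * (m\<^sup>2 * (72 * \<eta> ^ 4 / (real n)\<^sup>2)))
      = 18 * D\<^sup>2 * (K4 + 24 * \<eta> ^ 4) * Sh * real m ^ 3 / (\<upsilon> m * (real n)\<^sup>2)"
    using \<upsilon>m n by (simp add: C_def field_simps power2_eq_square power3_eq_cube)
  also have "n * Hm * (L * (m * (m * (3 * K4 / (real n)\<^sup>2))) + pbad / L) = (3 * K4 + 1) * Hm * m * sqrt pbad"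
  proof -
    have "r * r / (real n * r / real m) = m * r / n" if "0 < r" for r :: real
      using that m n by (simp add: field_simps)
    from this[of "sqrt pbad"] have "pbad / L = m * sqrt pbad / n" using pb by (simp add: L_def)
    then show ?thesis using n m by (simp add: L_def field_simps power2_eq_square)
  qed
  finally show "S.expectation ?F \<le> 3 * (K2 * (D * Sh) / n)
     + 18 * D\<^sup>2 * (K4 + 24 * \<eta> ^ 4) * Sh * real m ^ 3 / (\<upsilon> m * (real n)\<^sup>2)
     + 6 * \<rho> * (1 + D * d) * Rn + (3 * K4 + 1) * Hm * m * sqrt pbad + HH * \<rho> * pbad" .
qed

text \<open>The unweighted sum of squares may grow with \<open>m\<close>, but no faster than
  \<open>\<gamma> m\<close>, a factor later absorbed by the exponential.\<close>

lemma Hm_le: "Hm \<le> HH * \<gamma> m"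
proof -
  have "Hm \<le> (\<Sum>j=1..m. (h j)\<^sup>2 / \<gamma> j * \<gamma> m)"
    unfolding Hm_def
  proof (rule sum_mono)
    fix j assume j: "j \<in> {1..m}"
    then have "(h j)\<^sup>2 * \<gamma> j \<le> (h j)\<^sup>2 * \<gamma> m" using \<gamma>_mono[of j m] by (intro mult_left_mono) auto
    then show "(h j)\<^sup>2 \<le> (h j)\<^sup>2 / \<gamma> j * \<gamma> m" using j \<gamma>[of j] by (simp add: field_simps)
  qed
  also have "\<dots> = (\<Sum>\<^sub>\<infinity>j\<in>{1..m}. (h j)\<^sup>2 / \<gamma> j) * \<gamma> m" by (simp add: sum_distrib_right)
  also have "\<dots> \<le> HH * \<gamma> m"
    unfolding HH_def using \<gamma>_nonneg m
    by (intro mult_right_mono infsum_mono_neutral summable_on_subset_banach[OF h_summable] h_summable) auto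
  finally show ?thesis .
qed

text \<open>For the degenerate case: if the rate is 0, then \<open>Sh\<close> and \<open>Rh\<close>
  vanish, hence also \<open>HH\<close> and \<open>Hm\<close>, and the crude bound is 0 as
  well.\<close>

lemma HH_le:
  assumes "\<gamma> 1 = 1" "\<upsilon> 1 = 1"
  shows "HH \<le> Sh + Rh" and "Hm \<le> Sh"
proof -
  have "HH = (\<Sum>\<^sub>\<infinity>j\<in>{1..m} \<union> {m<..}. (h j)\<^sup>2 / \<gamma> j)"
    unfolding HH_def using m by (intro infsum_cong_neutral) auto
  also have "\<dots> = (\<Sum>j=1..m. (h j)\<^sup>2 / \<gamma> j) + Rh"
    unfolding Rh_def using m by (subst infsum_Un_disjoint) (auto intro!: summable_on_subset_banach[OF h_summable])
  also have "(\<Sum>j=1..m. (h j)\<^sup>2 / \<gamma> j) \<le> Sh"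
    unfolding Sh_def
  proof (rule sum_mono)
    fix j assume j: "j \<in> {1..m}"
    then have "\<upsilon> j \<le> \<gamma> j" using assms \<gamma>_mono[of 1 j] \<upsilon>_anti[of 1 j] by auto
    then show "(h j)\<^sup>2 / \<gamma> j \<le> (h j)\<^sup>2 / \<upsilon> j" using j \<upsilon>[of j] by (intro divide_left_mono) auto
  qed
  finally show "HH \<le> Sh + Rh" by simp
  show "Hm \<le> Sh"
    unfolding Hm_def Sh_def
  proof (rule sum_mono)
    fix j assume j: "j \<in> {1..m}"
    then have "(h j)\<^sup>2 * \<upsilon> j \<le> (h j)\<^sup>2 * 1" using assms \<upsilon>_anti[of 1 j] by (intro mult_left_mono) auto
    then show "(h j)\<^sup>2 \<le> (h j)\<^sup>2 / \<upsilon> j" using j \<upsilon>[of j] by (simp add: field_simps)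
  qed
qed

end

section \<open>Weights and rates\<close>

text \<open>\<open>y ^ 5 / fact 5\<close> is a single term of the exponential series.\<close>

lemma power5_exp_le: "y ^ 5 * exp (- y) \<le> 120" if "0 \<le> y" for y :: real
proof -
  have "(\<lambda>k. y ^ k / fact k) sums exp y"
    using exp_converges[of y] by (simp add: divide_inverse mult.commute)
  then have "sum (\<lambda>k. y ^ k / fact k) {5} \<le> exp y"
    using that sum_le_suminf[of "\<lambda>k. y ^ k / fact k" "{5}"] by (auto simp: sums_iff)
  then have "y ^ 5 \<le> 120 * exp y" by (simp add: fact_numeral)
  then show ?thesis by (simp add: exp_minus field_simps)
qed

text \<open>Put \<open>x = g / m\<^sup>2\<close>. The cubic bound gives
  \<open>m \<le> c * x\<close>, so the polynomial factor \<open>g * m\<^sup>2 = x * m ^ 4\<close> is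
  at most \<open>c ^ 4 * x ^ 5\<close>. The exponential is split into two equal factors: one absorbs
  the fifth power, the other is at most \<open>R\<close> because the logarithmic hypothesis gives
  \<open>- (b * x) \<le> ln R\<close>.\<close>

lemma exp_decay_le_rate:
  fixes m g c b R :: real
  assumes m: "1 \<le> m" and g: "0 < g" and c: "1 \<le> c" and b: "0 < b" and R: "0 < R"
    and mg: "m ^ 3 \<le> c * g" and ln: "m\<^sup>2 * \<bar>ln R\<bar> \<le> b * g"
  shows "g * m\<^sup>2 * exp (- (2 * b * (g / m\<^sup>2))) \<le> 120 * c ^ 4 / b ^ 5 * R"
proof -
  define x where "x = g / m\<^sup>2"
  have x: "0 < x" using g m by (simp add: x_def)
  have gx: "g = x * m\<^sup>2" using m by (simp add: x_def)
  have "m * m\<^sup>2 \<le> (c * x) * m\<^sup>2" using mg by (simp add: gx power3_eq_cube power2_eq_square)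
  then have mx: "m \<le> c * x" using m by (simp add: mult_le_cancel_right)
  have "g * m\<^sup>2 = x * m ^ 4" by (simp add: gx eval_nat_numeral)
  also have "\<dots> \<le> x * (c * x) ^ 4" using mx m x by (intro mult_left_mono power_mono) auto
  also have "\<dots> = c ^ 4 * x ^ 5" by (simp add: power_mult_distrib eval_nat_numeral)
  finally have poly: "g * m\<^sup>2 \<le> c ^ 4 * x ^ 5" .
  have "(b * x) ^ 5 * exp (- (b * x)) \<le> 120" using b x by (intro power5_exp_le) auto
  then have "x ^ 5 * exp (- (b * x)) \<le> 120 / b ^ 5"
    using b by (simp add: power_mult_distrib field_simps)
  then have p2: "c ^ 4 * (x ^ 5 * exp (- (b * x))) \<le> c ^ 4 * (120 / b ^ 5)"
    using c by (intro mult_left_mono) auto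
  have "\<bar>ln R\<bar> * m\<^sup>2 \<le> (b * x) * m\<^sup>2" using ln by (simp add: gx mult_ac)
  then have "\<bar>ln R\<bar> \<le> b * x" using m by (simp add: mult_le_cancel_right)
  then have "- (b * x) \<le> ln R" by simp
  then have "exp (- (b * x)) \<le> R" using R by (metis exp_le_cancel_iff exp_ln)
  have "g * m\<^sup>2 * exp (- (2 * b * x)) = g * m\<^sup>2 * (exp (- (b * x)) * exp (- (b * x)))"
    by (simp add: exp_add[symmetric])
  also have "\<dots> \<le> c ^ 4 * x ^ 5 * (exp (- (b * x)) * exp (- (b * x)))"
    using poly by (intro mult_right_mono) auto
  also have "\<dots> = c ^ 4 * (x ^ 5 * exp (- (b * x))) * exp (- (b * x))" by simp
  also have "\<dots> \<le> c ^ 4 * (120 / b ^ 5) * R"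
    by (rule mult_mono[OF p2 \<open>exp (- (b * x)) \<le> R\<close>]) (use c b in auto)
  finally show ?thesis by (simp add: x_def mult_ac)
qed

section \<open>Weights and the dimension parameter\<close>

context
  fixes \<gamma> \<upsilon> :: "nat \<Rightarrow> real"
  assumes ass1: "assumption1 \<gamma> \<upsilon>"
begin

lemma weights_pos: "1 \<le> j \<Longrightarrow> 0 < \<gamma> j" "1 \<le> j \<Longrightarrow> 0 < \<upsilon> j"
  and weights_1: "\<gamma> 1 = 1" "\<upsilon> 1 = 1"
  and weights_mono: "1 \<le> i \<Longrightarrow> i \<le> j \<Longrightarrow> \<gamma> i \<le> \<gamma> j" "1 \<le> i \<Longrightarrow> i \<le> j \<Longrightarrow> \<upsilon> j \<le> \<upsilon> i"
  using ass1 by (auto simp: assumption1_def monotone_on_def)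

lemma weights_cubic: "\<exists>c\<ge>1. \<forall>j\<ge>1. real j ^ 3 \<le> c * \<gamma> j"
proof -
  have "(\<lambda>j. real j ^ 3 / \<gamma> j) \<longlonglongrightarrow> 0" using ass1 by (simp add: assumption1_def)
  then have "Bseq (\<lambda>j. real j ^ 3 / \<gamma> j)" using convergentI convergent_imp_Bseq by blast
  then obtain K where K: "0 < K" "\<And>j. norm (real j ^ 3 / \<gamma> j) \<le> K" by (auto elim: BseqE)
  have "real j ^ 3 \<le> max 1 K * \<gamma> j" if "1 \<le> j" for j
  proof -
    have "real j ^ 3 / \<gamma> j \<le> K" using K(2)[of j] abs_ge_self[of "real j ^ 3 / \<gamma> j"] by (simp only: real_norm_def)
    then have "real j ^ 3 / \<gamma> j \<le> max 1 K" by simp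
    then show ?thesis using weights_pos(1)[OF that] by (simp add: divide_le_eq)
  qed
  then show ?thesis by (intro exI[of _ "max 1 K"]) auto
qed

lemma weights_summable: "\<exists>G\<ge>0. \<forall>k. (\<Sum>j=1..k. 1 / \<gamma> j) \<le> G"
proof -
  obtain c where c: "1 \<le> c" "\<And>j. 1 \<le> j \<Longrightarrow> real j ^ 3 \<le> c * \<gamma> j" using weights_cubic by auto
  \<comment> \<open>The cubic lower bound on \<open>\<gamma>\<close> implies a quadratic one; the
    series has the value 0 at index 0 since \<open>inverse 0 = 0\<close>.\<close>
  have s: "summable (\<lambda>j. c * inverse (real j ^ 2))"
    by (intro summable_mult inverse_power_summable) simp
  have "(\<Sum>j=1..k. 1 / \<gamma> j) \<le> (\<Sum>j. c * inverse (real j ^ 2))" for k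
  proof -
    have "(\<Sum>j=1..k. 1 / \<gamma> j) \<le> (\<Sum>j=1..k. c * inverse (real j ^ 2))"
    proof (rule sum_mono)
      fix j assume "j \<in> {1..k}"
      then have j: "1 \<le> j" by simp
      have "real j ^ 2 \<le> real j ^ 3" using j by (intro power_increasing) auto
      also have "\<dots> \<le> c * \<gamma> j" using c j by simp
      finally show "1 / \<gamma> j \<le> c * inverse (real j ^ 2)"
        using weights_pos(1)[OF j] j by (simp add: field_simps)
    qed
    also have "\<dots> \<le> (\<Sum>j. c * inverse (real j ^ 2))"
      using c by (intro sum_le_suminf s) auto
    finally show ?thesis .
  qed
  moreover have "0 \<le> (\<Sum>j. c * inverse (real j ^ 2))" using c by (intro suminf_nonneg s) auto
  ultimately show ?thesis by blast
qed

lemma weights_large: "\<exists>N\<ge>1. \<forall>j\<ge>N. K \<le> \<gamma> j"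
proof -
  obtain c where c: "1 \<le> c" "\<And>j. 1 \<le> j \<Longrightarrow> real j ^ 3 \<le> c * \<gamma> j" using weights_cubic by auto
  obtain N :: nat where N: "c * K \<le> N" using real_arch_simple by blast
  have "K \<le> \<gamma> j" if "max 1 N \<le> j" for j
  proof -
    have "c * K \<le> real j" using N that by simp
    also have "\<dots> \<le> real j ^ 3" using that power_increasing[of 1 3 "real j"] by simp
    also have "\<dots> \<le> c * \<gamma> j" using c that by simp
    finally show ?thesis using c by (simp add: mult_le_cancel_left)
  qed
  then show ?thesis by (intro exI[of _ "max 1 N"]) auto
qed

text \<open>The \<open>LEAST\<close> in \<open>m_star\<close> is meaningful only if a minimiser
  exists. The objective at \<open>j\<close> is at least \<open>\<gamma> j / x\<close>, which tends
  to infinity, so the search reduces to a finite range.\<close>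

lemma m_star_ge_1:
  assumes x: "0 < x"
  shows "1 \<le> m_star \<gamma> \<upsilon> x"
proof -
  define F where "F m = max (\<upsilon> m / \<gamma> m) (1 / x) / min (\<upsilon> m / \<gamma> m) (1 / x)" for m
  obtain N where N: "1 \<le> N" "\<And>j. N \<le> j \<Longrightarrow> x * (F 1 + 1) \<le> \<gamma> j" using weights_large by metis
  have big: "F 1 < F j" if "N \<le> j" for j
  proof -
    have j: "1 \<le> j" using that N by simp
    note pos = weights_pos[OF j]
    have "F 1 + 1 \<le> \<gamma> j / x" using N(2)[OF that] x by (simp add: field_simps)
    also have "\<dots> \<le> (1 / x) / (\<upsilon> j / \<gamma> j)"
      using pos x weights_mono(2)[of 1 j] j weights_1 by (simp add: field_simps)
    also have "\<dots> \<le> F j"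
      unfolding F_def using pos x by (intro frac_le) (auto simp: le_max_iff_disj)
    finally show ?thesis by simp
  qed
  define m0 where "m0 = arg_min_on F {1..N}"
  have fin: "finite {1..N}" "{1..N} \<noteq> {}" using N by auto
  have m0: "m0 \<in> {1..N}" "\<And>j. j \<in> {1..N} \<Longrightarrow> F m0 \<le> F j"
    using arg_min_if_finite(1)[OF fin, of F] arg_min_least[OF fin, of _ F] by (auto simp: m0_def)
  have "F m0 \<le> F j" if "1 \<le> j" for j
    using m0(2)[of j] m0(2)[of 1] big[of j] that N by (cases "j \<le> N") auto
  then have "is_arg_min F (\<lambda>m. 1 \<le> m) m0" using m0(1) by (auto simp: is_arg_min_def not_less)
  then have "is_arg_min F (\<lambda>m. 1 \<le> m) (m_star \<gamma> \<upsilon> x)"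
    unfolding m_star_def F_def by (rule LeastI)
  then show ?thesis by (simp add: is_arg_min_def)
qed

context
  assumes ass2: "assumption2 \<gamma> \<upsilon>"
begin

lemma kappa_pos: "0 < kappa \<gamma> \<upsilon>"
  using ass2 by (simp add: assumption2_def)

text \<open>\<open>alpha_star\<close> dominates both \<open>\<upsilon> m / \<gamma> m\<close> and
  \<open>1 / n\<close>, while \<open>kappa\<close> times it lies below both. The first consequence
  forces \<open>m_star\<close> to grow; the second controls the cut-off and the tail
  exponent.\<close>

lemma kappa_bounds:
  fixes n :: nat
  assumes n: "1 \<le> n"
  defines "m \<equiv> m_star \<gamma> \<upsilon> (real n)"
  shows "kappa \<gamma> \<upsilon> * (\<upsilon> m / \<gamma> m) \<le> 1 / n" and "kappa \<gamma> \<upsilon> * \<gamma> m \<le> n * \<upsilon> m"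
proof -
  let ?q = "\<lambda>n::nat. min (\<upsilon> (m_star \<gamma> \<upsilon> n) / \<gamma> (m_star \<gamma> \<upsilon> n)) (1 / real n) / alpha_star \<gamma> \<upsilon> n"
  have pos: "0 < \<upsilon> (m_star \<gamma> \<upsilon> (real k)) / \<gamma> (m_star \<gamma> \<upsilon> (real k))" if "1 \<le> k" for k :: nat
    using that weights_pos[OF m_star_ge_1[of "real k"]] by simp
  \<comment> \<open>A common lower bound of the family, needed to compare the infimum with one
    member.\<close>
  have "0 \<le> ?q k" if "k \<in> {1..}" for k :: nat
    using that pos[of k] by (auto simp: alpha_star_def intro!: divide_nonneg_nonneg)
  then have "kappa \<gamma> \<upsilon> \<le> ?q n"
    unfolding kappa_def using n by (intro cINF_lower bdd_belowI2[where m = 0]) auto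
  moreover have \<alpha>: "0 < alpha_star \<gamma> \<upsilon> n" using pos[OF n] by (auto simp: alpha_star_def)
  ultimately have k: "kappa \<gamma> \<upsilon> * alpha_star \<gamma> \<upsilon> n \<le> min (\<upsilon> m / \<gamma> m) (1 / real n)"
    by (simp add: pos_le_divide_eq m_def)
  have "kappa \<gamma> \<upsilon> * (\<upsilon> m / \<gamma> m) \<le> kappa \<gamma> \<upsilon> * alpha_star \<gamma> \<upsilon> n"
    using kappa_pos by (intro mult_left_mono) (auto simp: alpha_star_def m_def)
  then show "kappa \<gamma> \<upsilon> * (\<upsilon> m / \<gamma> m) \<le> 1 / n" using k by simp
  have "kappa \<gamma> \<upsilon> * (1 / n) \<le> kappa \<gamma> \<upsilon> * alpha_star \<gamma> \<upsilon> n"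
    using kappa_pos by (intro mult_left_mono) (auto simp: alpha_star_def)
  then have "kappa \<gamma> \<upsilon> * (1 / n) \<le> \<upsilon> m / \<gamma> m" using k by simp
  moreover have "0 < \<gamma> m" unfolding m_def using n by (intro weights_pos m_star_ge_1) simp
  ultimately show "kappa \<gamma> \<upsilon> * \<gamma> m \<le> n * \<upsilon> m" using n by (simp add: field_simps)
qed

text \<open>If \<open>m_star\<close> stayed below \<open>N\<close>, the ratio at \<open>N\<close>
  would be at most the ratio at \<open>m_star\<close>, hence at most \<open>1 / (kappa * n)\<close>,
  which fails for large \<open>n\<close>.\<close>

lemma eventually_weights_large:
  "eventually (\<lambda>n::nat. K \<le> \<gamma> (m_star \<gamma> \<upsilon> (real n))) sequentially"
proof -
  obtain N where N: "1 \<le> N" "\<And>j. N \<le> j \<Longrightarrow> K \<le> \<gamma> j" using weights_large by metis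
  define q where "q = kappa \<gamma> \<upsilon> * (\<upsilon> N / \<gamma> N)"
  have q: "0 < q" using kappa_pos weights_pos[OF N(1)] by (simp add: q_def)
  obtain n0 :: nat where n0: "1 / q < n0" using reals_Archimedean2 by blast
  show ?thesis
    unfolding eventually_sequentially
  proof (intro exI allI impI)
    fix n assume n: "max 1 n0 \<le> n"
    let ?m = "m_star \<gamma> \<upsilon> (real n)"
    have m: "1 \<le> ?m" using n by (intro m_star_ge_1) simp
    have "N \<le> ?m"
    proof (rule ccontr)
      assume "\<not> N \<le> ?m"
      then have "?m \<le> N" by simp
      then have "\<upsilon> N / \<gamma> N \<le> \<upsilon> ?m / \<gamma> ?m"
        using weights_mono[OF m, of N] weights_pos[OF m] weights_pos[OF N(1)] by (intro frac_le) auto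
      then have "q \<le> kappa \<gamma> \<upsilon> * (\<upsilon> ?m / \<gamma> ?m)" unfolding q_def using kappa_pos by (intro mult_left_mono) auto
      also have "\<dots> \<le> 1 / n" using n by (intro kappa_bounds) simp
      finally have "n \<le> 1 / q" using q n by (simp add: field_simps)
      then show False using n0 n by (auto simp: max_def split: if_splits)
    qed
    then show "K \<le> \<gamma> ?m" by (rule N(2))
  qed
qed

end

end

section \<open>Comparison of the risk with the rate\<close>

context npiv
begin

text \<open>\<open>R\<close> stands for the rate and \<open>k\<close> for the balancing constant.
  Each of the five terms of \<open>risk_fine\<close> is bounded by a constant multiple of
  \<open>R\<close>, the last two through the decay of \<open>pbad\<close>.\<close>

lemma risk_rate:
  fixes k c R :: real
  assumes k: "0 < k" and c: "1 \<le> c" and one: "\<gamma> 1 = 1" "\<upsilon> 1 = 1"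
    and balance: "k * \<gamma> m \<le> n * \<upsilon> m" and cubic: "real m ^ 3 \<le> c * \<gamma> m" and large: "4 * D \<le> k * \<gamma> m"
    and R: "0 < R" "Rn \<le> R" "Sh / n \<le> R"
    and ln: "(real m)\<^sup>2 * \<bar>ln R\<bar> \<le> k / (128 * D * \<eta>\<^sup>2) * \<gamma> m"
  defines "E \<equiv> 120 * c ^ 4 / (k / (128 * D * \<eta>\<^sup>2)) ^ 5"
  shows "(\<integral>\<^sup>+s. ennreal ((err s)\<^sup>2) \<partial>S)
    \<le> ennreal ((3 * K2 * D + 18 * D\<^sup>2 * (K4 + 24 * \<eta> ^ 4) * (c / k) + 6 * \<rho> * (1 + D * d)
         + 2 * (3 * K4 + 1) * HH * E + 2 * HH * \<rho> * E) * R)"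
proof -
  have \<upsilon>m: "0 < \<upsilon> m" "\<upsilon> m \<le> 1" and \<gamma>m: "1 \<le> \<gamma> m"
    using \<upsilon>[OF m] \<upsilon>_anti[of 1 m] \<gamma>_mono[of 1 m] m one by auto
  have n0: "0 < real n" and m1: "1 \<le> real m" using n m by auto
  \<comment> \<open>By the balance the exponent of \<open>pbad\<close> is at least
    \<open>k * \<gamma> m / (32 * D * \<eta>\<^sup>2 * m\<^sup>2)\<close>, that is
    \<open>4 * b\<close> times \<open>\<gamma> m / m\<^sup>2\<close>. The square root leaves
    \<open>2 * b\<close>, as \<open>exp_decay_le_rate\<close> expects; \<open>X\<close> is this
    square root of the exponential factor.\<close>
  define b where "b = k / (128 * D * \<eta>\<^sup>2)"
  have b: "0 < b" using k D0 \<eta> by (simp add: b_def)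
  define X where "X = exp (- (2 * b * (\<gamma> m / (real m)\<^sup>2)))"
  have "0 \<le> 2 * b * (\<gamma> m / (real m)\<^sup>2)" using b \<gamma>m by simp
  moreover have "0 < \<gamma> m" using \<gamma>m by simp
  ultimately have X: "0 \<le> X" "X \<le> 1" "\<gamma> m * (real m)\<^sup>2 * X \<le> E * R"
    using exp_decay_le_rate[OF m1 _ c b R(1) cubic ln[folded b_def]]
    unfolding X_def E_def b_def[symmetric] by auto
  have "pbad \<le> 2 * (real m)\<^sup>2 * (X * X)"
  proof -
    have "4 * b * (\<gamma> m / (real m)\<^sup>2) = (k * \<gamma> m) / (32 * D * \<eta>\<^sup>2 * (real m)\<^sup>2)" by (simp add: b_def)
    also have "\<dots> \<le> n * \<upsilon> m / (32 * D * \<eta>\<^sup>2 * (real m)\<^sup>2)"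
      using balance D0 by (intro divide_right_mono) auto
    finally have "exp (- (n * \<upsilon> m / (32 * D * \<eta>\<^sup>2 * (real m)\<^sup>2))) \<le> exp (- (4 * b * (\<gamma> m / (real m)\<^sup>2)))" by simp
    also have "\<dots> = X * X" by (simp add: X_def exp_add[symmetric])
    finally show ?thesis unfolding pbad_def by (intro mult_left_mono) auto
  qed
  have "2 * (real m)\<^sup>2 * (X * X) \<le> (2 * real m * X)\<^sup>2"
    using X(1) by (simp add: power2_eq_square)
  with \<open>pbad \<le> _\<close> have sq: "sqrt pbad \<le> 2 * real m * X"
    using X by (intro real_le_lsqrt) auto
  have "Hm * m * sqrt pbad \<le> (HH * \<gamma> m) * m * (2 * real m * X)"
    using Hm_le sq HH_nonneg \<gamma>m Hm_nonneg pbad_def by (intro mult_mono) auto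
  also have "\<dots> = 2 * HH * (\<gamma> m * (real m)\<^sup>2 * X)" by (simp add: power2_eq_square)
  also have "\<dots> \<le> 2 * HH * (E * R)" using X HH_nonneg by (intro mult_left_mono) auto
  finally have t4: "(3 * K4 + 1) * Hm * m * sqrt pbad \<le> 2 * (3 * K4 + 1) * HH * E * R"
    using mult_left_mono[of "Hm * m * sqrt pbad" "2 * HH * (E * R)" "3 * K4 + 1"] K_nonneg
    by (simp only: mult_ac)
  have "pbad \<le> 2 * (\<gamma> m * (real m)\<^sup>2 * X)"
  proof -
    have "(real m)\<^sup>2 * (X * X) \<le> (\<gamma> m * (real m)\<^sup>2) * (X * 1)"
      using X \<gamma>m mult_right_mono[of 1 "\<gamma> m" "(real m)\<^sup>2"] by (intro mult_mono) auto
    then show ?thesis using \<open>pbad \<le> _\<close> by simp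
  qed
  then have "pbad \<le> 2 * (E * R)" using X(3) by simp
  then have t5: "HH * \<rho> * pbad \<le> 2 * HH * \<rho> * E * R"
    using mult_left_mono[of pbad "2 * (E * R)" "HH * \<rho>"] HH_nonneg \<rho> by (simp add: mult_ac)
  have t1: "3 * (K2 * (D * Sh) / n) \<le> 3 * K2 * D * R"
    using mult_left_mono[OF R(3), of "3 * K2 * D"] K_nonneg D0 by (simp add: mult_ac)
  have t2: "18 * D\<^sup>2 * (K4 + 24 * \<eta> ^ 4) * Sh * real m ^ 3 / (\<upsilon> m * (real n)\<^sup>2)
      \<le> 18 * D\<^sup>2 * (K4 + 24 * \<eta> ^ 4) * (c / k) * R"
  proof -
    have "real m ^ 3 / (n * \<upsilon> m) \<le> (c * \<gamma> m) / (k * \<gamma> m)"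
      using cubic balance k \<gamma>m c by (intro frac_le) auto
    also have "\<dots> = c / k" using \<gamma>m by simp
    finally have "Sh / n * (real m ^ 3 / (n * \<upsilon> m)) \<le> R * (c / k)"
      using R Sh_nonneg \<upsilon>m n0 by (intro mult_mono) auto
    then have "18 * D\<^sup>2 * (K4 + 24 * \<eta> ^ 4) * (Sh / n * (real m ^ 3 / (n * \<upsilon> m))) \<le> 18 * D\<^sup>2 * (K4 + 24 * \<eta> ^ 4) * (R * (c / k))"
      using K_nonneg \<eta> by (intro mult_left_mono) auto
    then show ?thesis by (simp add: power2_eq_square mult_ac)
  qed
  have t3: "6 * \<rho> * (1 + D * d) * Rn \<le> 6 * \<rho> * (1 + D * d) * R"
    using R \<rho> D0 dD by (intro mult_left_mono) auto
  \<comment> \<open>Chaining \<open>4 * D \<le> k * \<gamma> m \<le> n * \<upsilon> m\<close> keeps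
    the cut-off inactive on the good event.\<close>
  have "4 * D / \<upsilon> m \<le> n" using large balance \<upsilon>m by (simp add: field_simps)
  from risk_fine[OF \<upsilon>m(2) this] show ?thesis
    by (rule order_trans[OF _ ennreal_leI]) (unfold distrib_right[where c = R], use t1 t2 t3 t4 t5 in linarith)
qed

lemma rate_bounds:
  assumes "m = m_star \<gamma> \<upsilon> (real n)"
  shows "Rn \<le> rate \<gamma> \<upsilon> h n" and "Sh / n \<le> rate \<gamma> \<upsilon> h n" and "0 \<le> rate \<gamma> \<upsilon> h n"
    and "rate \<gamma> \<upsilon> h n = 0 \<Longrightarrow> Sh = 0 \<and> Rh = 0"
proof -
  have rate: "rate \<gamma> \<upsilon> h n = max (alpha_star \<gamma> \<upsilon> n * Sh) Rh"
    unfolding rate_def Sh_def Rh_def assms[symmetric] ..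
  have \<alpha>: "\<upsilon> m / \<gamma> m \<le> alpha_star \<gamma> \<upsilon> n" "1 / n \<le> alpha_star \<gamma> \<upsilon> n"
    unfolding alpha_star_def assms[symmetric] by auto
  have "\<upsilon> m / \<gamma> m * Sh \<le> alpha_star \<gamma> \<upsilon> n * Sh" using \<alpha> Sh_nonneg by (intro mult_right_mono)
  then show "Rn \<le> rate \<gamma> \<upsilon> h n" unfolding Rn_def rate by (intro max.mono) auto
  have "1 / n * Sh \<le> alpha_star \<gamma> \<upsilon> n * Sh" using \<alpha> Sh_nonneg by (intro mult_right_mono)
  then show "Sh / n \<le> rate \<gamma> \<upsilon> h n" unfolding rate by simp
  show "0 \<le> rate \<gamma> \<upsilon> h n" unfolding rate using Rh_nonneg by (simp add: le_max_iff_disj)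
  assume "rate \<gamma> \<upsilon> h n = 0"
  then have "Sh / n \<le> 0" "Rh \<le> 0"
    using \<open>Sh / n \<le> rate \<gamma> \<upsilon> h n\<close> unfolding rate by auto
  then show "Sh = 0 \<and> Rh = 0" using Sh_nonneg Rh_nonneg n by (simp add: divide_le_0_iff)
qed

end

theorem theorem3p3:
  fixes \<gamma> \<upsilon> h :: "nat \<Rightarrow> real" and \<rho> d D \<sigma> \<eta> :: real
  assumes "assumption1 \<gamma> \<upsilon>" and "assumption2 \<gamma> \<upsilon>"
    and "\<rho> > 0" and "d \<ge> 1" and "D \<ge> d" and "\<sigma> > 0" and "\<eta> \<ge> 1"
    and "h \<in> weighted_space (\<lambda>j. 1 / \<gamma> j)"
    and "(\<lambda>n. real (m_star \<gamma> \<upsilon> (real n)) ^ 3 *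
              max \<bar>ln (rate \<gamma> \<upsilon> h (real n))\<bar> (ln (real (m_star \<gamma> \<upsilon> (real n)))))
         \<in> o(\<lambda>n::nat. \<gamma> (m_star \<gamma> \<upsilon> (real n)))"
  shows "\<exists>C>0. \<forall>(MZ :: 'z measure) (MW :: 'w measure) e f.
           prob_space MZ \<and> prob_space MW \<and> orthonormal_basis MZ e \<and> orthonormal_basis MW f \<longrightarrow>
           (\<forall>n\<ge>1.
              (SUP T \<in> ext_link_class MZ MW e f \<upsilon> d D.
               SUP P \<in> admissible_laws MZ MW e f \<sigma> \<eta> T.
               SUP \<phi> \<in> ellipsoid MZ e \<gamma> \<rho>.
                 \<integral>\<^sup>+s. ennreal (\<bar>l_hat e f h n (m_star \<gamma> \<upsilon> (real n)) s
                               - lin_functional h (coefs MZ e \<phi>)\<bar>\<^sup>2) \<partial>sample_law P \<phi> n)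
              \<le> ennreal (C * rate \<gamma> \<upsilon> h (real n)))"
proof -
  note ass1 = assms(1) and ass2 = assms(2)
  note pos = weights_pos[OF ass1] and one = weights_1[OF ass1] and mono = weights_mono[OF ass1]
  obtain c where c: "1 \<le> c" "\<And>j. 1 \<le> j \<Longrightarrow> real j ^ 3 \<le> c * \<gamma> j" using weights_cubic[OF ass1] by auto
  obtain G where G: "0 \<le> G" "\<And>k. (\<Sum>j=1..k. 1 / \<gamma> j) \<le> G" using weights_summable[OF ass1] by auto
  define k where "k = kappa \<gamma> \<upsilon>"
  have k: "0 < k" unfolding k_def by (rule kappa_pos[OF ass1 ass2])
  have D0: "0 < D" using assms by simp
  define mm where "mm n = m_star \<gamma> \<upsilon> (real n)" for n :: nat
  define R where "R n = rate \<gamma> \<upsilon> h (real n)" for n :: nat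
  have mm: "1 \<le> mm n" if "1 \<le> n" for n using m_star_ge_1[OF ass1, of "real n"] that by (simp add: mm_def)
  define b where "b = k / (128 * D * \<eta>\<^sup>2)"
  have b: "0 < b" using k D0 assms by (simp add: b_def)
  \<comment> \<open>The constants of the locale are restated outside it, in terms that mention
    neither bases nor laws, so that \<open>C\<close> can be chosen before these are
    quantified.\<close>
  define K4 where "K4 = 8 * (\<sigma> ^ 4 * \<eta> ^ 4 + (\<rho> * (1 + D * d))\<^sup>2 * G\<^sup>2 * (8 * (24 * \<eta> ^ 4 + 1)))"
  define K2 where "K2 = 2 * (\<sigma>\<^sup>2 + \<rho> * (1 + D * d) * G * \<eta>\<^sup>2)"
  define HH where "HH = (\<Sum>\<^sub>\<infinity>j\<in>{1..}. (h j)\<^sup>2 / \<gamma> j)"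
  define Hm where "Hm n = (\<Sum>j=1..mm n. (h j)\<^sup>2)" for n
  define E where "E = 120 * c ^ 4 / b ^ 5"
  define C1 where "C1 = 3 * K2 * D + 18 * D\<^sup>2 * (K4 + 24 * \<eta> ^ 4) * (c / k) + 6 * \<rho> * (1 + D * d)
         + 2 * (3 * K4 + 1) * HH * E + 2 * HH * \<rho> * E"
  define crude where "crude n = 2 * n * Hm n * (1 + (mm n)\<^sup>2 * (3 * K4 / (real n)\<^sup>2)) + 4 * \<rho> * (1 + D * d) * R n + HH * \<rho>" for n
  have K4: "0 \<le> K4" and K2: "0 \<le> K2" unfolding K4_def K2_def using assms D0 G
    by (auto intro!: add_nonneg_nonneg mult_nonneg_nonneg)
  have HH: "0 \<le> HH" unfolding HH_def by (intro infsum_nonneg) (auto intro!: divide_nonneg_nonneg less_imp_le[OF pos(1)])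
  have C1: "0 \<le> C1" unfolding C1_def E_def using K4 K2 HH D0 assms c k b
    by (auto intro!: add_nonneg_nonneg mult_nonneg_nonneg)
  have R0: "0 \<le> R n" for n
    unfolding R_def rate_def le_max_iff_disj
    using m_star_ge_1[OF ass1, of "real n"]
    by (intro disjI2 infsum_nonneg divide_nonneg_nonneg less_imp_le[OF pos(1)]) auto
  have crude0: "0 \<le> crude n" for n
    unfolding crude_def Hm_def using K4 HH R0[of n] assms D0
    by (intro add_nonneg_nonneg mult_nonneg_nonneg sum_nonneg) auto
  have "eventually (\<lambda>n. norm (real (mm n) ^ 3 * max \<bar>ln (R n)\<bar> (ln (real (mm n)))) \<le> b * norm (\<gamma> (mm n))) sequentially"
    using landau_o.smallD[OF assms(9) b] by (simp add: mm_def R_def)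
  moreover have "eventually (\<lambda>n. 4 * D / k \<le> \<gamma> (mm n)) sequentially"
    unfolding mm_def by (rule eventually_weights_large[OF ass1 ass2])
  ultimately obtain n0 where n0: "\<And>n. n0 \<le> n \<Longrightarrow> norm (real (mm n) ^ 3 * max \<bar>ln (R n)\<bar> (ln (real (mm n)))) \<le> b * norm (\<gamma> (mm n))"
      "\<And>n. n0 \<le> n \<Longrightarrow> 4 * D / k \<le> \<gamma> (mm n)"
    unfolding eventually_sequentially by (metis nle_le order_trans)
  \<comment> \<open>Every \<open>n\<close> below \<open>n0\<close> contributes its own ratio of
    crude bound to rate. Where the rate is 0 the quotient is 0 by convention, and that case is
    treated apart.\<close>
  define C where "C = C1 + (\<Sum>n=1..n0. crude n / R n) + 1"
  have sum0: "0 \<le> (\<Sum>n=1..n0. crude n / R n)" using crude0 R0 by (intro sum_nonneg divide_nonneg_nonneg)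
  have C: "0 < C" using C1 sum0 by (simp add: C_def)
  have main: "(\<integral>\<^sup>+s. ennreal (\<bar>l_hat e f h n (m_star \<gamma> \<upsilon> (real n)) s - lin_functional h (coefs MZ e \<phi>)\<bar>\<^sup>2) \<partial>sample_law P \<phi> n)
      \<le> ennreal (C * rate \<gamma> \<upsilon> h (real n))"
    if onb: "orthonormal_basis MZ e" "orthonormal_basis MW f" and n: "1 \<le> n"
      and T: "T \<in> ext_link_class MZ MW e f \<upsilon> d D" and P: "P \<in> admissible_laws MZ MW e f \<sigma> \<eta> T"
      and \<phi>: "\<phi> \<in> ellipsoid MZ e \<gamma> \<rho>"
    for MZ :: "'z measure" and MW :: "'w measure" and e f n T P \<phi>
  proof -
    interpret N: npiv MZ MW e f \<sigma> \<eta> T P \<gamma> \<upsilon> h d D \<rho> G \<phi> "mm n" n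
      by unfold_locales (use onb n T P \<phi> assms pos mono G mm[OF n] in auto)
    have eq: "(\<integral>\<^sup>+s. ennreal (\<bar>l_hat e f h n (m_star \<gamma> \<upsilon> (real n)) s - lin_functional h (coefs MZ e \<phi>)\<bar>\<^sup>2) \<partial>sample_law P \<phi> n)
       = (\<integral>\<^sup>+s. ennreal ((N.err s)\<^sup>2) \<partial>N.S)"
      unfolding mm_def[symmetric] N.err_def N.S_def power2_abs by (rule refl)
    have constants: "N.K4 = K4" "N.K2 = K2" "N.HH = HH" "N.Hm = Hm n"
      by (simp_all add: N.K4_def K4_def N.K2_def K2_def N.HH_def HH_def N.Hm_def Hm_def)
    note bounds = N.rate_bounds[OF mm_def, folded R_def]
    have crude: "(\<integral>\<^sup>+s. ennreal ((N.err s)\<^sup>2) \<partial>N.S) \<le> ennreal (crude n)"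
      by (rule order_trans[OF N.risk_crude ennreal_leI])
        (use bounds(1) assms D0 in \<open>auto simp: constants crude_def intro!: mult_left_mono\<close>)
    consider "R n = 0" | "0 < R n" "n0 \<le> n" | "0 < R n" "n < n0" using R0[of n] by fastforce
    then have "(\<integral>\<^sup>+s. ennreal ((N.err s)\<^sup>2) \<partial>N.S) \<le> ennreal (C * R n)"
    proof cases
      case 1
      \<comment> \<open>A vanishing rate forces the relevant coefficients of \<open>h\<close> to
        vanish, so the crude bound is 0; taking logarithms here would be meaningless, as
        \<open>ln 0\<close> is a default value.\<close>
      then have "N.Sh = 0" "N.Rh = 0" using bounds(4) by auto
      then have "HH = 0" "Hm n = 0"
        using N.HH_le one N.HH_nonneg N.Hm_nonneg by (auto simp: constants)
      then have "crude n = 0" using 1 by (simp add: crude_def)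
      then show ?thesis using crude 1 by simp
    next
      case 2
      have "(real (mm n))\<^sup>2 * \<bar>ln (R n)\<bar> \<le> real (mm n) ^ 3 * max \<bar>ln (R n)\<bar> (ln (real (mm n)))"
        using mm[OF n] by (intro mult_mono power_increasing) auto
      also have "\<dots> \<le> b * \<gamma> (mm n)"
        using n0(1)[OF 2(2)] pos(1)[OF mm[OF n]] by simp
      finally have ln: "(real (mm n))\<^sup>2 * \<bar>ln (R n)\<bar> \<le> k / (128 * D * \<eta>\<^sup>2) * \<gamma> (mm n)" by (simp add: b_def)
      have bal: "k * \<gamma> (mm n) \<le> n * \<upsilon> (mm n)"
        unfolding k_def mm_def by (rule kappa_bounds(2)[OF ass1 ass2 n])
      have large: "4 * D \<le> k * \<gamma> (mm n)" using n0(2)[OF 2(2)] k by (simp add: field_simps)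
      have "(\<integral>\<^sup>+s. ennreal ((N.err s)\<^sup>2) \<partial>N.S) \<le> ennreal (C1 * R n)"
        using N.risk_rate[OF k c(1) one bal c(2)[OF mm[OF n]] large 2(1) bounds(1,2) ln]
        unfolding constants C1_def E_def b_def .
      also have "\<dots> \<le> ennreal (C * R n)"
        using R0[of n] sum0 by (intro ennreal_leI mult_right_mono) (auto simp: C_def)
      finally show ?thesis .
    next
      case 3
      have "crude n / R n \<le> (\<Sum>n=1..n0. crude n / R n)"
        using 3 n crude0 R0 by (intro member_le_sum) auto
      then have "crude n / R n \<le> C" using C1 by (simp add: C_def)
      then have "crude n \<le> C * R n" using 3 by (simp add: divide_le_eq)
      then show ?thesis using crude by (meson ennreal_leI order_trans)
    qed
    then show ?thesis unfolding eq R_def .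
  qed
  show ?thesis
    using C main by (intro exI[of _ C]) (auto intro!: SUP_least)
qed

end
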